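(* Let $R$ be a fractionnally self fp-injective ring. If $R$ is a Bézout ring, then $R$ is a Kaplansky ring.
   Context: All rings are commutative with identity. For a ring $S$, $Q(S)$ denotes its classical ring of quotients. A ring $S$ is self fp-injective if $\mathrm{Ext}^1_S(F,S)=0$ for every finitely presented $S$-module $F$. $R$ is fractionnally self fp-injective if $Q(R/A)$ is self fp-injective for every proper ideal $A$ of $R$. $R$ is Bézout if every finitely generated ideal is principal. $R$ is a Kaplansky ring (elementary divisor ring) if for every matrix $A$ over $R$ there exist invertible matrices $P,Q$ and a diagonal matrix $D$ over $R$ such that $PAQ=D$. *)

theory Defs
  imports "HOL-Algebra.Algebra"
begin

definition regular_elem :: "('b, 'm) ring_scheme \<Rightarrow> 'b \<Rightarrow> bool" where
  "regular_elem S s \<longleftrightarrow> s \<in> carrier S \<and> (\<forall>x \<in> carrier S. s \<otimes>\<^bsub>S\<^esub> x = \<zero>\<^bsub>S\<^esub> \<longrightarrow> x = \<zero>\<^bsub>S\<^esub>)"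

definition frac_pairs :: "('b, 'm) ring_scheme \<Rightarrow> ('b \<times> 'b) set" where
  "frac_pairs S = carrier S \<times> {s. regular_elem S s}"

definition frac_rel :: "('b, 'm) ring_scheme \<Rightarrow> (('b \<times> 'b) \<times> ('b \<times> 'b)) set" where
  "frac_rel S = {((a, s), (b, t)). (a, s) \<in> frac_pairs S \<and> (b, t) \<in> frac_pairs S
                   \<and> a \<otimes>\<^bsub>S\<^esub> t = b \<otimes>\<^bsub>S\<^esub> s}"

definition frac_class :: "('b, 'm) ring_scheme \<Rightarrow> 'b \<Rightarrow> 'b \<Rightarrow> ('b \<times> 'b) set" where
  "frac_class S a s = frac_rel S `` {(a, s)}"

definition frac_mult :: "('b, 'm) ring_scheme \<Rightarrow> ('b \<times> 'b) set \<Rightarrow> ('b \<times> 'b) set \<Rightarrow> ('b \<times> 'b) set" where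
  "frac_mult S P Q = {z. \<exists>a s b t. (a, s) \<in> P \<and> (b, t) \<in> Q \<and> z \<in> frac_class S (a \<otimes>\<^bsub>S\<^esub> b) (s \<otimes>\<^bsub>S\<^esub> t)}"

definition frac_add :: "('b, 'm) ring_scheme \<Rightarrow> ('b \<times> 'b) set \<Rightarrow> ('b \<times> 'b) set \<Rightarrow> ('b \<times> 'b) set" where
  "frac_add S P Q = {z. \<exists>a s b t. (a, s) \<in> P \<and> (b, t) \<in> Q \<and>
                        z \<in> frac_class S ((a \<otimes>\<^bsub>S\<^esub> t) \<oplus>\<^bsub>S\<^esub> (b \<otimes>\<^bsub>S\<^esub> s)) (s \<otimes>\<^bsub>S\<^esub> t)}"

definition classical_quotient_ring :: "('b, 'm) ring_scheme \<Rightarrow> ('b \<times> 'b) set ring" where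
  "classical_quotient_ring S =
    \<lparr>carrier = frac_pairs S // frac_rel S,
     Group.monoid.mult = frac_mult S,
     one = frac_class S \<one>\<^bsub>S\<^esub> \<one>\<^bsub>S\<^esub>,
     ring.zero = frac_class S \<zero>\<^bsub>S\<^esub> \<one>\<^bsub>S\<^esub>,
     ring.add = frac_add S\<rparr>"

definition free_mod :: "('b, 'm) ring_scheme \<Rightarrow> nat \<Rightarrow> (nat \<Rightarrow> 'b) set" where
  "free_mod S n = {v. (\<forall>j<n. v j \<in> carrier S) \<and> (\<forall>j\<ge>n. v j = \<zero>\<^bsub>S\<^esub>)}"

definition vadd :: "('b, 'm) ring_scheme \<Rightarrow> (nat \<Rightarrow> 'b) \<Rightarrow> (nat \<Rightarrow> 'b) \<Rightarrow> nat \<Rightarrow> 'b" where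
  "vadd S u v = (\<lambda>j. u j \<oplus>\<^bsub>S\<^esub> v j)"

definition vsmult :: "('b, 'm) ring_scheme \<Rightarrow> 'b \<Rightarrow> (nat \<Rightarrow> 'b) \<Rightarrow> nat \<Rightarrow> 'b" where
  "vsmult S r v = (\<lambda>j. r \<otimes>\<^bsub>S\<^esub> v j)"

definition gen_submod :: "('b, 'm) ring_scheme \<Rightarrow> nat \<Rightarrow> nat \<Rightarrow> (nat \<Rightarrow> nat \<Rightarrow> 'b) \<Rightarrow> (nat \<Rightarrow> 'b) set" where
  "gen_submod S n m k =
     {(\<lambda>j. if j < n then finsum S (\<lambda>i. r i \<otimes>\<^bsub>S\<^esub> k i j) {..<m} else \<zero>\<^bsub>S\<^esub>) | r. \<forall>i<m. r i \<in> carrier S}"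

definition linear_on :: "('b, 'm) ring_scheme \<Rightarrow> (nat \<Rightarrow> 'b) set \<Rightarrow> ((nat \<Rightarrow> 'b) \<Rightarrow> 'b) \<Rightarrow> bool" where
  "linear_on S K f \<longleftrightarrow> (\<forall>v\<in>K. f v \<in> carrier S)
     \<and> (\<forall>u\<in>K. \<forall>v\<in>K. f (vadd S u v) = f u \<oplus>\<^bsub>S\<^esub> f v)
     \<and> (\<forall>r\<in>carrier S. \<forall>v\<in>K. f (vsmult S r v) = r \<otimes>\<^bsub>S\<^esub> f v)"

text \<open>Ext^1_S(F,S) = 0 for every finitely presented F.  Every finitely presented F is
  S^n/K with K a finitely generated submodule of S^n; from 0 -> K -> S^n -> F -> 0 and
  Ext^1(S^n,S)=0, Ext^1(F,S)=0 iff every S-linear map K -> S extends to S^n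
  (Hom(S^n,S) being given by dot product with c in S^n).\<close>
definition self_fp_injective :: "('b, 'm) ring_scheme \<Rightarrow> bool" where
  "self_fp_injective S \<longleftrightarrow>
    (\<forall>n m (k :: nat \<Rightarrow> nat \<Rightarrow> 'b) f.
       (\<forall>i<m. k i \<in> free_mod S n) \<longrightarrow> linear_on S (gen_submod S n m k) f \<longrightarrow>
       (\<exists>c\<in>free_mod S n. \<forall>v\<in>gen_submod S n m k. f v = finsum S (\<lambda>j. c j \<otimes>\<^bsub>S\<^esub> v j) {..<n}))"

definition frac_self_fp_injective :: "('a, 'm) ring_scheme \<Rightarrow> bool" where
  "frac_self_fp_injective R \<longleftrightarrow>
    (\<forall>A. ideal A R \<and> A \<noteq> carrier R \<longrightarrow> self_fp_injective (classical_quotient_ring (R Quot A)))"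

definition bezout_ring :: "('a, 'm) ring_scheme \<Rightarrow> bool" where
  "bezout_ring R \<longleftrightarrow> (\<forall>G. finite G \<and> G \<subseteq> carrier R \<longrightarrow> (\<exists>d\<in>carrier R. Idl\<^bsub>R\<^esub> G = PIdl\<^bsub>R\<^esub> d))"

definition is_mat :: "('a, 'm) ring_scheme \<Rightarrow> nat \<Rightarrow> nat \<Rightarrow> (nat \<Rightarrow> nat \<Rightarrow> 'a) \<Rightarrow> bool" where
  "is_mat R m n M \<longleftrightarrow> (\<forall>i<m. \<forall>j<n. M i j \<in> carrier R)"

definition mat_mul :: "('a, 'm) ring_scheme \<Rightarrow> nat \<Rightarrow> (nat \<Rightarrow> nat \<Rightarrow> 'a) \<Rightarrow> (nat \<Rightarrow> nat \<Rightarrow> 'a) \<Rightarrow> nat \<Rightarrow> nat \<Rightarrow> 'a" where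
  "mat_mul R l A B = (\<lambda>i j. finsum R (\<lambda>t. A i t \<otimes>\<^bsub>R\<^esub> B t j) {..<l})"

definition invertible_mat :: "('a, 'm) ring_scheme \<Rightarrow> nat \<Rightarrow> (nat \<Rightarrow> nat \<Rightarrow> 'a) \<Rightarrow> bool" where
  "invertible_mat R n P \<longleftrightarrow> is_mat R n n P \<and>
     (\<exists>P'. is_mat R n n P' \<and> (\<forall>i<n. \<forall>j<n.
        mat_mul R n P P' i j = (if i = j then \<one>\<^bsub>R\<^esub> else \<zero>\<^bsub>R\<^esub>) \<and>
        mat_mul R n P' P i j = (if i = j then \<one>\<^bsub>R\<^esub> else \<zero>\<^bsub>R\<^esub>)))"

definition kaplansky_ring :: "('a, 'm) ring_scheme \<Rightarrow> bool" where
  "kaplansky_ring R \<longleftrightarrow>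
    (\<forall>m n M. is_mat R m n M \<longrightarrow>
      (\<exists>P Q D. invertible_mat R m P \<and> invertible_mat R n Q \<and> is_mat R m n D \<and>
         (\<forall>i<m. \<forall>j<n. i \<noteq> j \<longrightarrow> D i j = \<zero>\<^bsub>R\<^esub>) \<and>
         (\<forall>i<m. \<forall>j<n. mat_mul R n (mat_mul R m P M) Q i j = D i j)))"

end

theory Submission
  imports Defs
begin

text \<open>
  If S = R/A is reduced, self fp-injectivity makes Q(S) von Neumann regular, and since S is
  Bezout the idempotents of Q(S) already lie in S; so modulo A every element has the
  annihilator of an idempotent. Suppose a family of pairs, closed under affine combinations,
  contains no comaximal pair. An ideal maximal among those modulo which this persists is radical,
  and its quotient has no nontrivial idempotents, so it is prime: the existence of a comaximal
  pair can be tested modulo prime ideals. This reduces both the Hermite property and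
  Kaplansky's condition on unimodular triangular matrices with rows (a, b) and (0, c) to the
  Bezout domains R/P. There the Hermite property follows from stable range 2. For Kaplansky's
  condition, lifting idempotents modulo the radical of c yields a factorization c = rs into
  comaximal factors such that r divides a power of a, and a = a1 a0 with a0 dividing s and a1
  comaximal to s; the Chinese remainder theorem and stable range 2 then finish the argument.
\<close>

section \<open>Comaximal elements\<close>

text \<open>Affine closure is what allows gluing: if e is idempotent modulo A and f = 1 - e, then f
  x + e x' agrees with x where e vanishes and with x' where f vanishes, so comaximal pairs over the
  two factors of R/A combine into one over R/A. Both problems have affine solution families: the
  cofactors with x = x' d, y = y' d form a coset of ann(d)^2, and the pairs (a x + b y, c y) form a
  submodule of R^2. Why all ideals are needed: R/P is a domain, so it has trivial idempotents only,
  and nothing is gained by splitting R/P itself. The useful idempotents live in the reduced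
  quotients of R/P by radicals of principal ideals; these are again quotients of R, but of a kind
  that cannot be fixed in advance, since c varies. There the idempotent separates the part of c on
  which a is nilpotent from the part on which a is a nonzerodivisor, and the two parts call for
  different congruence conditions on the unknowns x and y.\<close>

named_theorems carr "carrier memberships, passed to the algebra method"

text \<open>Compared with \<open>hermite_ring\<close>, the coefficients combine x and y instead of
  their cofactors: u x' + v y' equals 1 only up to the annihilator of d. This gap is what the
  reduction to prime quotients has to close.\<close>

definition gcd_ring :: "('a, 'm) ring_scheme \<Rightarrow> bool" where
  "gcd_ring R \<longleftrightarrow> (\<forall>x\<in>carrier R. \<forall>y\<in>carrier R.
     \<exists>d\<in>carrier R. \<exists>x'\<in>carrier R. \<exists>y'\<in>carrier R. \<exists>u\<in>carrier R. \<exists>v\<in>carrier R.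
       x = x' \<otimes>\<^bsub>R\<^esub> d \<and> y = y' \<otimes>\<^bsub>R\<^esub> d \<and> d = u \<otimes>\<^bsub>R\<^esub> x \<oplus>\<^bsub>R\<^esub> v \<otimes>\<^bsub>R\<^esub> y)"

definition comax :: "('a, 'm) ring_scheme \<Rightarrow> 'a \<Rightarrow> 'a \<Rightarrow> bool" where
  "comax R x y \<longleftrightarrow> (\<exists>u\<in>carrier R. \<exists>v\<in>carrier R. u \<otimes>\<^bsub>R\<^esub> x \<oplus>\<^bsub>R\<^esub> v \<otimes>\<^bsub>R\<^esub> y = \<one>\<^bsub>R\<^esub>)"

text \<open>By comaximality (x', y') completes to a matrix of determinant 1, which carries the row
  (x, y) to (d, 0). This is Kaplansky's notion of a Hermite ring.\<close>

definition hermite_ring :: "('a, 'm) ring_scheme \<Rightarrow> bool" where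
  "hermite_ring R \<longleftrightarrow> (\<forall>x\<in>carrier R. \<forall>y\<in>carrier R.
     \<exists>d\<in>carrier R. \<exists>x'\<in>carrier R. \<exists>y'\<in>carrier R.
       x = x' \<otimes>\<^bsub>R\<^esub> d \<and> y = y' \<otimes>\<^bsub>R\<^esub> d \<and> comax R x' y')"

text \<open>For a Hermite ring this says that the triangular matrix with rows (a, b) and (0, c) is
  equivalent to a diagonal one as soon as its entries generate the unit ideal.\<close>
definition kaplansky_condition :: "('a, 'm) ring_scheme \<Rightarrow> bool" where
  "kaplansky_condition R \<longleftrightarrow> (\<forall>a\<in>carrier R. \<forall>b\<in>carrier R. \<forall>c\<in>carrier R.
     (\<exists>\<alpha>\<in>carrier R. \<exists>\<beta>\<in>carrier R. \<exists>\<gamma>\<in>carrier R.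
        \<alpha> \<otimes>\<^bsub>R\<^esub> a \<oplus>\<^bsub>R\<^esub> \<beta> \<otimes>\<^bsub>R\<^esub> b \<oplus>\<^bsub>R\<^esub> \<gamma> \<otimes>\<^bsub>R\<^esub> c = \<one>\<^bsub>R\<^esub>) \<longrightarrow>
     (\<exists>x\<in>carrier R. \<exists>y\<in>carrier R. comax R (a \<otimes>\<^bsub>R\<^esub> x \<oplus>\<^bsub>R\<^esub> b \<otimes>\<^bsub>R\<^esub> y) (c \<otimes>\<^bsub>R\<^esub> y)))"

lemma hermite_ringE:
  assumes "hermite_ring R" "x \<in> carrier R" "y \<in> carrier R"
  obtains d x' y' where "d \<in> carrier R" "x' \<in> carrier R" "y' \<in> carrier R"
    "x = x' \<otimes>\<^bsub>R\<^esub> d" "y = y' \<otimes>\<^bsub>R\<^esub> d" "comax R x' y'"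
  using assms unfolding hermite_ring_def by blast

lemma gcd_ringE:
  assumes "gcd_ring R" "x \<in> carrier R" "y \<in> carrier R"
  obtains d x' y' u v where "d \<in> carrier R" "x' \<in> carrier R" "y' \<in> carrier R" "u \<in> carrier R" "v \<in> carrier R"
    "x = x' \<otimes>\<^bsub>R\<^esub> d" "y = y' \<otimes>\<^bsub>R\<^esub> d" "d = u \<otimes>\<^bsub>R\<^esub> x \<oplus>\<^bsub>R\<^esub> v \<otimes>\<^bsub>R\<^esub> y"
  using assms unfolding gcd_ring_def by blast

context cring
begin

lemma eq_by_diff:
  assumes "x \<ominus> y = \<zero>" "x \<in> carrier R" "y \<in> carrier R"
  shows "x = y"
  using assms r_right_minus_eq by blast

lemma comaxI: "\<lbrakk>u \<otimes> x \<oplus> v \<otimes> y = \<one>; u \<in> carrier R; v \<in> carrier R\<rbrakk> \<Longrightarrow> comax R x y"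
  unfolding comax_def by blast

lemma comaxE:
  assumes "comax R x y"
  obtains u v where "u \<in> carrier R" "v \<in> carrier R" "u \<otimes> x \<oplus> v \<otimes> y = \<one>"
  using assms unfolding comax_def by blast

lemma comax_sym:
  assumes "comax R x y" "x \<in> carrier R" "y \<in> carrier R"
  shows "comax R y x"
  using assms unfolding comax_def by (metis a_comm m_closed)

lemma comax_mult:
  assumes "comax R x y" "comax R x z" and [simp, carr]: "x \<in> carrier R" "y \<in> carrier R" "z \<in> carrier R"
  shows "comax R x (y \<otimes> z)"
proof -
  obtain u v where [simp, carr]: "u \<in> carrier R" "v \<in> carrier R" and e: "u \<otimes> x \<oplus> v \<otimes> y = \<one>"
    using assms(1) by (rule comaxE)
  obtain u' v' where [simp, carr]: "u' \<in> carrier R" "v' \<in> carrier R" and e': "u' \<otimes> x \<oplus> v' \<otimes> z = \<one>"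
    using assms(2) by (rule comaxE)
  \<comment> \<open>In the product of the two identities, v v' y z is the sole term that is not
    visibly a multiple of x.\<close>
  have "(u \<otimes> u' \<otimes> x \<oplus> u \<otimes> v' \<otimes> z \<oplus> v \<otimes> y \<otimes> u') \<otimes> x \<oplus> (v \<otimes> v') \<otimes> (y \<otimes> z)
      = (u \<otimes> x \<oplus> v \<otimes> y) \<otimes> (u' \<otimes> x \<oplus> v' \<otimes> z)"
    using carr by algebra
  also have "\<dots> = \<one>" by (simp add: e e')
  finally show ?thesis by (rule comaxI) auto
qed

lemma comax_one:
  assumes "x \<in> carrier R"
  shows "comax R x \<one>"
  by (rule comaxI[of \<zero> _ \<one>]) (use assms in auto)

lemma comax_pow:
  assumes "comax R x y" and [simp, carr]: "x \<in> carrier R" "y \<in> carrier R"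
  shows "comax R x (y [^] (n::nat))"
  by (induction n) (auto intro: comax_one comax_mult assms)

lemma comax_divisor:
  assumes "comax R x (y \<otimes> z)" and [simp, carr]: "x \<in> carrier R" "y \<in> carrier R" "z \<in> carrier R"
  shows "comax R x y"
proof -
  obtain u v where [simp, carr]: "u \<in> carrier R" "v \<in> carrier R" and e: "u \<otimes> x \<oplus> v \<otimes> (y \<otimes> z) = \<one>"
    using assms(1) by (rule comaxE)
  have "u \<otimes> x \<oplus> (v \<otimes> z) \<otimes> y = u \<otimes> x \<oplus> v \<otimes> (y \<otimes> z)" using carr by algebra
  then show ?thesis unfolding e by (rule comaxI) auto
qed

lemma comax_divides:
  assumes "comax R x y" "z divides y" and [simp, carr]: "x \<in> carrier R" "y \<in> carrier R" "z \<in> carrier R"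
  shows "comax R x z"
  using assms comax_divisor unfolding factor_def by metis

text \<open>Euclid's lemma: y is invertible modulo x.\<close>

lemma comax_cancel:
  assumes "comax R x y" "x divides (y \<otimes> z)" and [simp, carr]: "x \<in> carrier R" "y \<in> carrier R" "z \<in> carrier R"
  shows "x divides z"
proof -
  obtain u v where [simp, carr]: "u \<in> carrier R" "v \<in> carrier R" and e: "u \<otimes> x \<oplus> v \<otimes> y = \<one>"
    using assms(1) by (rule comaxE)
  obtain w where [simp, carr]: "w \<in> carrier R" and w: "y \<otimes> z = x \<otimes> w"
    using assms(2) unfolding factor_def by blast
  have "z = (u \<otimes> x \<oplus> v \<otimes> y) \<otimes> z" using e by simp
  also have "\<dots> = u \<otimes> x \<otimes> z \<oplus> v \<otimes> (y \<otimes> z)" using carr by algebra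
  also have "\<dots> = x \<otimes> (u \<otimes> z \<oplus> v \<otimes> w)" unfolding w using carr by algebra
  finally show ?thesis unfolding factor_def by auto
qed

lemma comax_add_multiple:
  assumes "comax R x y" and [simp, carr]: "x \<in> carrier R" "y \<in> carrier R" "k \<in> carrier R"
  shows "comax R x (y \<oplus> k \<otimes> x)"
proof -
  obtain u v where [simp, carr]: "u \<in> carrier R" "v \<in> carrier R" and e: "u \<otimes> x \<oplus> v \<otimes> y = \<one>"
    using assms(1) by (rule comaxE)
  have "(u \<ominus> v \<otimes> k) \<otimes> x \<oplus> v \<otimes> (y \<oplus> k \<otimes> x) = u \<otimes> x \<oplus> v \<otimes> y" using carr by algebra
  then show ?thesis unfolding e by (rule comaxI) auto
qed

text \<open>A divisor r of a power of a has a in its radical, so a may be dropped from a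
  unimodular triple containing r.\<close>
lemma comax_drop_radical:
  assumes "r divides (a [^] (m::nat))" "U \<otimes> r \<oplus> V \<otimes> t \<oplus> W \<otimes> a = \<one>"
    and [simp, carr]: "r \<in> carrier R" "a \<in> carrier R" "t \<in> carrier R" "U \<in> carrier R" "V \<in> carrier R" "W \<in> carrier R"
  shows "comax R r t"
proof -
  have "W \<otimes> a \<oplus> \<one> \<otimes> (V \<otimes> t \<oplus> U \<otimes> r) = U \<otimes> r \<oplus> V \<otimes> t \<oplus> W \<otimes> a" using carr by algebra
  then have "comax R a (V \<otimes> t \<oplus> U \<otimes> r)" unfolding assms(2) by (rule comaxI) auto
  \<comment> \<open>Comaximality passes from a to its powers and from a power to its divisor r; the
    summand U r may then be subtracted.\<close>
  then have "comax R (V \<otimes> t \<oplus> U \<otimes> r) (a [^] m)" by (intro comax_pow) (auto intro: comax_sym)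
  then have "comax R (V \<otimes> t \<oplus> U \<otimes> r) r" by (rule comax_divides[OF _ assms(1)]) auto
  then have "comax R r (V \<otimes> t \<oplus> U \<otimes> r)" by (rule comax_sym) auto
  then have "comax R r ((V \<otimes> t \<oplus> U \<otimes> r) \<oplus> (\<ominus> U) \<otimes> r)" by (rule comax_add_multiple) auto
  moreover have "(V \<otimes> t \<oplus> U \<otimes> r) \<oplus> (\<ominus> U) \<otimes> r = t \<otimes> V" using carr by algebra
  ultimately show ?thesis using comax_divisor by auto
qed

text \<open>Hermite rings have stable range 2. Write (x, y) = d (a, b) with \<mu> a + \<nu> b = 1.
  The vectors (a, b) and (-\<nu>, \<mu>) have determinant 1, hence form a basis of R^2. Adding z
  (-\<nu>, \<mu>) to (x, y) gives the vector with coordinates (d, z) in this basis, and d, z are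
  comaximal because d divides x and y.\<close>

lemma hermite_stable_range_2:
  assumes H: "hermite_ring R" and e: "p \<otimes> x \<oplus> q \<otimes> y \<oplus> r \<otimes> z = \<one>"
    and [simp, carr]: "p \<in> carrier R" "q \<in> carrier R" "r \<in> carrier R"
      "x \<in> carrier R" "y \<in> carrier R" "z \<in> carrier R"
  obtains k l where "k \<in> carrier R" "l \<in> carrier R" "comax R (x \<oplus> k \<otimes> z) (y \<oplus> l \<otimes> z)"
proof -
  obtain d a b where [simp, carr]: "d \<in> carrier R" "a \<in> carrier R" "b \<in> carrier R"
    and x: "x = a \<otimes> d" and y: "y = b \<otimes> d" and ab: "comax R a b"
    by (rule hermite_ringE[OF H \<open>x \<in> carrier R\<close> \<open>y \<in> carrier R\<close>])
  obtain \<mu> \<nu> where [simp, carr]: "\<mu> \<in> carrier R" "\<nu> \<in> carrier R" and mn: "\<mu> \<otimes> a \<oplus> \<nu> \<otimes> b = \<one>"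
    using ab by (rule comaxE)
  have mn': "\<mu> \<otimes> a = \<one> \<ominus> \<nu> \<otimes> b" unfolding mn[symmetric] using carr by algebra
  have e': "r \<otimes> z = \<one> \<ominus> (p \<otimes> a \<oplus> q \<otimes> b) \<otimes> d" unfolding e[symmetric] x y using carr by algebra
  let ?w = "p \<otimes> a \<oplus> q \<otimes> b"
  have "(?w \<otimes> \<mu> \<ominus> r \<otimes> b) \<otimes> (x \<oplus> (\<ominus> \<nu>) \<otimes> z) \<oplus> (?w \<otimes> \<nu> \<oplus> r \<otimes> a) \<otimes> (y \<oplus> \<mu> \<otimes> z)
     = (\<mu> \<otimes> a \<oplus> \<nu> \<otimes> b) \<otimes> (?w \<otimes> d) \<oplus> (r \<otimes> z) \<otimes> (\<mu> \<otimes> a \<oplus> \<nu> \<otimes> b)" unfolding x y using carr by algebra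
  also have "\<dots> = \<one>" unfolding mn e' using carr by algebra
  finally have "comax R (x \<oplus> (\<ominus> \<nu>) \<otimes> z) (y \<oplus> \<mu> \<otimes> z)" by (rule comaxI) auto
  then show ?thesis by (intro that) auto
qed

end

section \<open>Bezout domains: the Hermite property and Kaplansky's condition\<close>

lemma (in domain) gcd_ring_imp_hermite:
  assumes "gcd_ring R"
  shows "hermite_ring R"
  unfolding hermite_ring_def
proof (intro ballI)
  fix x y assume [simp, carr]: "x \<in> carrier R" "y \<in> carrier R"
  obtain d x' y' u v where [simp, carr]: "d \<in> carrier R" "x' \<in> carrier R" "y' \<in> carrier R" "u \<in> carrier R" "v \<in> carrier R"
    and x: "x = x' \<otimes> d" and y: "y = y' \<otimes> d" and d: "d = u \<otimes> x \<oplus> v \<otimes> y"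
    by (rule gcd_ringE[OF assms \<open>x \<in> carrier R\<close> \<open>y \<in> carrier R\<close>])
  show "\<exists>d\<in>carrier R. \<exists>x'\<in>carrier R. \<exists>y'\<in>carrier R. x = x' \<otimes> d \<and> y = y' \<otimes> d \<and> comax R x' y'"
  proof (cases "d = \<zero>")
    case True
    then have "x = \<one> \<otimes> d \<and> y = \<zero> \<otimes> d \<and> comax R \<one> \<zero>"
      using x y by (auto intro!: comaxI[of \<one> _ \<zero>])
    then show ?thesis using one_closed zero_closed \<open>d \<in> carrier R\<close> by blast
  next
    case False
    \<comment> \<open>The cofactor identity holds after multiplication by d, and in a domain d
      cancels.\<close>
    have "(u \<otimes> x' \<oplus> v \<otimes> y') \<otimes> d = u \<otimes> x \<oplus> v \<otimes> y" unfolding x y using carr by algebra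
    also have "\<dots> = \<one> \<otimes> d" using d by simp
    finally have "u \<otimes> x' \<oplus> v \<otimes> y' = \<one>"
      using m_rcancel[OF False \<open>d \<in> carrier R\<close>, of "u \<otimes> x' \<oplus> v \<otimes> y'" \<one>] by simp
    then have "comax R x' y'" by (rule comaxI) auto
    then show ?thesis using x y \<open>d \<in> carrier R\<close> \<open>x' \<in> carrier R\<close> \<open>y' \<in> carrier R\<close> by blast
  qed
qed

text \<open>With A the radical of cR: e is idempotent modulo A, and a and e have the same annihilator modulo A.\<close>
definition radically_split :: "('a, 'm) ring_scheme \<Rightarrow> 'a \<Rightarrow> 'a \<Rightarrow> 'a \<Rightarrow> bool" where
  "radically_split R c a e \<longleftrightarrow>
     (\<exists>n::nat. c divides\<^bsub>R\<^esub> ((e \<otimes>\<^bsub>R\<^esub> (\<one>\<^bsub>R\<^esub> \<ominus>\<^bsub>R\<^esub> e)) [^]\<^bsub>R\<^esub> n)) \<and>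
     (\<exists>n::nat. c divides\<^bsub>R\<^esub> ((a \<otimes>\<^bsub>R\<^esub> (\<one>\<^bsub>R\<^esub> \<ominus>\<^bsub>R\<^esub> e)) [^]\<^bsub>R\<^esub> n)) \<and>
     (\<forall>x\<in>carrier R. c divides\<^bsub>R\<^esub> (a \<otimes>\<^bsub>R\<^esub> x) \<longrightarrow> (\<exists>n::nat. c divides\<^bsub>R\<^esub> ((e \<otimes>\<^bsub>R\<^esub> x) [^]\<^bsub>R\<^esub> n)))"

text \<open>Modulo the radical of c the element e is idempotent, so the primes over c fall into
  those containing e, collected in r, and those containing f = 1 - e, collected in s. Since a f is
  nilpotent modulo c and f is a unit modulo r, a is nilpotent modulo r. Since e is a unit modulo s
  and has the annihilator of a, a is a nonzerodivisor modulo the radical of s; this forces the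
  cofactor a1 of the gcd of a and s to be comaximal to s.\<close>

lemma (in domain) comax_factorization:
  assumes H: "hermite_ring R" and c0: "c \<noteq> \<zero>" and sp: "radically_split R c a e"
    and [simp, carr]: "c \<in> carrier R" "a \<in> carrier R" "e \<in> carrier R"
  obtains r s a0 a1 s1 and m :: nat
  where "r \<in> carrier R" "s \<in> carrier R" "a0 \<in> carrier R" "a1 \<in> carrier R" "s1 \<in> carrier R"
    "c = r \<otimes> s" "comax R r s" "r divides (a [^] m)" "a = a1 \<otimes> a0" "s = s1 \<otimes> a0" "comax R a1 s"
proof -
  define f where "f = \<one> \<ominus> e"
  have [simp, carr]: "f \<in> carrier R" by (simp add: f_def)
  have ef: "comax R e f"
  proof (rule comaxI)
    show "\<one> \<otimes> e \<oplus> \<one> \<otimes> f = \<one>" unfolding f_def using carr by algebra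
  qed auto
  obtain n k :: nat where n: "c divides ((e \<otimes> f) [^] n)" and k: "c divides ((a \<otimes> f) [^] k)"
    and *: "\<And>x. \<lbrakk>x \<in> carrier R; c divides (a \<otimes> x)\<rbrakk> \<Longrightarrow> \<exists>n::nat. c divides ((e \<otimes> x) [^] n)"
    using sp unfolding radically_split_def f_def by blast
  have en: "e [^] n \<in> carrier R" by simp
  \<comment> \<open>r is a gcd of c and e^n in Hermite form, so that the cofactors s and g are
    comaximal.\<close>
  obtain s g r where [simp, carr]: "r \<in> carrier R" "s \<in> carrier R" "g \<in> carrier R"
    and c: "c = s \<otimes> r" and g: "e [^] n = g \<otimes> r" and sg: "comax R s g"
    by (rule hermite_ringE[OF H \<open>c \<in> carrier R\<close> en])
  have r0: "r \<noteq> \<zero>" using c c0 by auto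
  have efn: "comax R (e [^] n) (f [^] i)" for i :: nat
    by (intro comax_pow comax_sym[OF comax_pow[OF comax_sym[OF ef]]]) auto
  have re: "r divides (e [^] n)" unfolding factor_def g using m_comm by auto
  have rf: "comax R r (f [^] i)" for i :: nat
    by (rule comax_sym[OF comax_divides[OF comax_sym[OF efn] re]]) auto
  obtain w where [simp, carr]: "w \<in> carrier R" and w: "(e \<otimes> f) [^] n = c \<otimes> w"
    using n unfolding factor_def by blast
  \<comment> \<open>c = s r divides e^n f^n = g f^n r. Cancelling r, in a domain, and then g, which
    is comaximal to s, leaves s dividing f^n.\<close>
  have "(g \<otimes> f [^] n) \<otimes> r = (e \<otimes> f) [^] n"
    using g by (simp add: nat_pow_distrib m_ac)
  also have "\<dots> = (s \<otimes> w) \<otimes> r" unfolding w c using carr by algebra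
  finally have "g \<otimes> f [^] n = s \<otimes> w" using r0 by (simp add: m_rcancel)
  then have "s divides (g \<otimes> f [^] n)" unfolding factor_def by auto
  then have sf: "s divides (f [^] n)" by (rule comax_cancel[OF sg]) auto
  have rs: "comax R r s" by (rule comax_divides[OF rf sf]) auto
  have se: "comax R s (e [^] i)" for i :: nat
    by (intro comax_pow comax_sym[OF comax_divides[OF comax_pow[OF ef] sf]]) auto
  have rc: "r divides c" unfolding factor_def c using m_comm[of s r] by auto
  have sc: "s divides c" unfolding factor_def c by auto
  have "r divides (f [^] k \<otimes> a [^] k)"
    using divides_trans[OF rc k] by (simp add: nat_pow_distrib m_ac)
  then have ra: "r divides (a [^] k)" by (rule comax_cancel[OF rf]) auto
  obtain a0 a1 s1 where [simp, carr]: "a0 \<in> carrier R" "a1 \<in> carrier R" "s1 \<in> carrier R"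
    and a: "a = a1 \<otimes> a0" and s: "s = s1 \<otimes> a0" and as: "comax R a1 s1"
    by (rule hermite_ringE[OF H \<open>a \<in> carrier R\<close> \<open>s \<in> carrier R\<close>])
  \<comment> \<open>The witness s1 r is killed by a modulo c, hence e s1 r is nilpotent modulo c and
    so modulo s. Both e and r are units modulo s, so s1 is nilpotent modulo s, and comaximality of
    a1 with s1 extends to s.\<close>
  have "a \<otimes> (s1 \<otimes> r) = c \<otimes> a1" unfolding a c s using carr by algebra
  then have "c divides (a \<otimes> (s1 \<otimes> r))" unfolding factor_def by auto
  then obtain j :: nat where "c divides ((e \<otimes> (s1 \<otimes> r)) [^] j)" using *[of "s1 \<otimes> r"] by auto
  then have "s divides ((e \<otimes> (s1 \<otimes> r)) [^] j)" by (rule divides_trans[OF sc]) auto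
  then have "s divides (e [^] j \<otimes> (r [^] j \<otimes> s1 [^] j))" by (simp add: nat_pow_distrib m_ac)
  then have "s divides (r [^] j \<otimes> s1 [^] j)" by (rule comax_cancel[OF se]) auto
  moreover have "comax R s (r [^] j)" by (intro comax_pow comax_sym[OF rs]) auto
  ultimately have "s divides (s1 [^] j)" using comax_cancel by simp
  moreover have "comax R a1 (s1 [^] j)" by (intro comax_pow as) auto
  ultimately have "comax R a1 s" using comax_divides by simp
  have c': "c = r \<otimes> s" using c m_comm[of s r] by simp
  show ?thesis by (rule that[of r s a0 a1 s1 k]) fact+
qed

text \<open>Put t = a x + b y. Comaximality with c y = r s y is achieved factor by factor. Modulo s,
  the unknowns are chosen to make t congruent to 1. Modulo r, a is nilpotent and b is a unit, so t
  is a unit as soon as y is. Modulo y, t is a x = a1 a0 x, so y has to be comaximal to a1, a0 and x.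
  The first conditions are congruences modulo s and modulo r a1, solved by the Chinese remainder
  theorem; comaximality of x and y is then obtained by stable range 2 without disturbing
  them.\<close>

lemma (in domain) triangular_unimodular_value:
  assumes H: "hermite_ring R" and sp: "c \<noteq> \<zero> \<Longrightarrow> \<exists>e\<in>carrier R. radically_split R c a e"
    and abc: "\<alpha> \<otimes> a \<oplus> \<beta> \<otimes> b \<oplus> \<gamma> \<otimes> c = \<one>"
    and [simp, carr]: "\<alpha> \<in> carrier R" "\<beta> \<in> carrier R" "\<gamma> \<in> carrier R" "a \<in> carrier R" "b \<in> carrier R" "c \<in> carrier R"
  shows "\<exists>x\<in>carrier R. \<exists>y\<in>carrier R. comax R (a \<otimes> x \<oplus> b \<otimes> y) (c \<otimes> y)"
proof (cases "c = \<zero>")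
  case True
  have "\<one> \<otimes> (a \<otimes> \<alpha> \<oplus> b \<otimes> \<beta>) \<oplus> \<gamma> \<otimes> c = \<alpha> \<otimes> a \<oplus> \<beta> \<otimes> b \<oplus> \<gamma> \<otimes> c" using carr by algebra
  then have "\<one> \<otimes> (a \<otimes> \<alpha> \<oplus> b \<otimes> \<beta>) \<oplus> \<zero> \<otimes> (c \<otimes> \<beta>) = \<one>" using abc True by auto
  then have "comax R (a \<otimes> \<alpha> \<oplus> b \<otimes> \<beta>) (c \<otimes> \<beta>)" by (rule comaxI) auto
  then show ?thesis using \<open>\<alpha> \<in> carrier R\<close> \<open>\<beta> \<in> carrier R\<close> by blast
next
  case False
  then obtain e where e: "e \<in> carrier R" "radically_split R c a e" using sp by blast
  obtain r s a0 a1 s1 and m :: nat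
    where [simp, carr]: "r \<in> carrier R" "s \<in> carrier R" "a0 \<in> carrier R" "a1 \<in> carrier R" "s1 \<in> carrier R"
      and c: "c = r \<otimes> s" and rs: "comax R r s" and ra: "r divides (a [^] m)"
      and a: "a = a1 \<otimes> a0" and s: "s = s1 \<otimes> a0" and a1s: "comax R a1 s"
    by (rule comax_factorization[OF H False e(2) \<open>c \<in> carrier R\<close> \<open>a \<in> carrier R\<close> e(1)])
  \<comment> \<open>Both a and c are multiples of a0, so u a0 collects \<alpha> a + \<gamma> c = 1 -
    \<beta> b.\<close>
  define u where "u = \<alpha> \<otimes> a1 \<oplus> \<gamma> \<otimes> r \<otimes> s1"
  have [simp, carr]: "u \<in> carrier R" by (simp add: u_def)
  have uv: "u \<otimes> a0 = \<one> \<ominus> \<beta> \<otimes> b" unfolding abc[symmetric] u_def a c s using carr by algebra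
  have "comax R s (r \<otimes> a1)" by (intro comax_mult comax_sym[OF rs] comax_sym[OF a1s]) auto
  then obtain \<sigma> \<tau> where [simp, carr]: "\<sigma> \<in> carrier R" "\<tau> \<in> carrier R" and st: "\<sigma> \<otimes> s \<oplus> \<tau> \<otimes> (r \<otimes> a1) = \<one>"
    by (rule comaxE)
  have st': "\<tau> \<otimes> (r \<otimes> a1) = \<one> \<ominus> \<sigma> \<otimes> s" unfolding st[symmetric] using carr by algebra
  \<comment> \<open>Chinese remainders: \<tau> r a1 is 1 modulo s, and \<sigma> s is 1 modulo r a1.
    Thus y0 is \<beta> modulo s and 1 modulo r a1, while a1 x0 is u modulo s, which makes a x0 + b
    y0 congruent to u a0 + \<beta> b = 1 modulo s. Multiples of z = s r a1 can be added to x0 and y0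
    without changing this.\<close>
  define z where "z = s \<otimes> r \<otimes> a1"
  define x0 where "x0 = u \<otimes> \<tau> \<otimes> r"
  define y0 where "y0 = \<beta> \<otimes> (\<tau> \<otimes> (r \<otimes> a1)) \<oplus> \<sigma> \<otimes> s"
  have [simp, carr]: "z \<in> carrier R" "x0 \<in> carrier R" "y0 \<in> carrier R" by (simp_all add: z_def x0_def y0_def)
  have y1: "y0 = \<beta> \<oplus> s \<otimes> (\<sigma> \<ominus> \<beta> \<otimes> \<sigma>)" unfolding y0_def st' using carr by algebra
  have y2: "y0 = \<one> \<oplus> (r \<otimes> a1) \<otimes> (\<beta> \<otimes> \<tau> \<ominus> \<tau>)"
  proof -
    have "y0 = \<beta> \<otimes> (\<tau> \<otimes> (r \<otimes> a1)) \<oplus> (\<sigma> \<otimes> s \<oplus> \<tau> \<otimes> (r \<otimes> a1)) \<ominus> \<tau> \<otimes> (r \<otimes> a1)"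
      unfolding y0_def using carr by algebra
    also have "\<dots> = \<one> \<oplus> (r \<otimes> a1) \<otimes> (\<beta> \<otimes> \<tau> \<ominus> \<tau>)" unfolding st using carr by algebra
    finally show ?thesis .
  qed
  have x1: "a1 \<otimes> x0 = u \<ominus> u \<otimes> \<sigma> \<otimes> s"
  proof -
    have "a1 \<otimes> x0 = u \<otimes> (\<tau> \<otimes> (r \<otimes> a1))" unfolding x0_def using carr by algebra
    also have "\<dots> = u \<ominus> u \<otimes> \<sigma> \<otimes> s" unfolding st' using carr by algebra
    finally show ?thesis .
  qed
  define \<kappa> where "\<kappa> = a0 \<otimes> u \<otimes> \<sigma> \<ominus> b \<otimes> (\<sigma> \<ominus> \<beta> \<otimes> \<sigma>)"
  have [simp, carr]: "\<kappa> \<in> carrier R" by (simp add: \<kappa>_def)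
  have E1: "a \<otimes> x0 \<oplus> b \<otimes> y0 \<oplus> \<kappa> \<otimes> s = \<one>"
  proof -
    have "a \<otimes> x0 \<oplus> b \<otimes> y0 \<oplus> \<kappa> \<otimes> s = a0 \<otimes> (a1 \<otimes> x0) \<oplus> b \<otimes> y0 \<oplus> \<kappa> \<otimes> s" unfolding a using carr by algebra
    also have "\<dots> = u \<otimes> a0 \<oplus> \<beta> \<otimes> b" unfolding x1 y1 \<kappa>_def using carr by algebra
    also have "\<dots> = \<one>" unfolding uv using carr by algebra
    finally show ?thesis .
  qed
  define \<rho> where "\<rho> = \<tau> \<ominus> \<beta> \<otimes> \<tau>"
  have [simp, carr]: "\<rho> \<in> carrier R" by (simp add: \<rho>_def)
  have E2: "y0 \<oplus> \<rho> \<otimes> (r \<otimes> a1) = \<one>" unfolding \<rho>_def y2 using carr by algebra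
  \<comment> \<open>In the relation \<open>E1\<close> the term \<kappa> s is multiplied by 1 = y0 +
    \<rho> r a1; this turns it into a unimodular relation among x0, y0 and z, as stable range 2
    requires.\<close>
  have "a \<otimes> x0 \<oplus> (b \<oplus> \<kappa> \<otimes> s) \<otimes> y0 \<oplus> (\<kappa> \<otimes> \<rho>) \<otimes> z = a \<otimes> x0 \<oplus> b \<otimes> y0 \<oplus> \<kappa> \<otimes> s \<otimes> (y0 \<oplus> \<rho> \<otimes> (r \<otimes> a1))"
    unfolding z_def using carr by algebra
  also have "\<dots> = \<one>" unfolding E2 using E1 by simp
  finally obtain k l where [simp, carr]: "k \<in> carrier R" "l \<in> carrier R"
    and xy: "comax R (x0 \<oplus> k \<otimes> z) (y0 \<oplus> l \<otimes> z)"
    by (rule hermite_stable_range_2[OF H]) auto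
  define x where "x = x0 \<oplus> k \<otimes> z"
  define y where "y = y0 \<oplus> l \<otimes> z"
  have [simp, carr]: "x \<in> carrier R" "y \<in> carrier R" by (simp_all add: x_def y_def)
  have "(\<rho> \<ominus> l \<otimes> s) \<otimes> (r \<otimes> a1) \<oplus> \<one> \<otimes> y = y0 \<oplus> \<rho> \<otimes> (r \<otimes> a1)" unfolding y_def z_def using carr by algebra
  then have "(\<rho> \<ominus> l \<otimes> s) \<otimes> (r \<otimes> a1) \<oplus> \<one> \<otimes> y = \<one>" unfolding E2 .
  then have "comax R (r \<otimes> a1) y" by (rule comaxI) auto
  then have yra: "comax R y (r \<otimes> a1)" by (rule comax_sym) auto
  have yr: "comax R y r" by (rule comax_divisor[OF yra]) auto
  have ya1: "comax R y a1" by (rule comax_divisor[of _ _ r]) (use yra in \<open>auto simp: m_comm\<close>)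
  \<comment> \<open>a0 divides s and y is \<beta> modulo s, so b y is \<beta> b = 1 - u a0 modulo s,
    hence 1 modulo a0.\<close>
  have "b \<otimes> y \<oplus> (u \<ominus> s1 \<otimes> b \<otimes> (\<sigma> \<ominus> \<beta> \<otimes> \<sigma> \<oplus> l \<otimes> r \<otimes> a1)) \<otimes> a0 = u \<otimes> a0 \<oplus> \<beta> \<otimes> b"
    unfolding y_def z_def y1 s using carr by algebra
  also have "\<dots> = \<one>" unfolding uv using carr by algebra
  finally have ya0: "comax R y a0" by (rule comaxI) auto
  have "comax R y (a \<otimes> x)"
    unfolding a by (intro comax_mult ya1 ya0 comax_sym[OF xy[folded x_def y_def]]) auto
  then have "comax R y (a \<otimes> x \<oplus> b \<otimes> y)" by (rule comax_add_multiple) auto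
  moreover
  define t where "t = a \<otimes> x \<oplus> b \<otimes> y"
  have [simp, carr]: "t \<in> carrier R" by (simp add: t_def)
  ultimately have ty: "comax R t y" by (auto intro: comax_sym simp: t_def)
  have "\<one> \<otimes> t \<oplus> (\<kappa> \<ominus> a \<otimes> k \<otimes> r \<otimes> a1 \<ominus> b \<otimes> l \<otimes> r \<otimes> a1) \<otimes> s = a \<otimes> x0 \<oplus> b \<otimes> y0 \<oplus> \<kappa> \<otimes> s"
    unfolding t_def x_def y_def z_def using carr by algebra
  then have "\<one> \<otimes> t \<oplus> (\<kappa> \<ominus> a \<otimes> k \<otimes> r \<otimes> a1 \<ominus> b \<otimes> l \<otimes> r \<otimes> a1) \<otimes> s = \<one>" unfolding E1 .
  then have ts: "comax R t s" by (rule comaxI) auto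
  \<comment> \<open>Modulo r the term \<gamma> c disappears and a is nilpotent, so b is a unit
    there. As y is one too, t differs from the unit b y by the nilpotent a x.\<close>
  have "(\<gamma> \<otimes> s) \<otimes> r \<oplus> \<beta> \<otimes> b \<oplus> \<alpha> \<otimes> a = \<alpha> \<otimes> a \<oplus> \<beta> \<otimes> b \<oplus> \<gamma> \<otimes> c" unfolding c using carr by algebra
  then have "(\<gamma> \<otimes> s) \<otimes> r \<oplus> \<beta> \<otimes> b \<oplus> \<alpha> \<otimes> a = \<one>" unfolding abc .
  then have "comax R r b" by (rule comax_drop_radical[OF ra]) auto
  then have "comax R r (b \<otimes> y)" by (intro comax_mult comax_sym[OF yr]) auto
  then obtain U V where [simp, carr]: "U \<in> carrier R" "V \<in> carrier R" and UV: "U \<otimes> r \<oplus> V \<otimes> (b \<otimes> y) = \<one>"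
    by (rule comaxE)
  have "U \<otimes> r \<oplus> V \<otimes> t \<oplus> (\<ominus> (V \<otimes> x)) \<otimes> a = U \<otimes> r \<oplus> V \<otimes> (b \<otimes> y)" unfolding t_def using carr by algebra
  then have "U \<otimes> r \<oplus> V \<otimes> t \<oplus> (\<ominus> (V \<otimes> x)) \<otimes> a = \<one>" unfolding UV .
  then have "comax R r t" by (rule comax_drop_radical[OF ra]) auto
  then have "comax R t (r \<otimes> s \<otimes> y)" by (intro comax_mult ts ty comax_sym[of r t]) auto
  then have "comax R (a \<otimes> x \<oplus> b \<otimes> y) (c \<otimes> y)" unfolding t_def c .
  then show ?thesis using \<open>x \<in> carrier R\<close> \<open>y \<in> carrier R\<close> by blast
qed

section \<open>Quotient rings of reduced rings\<close>

context cring
begin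

lemma regular_elem_closed: "regular_elem R s \<Longrightarrow> s \<in> carrier R"
  by (simp add: regular_elem_def)

lemma regular_elem_eq_zero:
  "\<lbrakk>regular_elem R s; s \<otimes> x = \<zero>; x \<in> carrier R\<rbrakk> \<Longrightarrow> x = \<zero>"
  unfolding regular_elem_def by blast

lemma regular_elem_cancel:
  assumes "regular_elem R s" "s \<otimes> x = s \<otimes> y" "x \<in> carrier R" "y \<in> carrier R"
  shows "x = y"
proof -
  have [simp, carr]: "s \<in> carrier R" using assms(1) by (rule regular_elem_closed)
  have "s \<otimes> (x \<ominus> y) = s \<otimes> x \<ominus> s \<otimes> y" using assms(3,4) carr by algebra
  also have "\<dots> = \<zero>" using assms by (simp add: r_neg a_minus_def)
  finally have "x \<ominus> y = \<zero>" by (rule regular_elem_eq_zero[OF assms(1)]) (use assms(3,4) in simp)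
  then show ?thesis using assms eq_by_diff by blast
qed

lemma regular_elem_mult:
  assumes "regular_elem R s" "regular_elem R t"
  shows "regular_elem R (s \<otimes> t)"
proof -
  have [simp, carr]: "s \<in> carrier R" "t \<in> carrier R" using assms by (auto intro: regular_elem_closed)
  show ?thesis
    unfolding regular_elem_def
  proof (intro conjI ballI impI)
    fix x assume x: "x \<in> carrier R" "s \<otimes> t \<otimes> x = \<zero>"
    then have "s \<otimes> (t \<otimes> x) = \<zero>" using m_assoc[of s t x] by simp
    then have "t \<otimes> x = \<zero>" using assms(1) x unfolding regular_elem_def by simp
    then show "x = \<zero>" using assms(2) x unfolding regular_elem_def by simp
  qed simp
qed

lemma regular_elem_divisor:
  assumes "regular_elem R (s \<otimes> t)" "s \<in> carrier R" "t \<in> carrier R"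
  shows "regular_elem R s"
  unfolding regular_elem_def
proof (intro conjI ballI impI)
  fix x assume x: "x \<in> carrier R" "s \<otimes> x = \<zero>"
  have "(s \<otimes> t) \<otimes> x = t \<otimes> (s \<otimes> x)" using assms(2,3) x(1) by (simp add: m_ac)
  then show "x = \<zero>" using assms x unfolding regular_elem_def by simp
qed (use assms in auto)

lemma regular_elem_one: "regular_elem R \<one>"
  by (simp add: regular_elem_def)

section \<open>Arithmetic in the classical ring of quotients\<close>

lemma frac_class_eq_iff:
  assumes "a \<in> carrier R" "regular_elem R s" "b \<in> carrier R" "regular_elem R t"
  shows "frac_class R a s = frac_class R b t \<longleftrightarrow> a \<otimes> t = b \<otimes> s"
proof -
  have "equiv (frac_pairs R) (frac_rel R)"
  proof (rule equivI)
    show "frac_rel R \<subseteq> frac_pairs R \<times> frac_pairs R" by (auto simp: frac_rel_def)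
    show "refl_on (frac_pairs R) (frac_rel R)" by (auto simp: refl_on_def frac_rel_def frac_pairs_def)
    show "sym (frac_rel R)" by (auto simp: sym_def frac_rel_def)
    show "trans (frac_rel R)"
    proof (rule transI)
      fix p q r assume "(p, q) \<in> frac_rel R" "(q, r) \<in> frac_rel R"
      then obtain a s b t c w where p: "p = (a, s)" "q = (b, t)" "r = (c, w)"
        and [simp, carr]: "a \<in> carrier R" "b \<in> carrier R" "c \<in> carrier R"
        and reg: "regular_elem R s" "regular_elem R t" "regular_elem R w"
        and e1: "a \<otimes> t = b \<otimes> s" and e2: "b \<otimes> w = c \<otimes> t"
        unfolding frac_rel_def frac_pairs_def by auto
      have [simp, carr]: "s \<in> carrier R" "t \<in> carrier R" "w \<in> carrier R"
        using reg by (auto intro: regular_elem_closed)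
      \<comment> \<open>Transitivity: the middle denominator t is regular and cancels.\<close>
      have "t \<otimes> (a \<otimes> w) = (a \<otimes> t) \<otimes> w" by (simp add: m_ac)
      also have "\<dots> = s \<otimes> (b \<otimes> w)" unfolding e1 by (simp add: m_ac)
      also have "\<dots> = t \<otimes> (c \<otimes> s)" unfolding e2 by (simp add: m_ac)
      finally have "a \<otimes> w = c \<otimes> s" using regular_elem_cancel[OF reg(2)] by auto
      then show "(p, r) \<in> frac_rel R" unfolding frac_rel_def frac_pairs_def using reg p by auto
    qed
  qed
  then have "frac_class R a s = frac_class R b t \<longleftrightarrow> ((a, s), (b, t)) \<in> frac_rel R"
    unfolding frac_class_def using assms by (intro eq_equiv_class_iff) (auto simp: frac_pairs_def)
  then show ?thesis using assms by (auto simp: frac_rel_def frac_pairs_def)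
qed

lemma mem_frac_class_iff:
  assumes "a \<in> carrier R" "regular_elem R s"
  shows "(b, t) \<in> frac_class R a s \<longleftrightarrow> b \<in> carrier R \<and> regular_elem R t \<and> frac_class R b t = frac_class R a s"
proof -
  have "(b, t) \<in> frac_class R a s \<longleftrightarrow> b \<in> carrier R \<and> regular_elem R t \<and> a \<otimes> t = b \<otimes> s"
    using assms by (auto simp: frac_class_def frac_rel_def frac_pairs_def)
  then show ?thesis using assms frac_class_eq_iff[of a s b t] by auto
qed

text \<open>\<open>frac_mult\<close> takes the union over all representatives of both factors;
  independence of the representatives is what collapses this union to a single class.\<close>

lemma frac_mult_class:
  assumes [simp, carr]: "a \<in> carrier R" "b \<in> carrier R" and reg: "regular_elem R s" "regular_elem R t"
  shows "frac_mult R (frac_class R a s) (frac_class R b t) = frac_class R (a \<otimes> b) (s \<otimes> t)"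
proof -
  have *: "frac_class R (a' \<otimes> b') (s' \<otimes> t') = frac_class R (a \<otimes> b) (s \<otimes> t)"
    if [simp, carr]: "a' \<in> carrier R" "b' \<in> carrier R" and reg': "regular_elem R s'" "regular_elem R t'"
      and eq: "frac_class R a' s' = frac_class R a s" "frac_class R b' t' = frac_class R b t" for a' b' s' t'
  proof -
    have [simp, carr]: "s \<in> carrier R" "t \<in> carrier R" "s' \<in> carrier R" "t' \<in> carrier R"
      using reg reg' by (auto intro: regular_elem_closed)
    have e: "a' \<otimes> s = a \<otimes> s'" "b' \<otimes> t = b \<otimes> t'" using eq reg reg' by (auto simp: frac_class_eq_iff)
    have "(a' \<otimes> b') \<otimes> (s \<otimes> t) = (a' \<otimes> s) \<otimes> (b' \<otimes> t)" using carr by algebra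
    also have "\<dots> = (a \<otimes> b) \<otimes> (s' \<otimes> t')" unfolding e using carr by algebra
    finally show ?thesis using reg reg' by (subst frac_class_eq_iff) (auto intro: regular_elem_mult)
  qed
  show ?thesis (is "?L = ?R")
  proof
    show "?L \<subseteq> ?R"
    proof
      fix z assume "z \<in> ?L"
      then obtain a' s' b' t' where m: "(a', s') \<in> frac_class R a s" "(b', t') \<in> frac_class R b t"
        and z: "z \<in> frac_class R (a' \<otimes> b') (s' \<otimes> t')"
        unfolding frac_mult_def by blast
      show "z \<in> ?R"
        using z m[unfolded mem_frac_class_iff[OF assms(1) reg(1)] mem_frac_class_iff[OF assms(2) reg(2)]]
          *[of a' b' s' t'] by blast
    qed
    have "(a, s) \<in> frac_class R a s" "(b, t) \<in> frac_class R b t"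
      using assms by (simp_all add: mem_frac_class_iff)
    then show "?R \<subseteq> ?L" unfolding frac_mult_def by blast
  qed
qed

lemma frac_add_class:
  assumes [simp, carr]: "a \<in> carrier R" "b \<in> carrier R" and reg: "regular_elem R s" "regular_elem R t"
  shows "frac_add R (frac_class R a s) (frac_class R b t) = frac_class R (a \<otimes> t \<oplus> b \<otimes> s) (s \<otimes> t)"
proof -
  have *: "frac_class R (a' \<otimes> t' \<oplus> b' \<otimes> s') (s' \<otimes> t') = frac_class R (a \<otimes> t \<oplus> b \<otimes> s) (s \<otimes> t)"
    if [simp, carr]: "a' \<in> carrier R" "b' \<in> carrier R" and reg': "regular_elem R s'" "regular_elem R t'"
      and eq: "frac_class R a' s' = frac_class R a s" "frac_class R b' t' = frac_class R b t" for a' b' s' t'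
  proof -
    have [simp, carr]: "s \<in> carrier R" "t \<in> carrier R" "s' \<in> carrier R" "t' \<in> carrier R"
      using reg reg' by (auto intro: regular_elem_closed)
    have e: "a' \<otimes> s = a \<otimes> s'" "b' \<otimes> t = b \<otimes> t'" using eq reg reg' by (auto simp: frac_class_eq_iff)
    have "(a' \<otimes> t' \<oplus> b' \<otimes> s') \<otimes> (s \<otimes> t) = (a' \<otimes> s) \<otimes> (t \<otimes> t') \<oplus> (b' \<otimes> t) \<otimes> (s \<otimes> s')" using carr by algebra
    also have "\<dots> = (a \<otimes> t \<oplus> b \<otimes> s) \<otimes> (s' \<otimes> t')" unfolding e using carr by algebra
    finally show ?thesis using reg reg' by (subst frac_class_eq_iff) (auto intro: regular_elem_mult)
  qed
  show ?thesis (is "?L = ?R")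
  proof
    show "?L \<subseteq> ?R"
    proof
      fix z assume "z \<in> ?L"
      then obtain a' s' b' t' where m: "(a', s') \<in> frac_class R a s" "(b', t') \<in> frac_class R b t"
        and z: "z \<in> frac_class R (a' \<otimes> t' \<oplus> b' \<otimes> s') (s' \<otimes> t')"
        unfolding frac_add_def by blast
      show "z \<in> ?R"
        using z m[unfolded mem_frac_class_iff[OF assms(1) reg(1)] mem_frac_class_iff[OF assms(2) reg(2)]]
          *[of a' b' s' t'] by blast
    qed
    have "(a, s) \<in> frac_class R a s" "(b, t) \<in> frac_class R b t"
      using assms by (simp_all add: mem_frac_class_iff)
    then show "?R \<subseteq> ?L" unfolding frac_add_def by blast
  qed
qed

lemma classical_quotient_carrier_iff:
  "P \<in> carrier (classical_quotient_ring R) \<longleftrightarrow> (\<exists>a s. a \<in> carrier R \<and> regular_elem R s \<and> P = frac_class R a s)"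
  by (auto simp: classical_quotient_ring_def quotient_def frac_pairs_def frac_class_def)

lemma classical_quotient_simps:
  "monoid.mult (classical_quotient_ring R) = frac_mult R"
  "ring.add (classical_quotient_ring R) = frac_add R"
  "monoid.one (classical_quotient_ring R) = frac_class R \<one> \<one>"
  "ring.zero (classical_quotient_ring R) = frac_class R \<zero> \<one>"
  by (simp_all add: classical_quotient_ring_def)

text \<open>Supplies the laws of addition behind \<open>finsum\<close>, so that the sums in
  \<open>gen_submod\<close> and in \<open>self_fp_injective\<close> can be evaluated over the ring
  of quotients.\<close>

lemma classical_quotient_abelian_monoid: "abelian_monoid (classical_quotient_ring R)"
proof (rule abelian_monoidI)
  let ?Q = "classical_quotient_ring R"
  show "\<zero>\<^bsub>?Q\<^esub> \<in> carrier ?Q"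
    unfolding classical_quotient_carrier_iff classical_quotient_simps using regular_elem_one by blast
  fix x y z assume "x \<in> carrier ?Q" "y \<in> carrier ?Q" "z \<in> carrier ?Q"
  then obtain a s b t c w where ac: "a \<in> carrier R" "b \<in> carrier R" "c \<in> carrier R"
    and reg: "regular_elem R s" "regular_elem R t" "regular_elem R w"
    and x: "x = frac_class R a s" and y: "y = frac_class R b t" and z: "z = frac_class R c w"
    unfolding classical_quotient_carrier_iff by blast
  note [simp, carr] = ac
  have [simp, carr]: "s \<in> carrier R" "t \<in> carrier R" "w \<in> carrier R"
    using reg by (auto intro: regular_elem_closed)
  note reg' = reg regular_elem_mult[OF reg(1,2)] regular_elem_mult[OF reg(2,3)]
  note sm = classical_quotient_simps x y z frac_add_class reg' regular_elem_one
  show "x \<oplus>\<^bsub>?Q\<^esub> y \<in> carrier ?Q"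
    unfolding classical_quotient_carrier_iff
    by (rule exI[of _ "a \<otimes> t \<oplus> b \<otimes> s"], rule exI[of _ "s \<otimes> t"]) (simp add: sm)
  have "(a \<otimes> t \<oplus> b \<otimes> s) \<otimes> w \<oplus> c \<otimes> (s \<otimes> t) = a \<otimes> (t \<otimes> w) \<oplus> (b \<otimes> w \<oplus> c \<otimes> t) \<otimes> s"
    using carr by algebra
  then show "x \<oplus>\<^bsub>?Q\<^esub> y \<oplus>\<^bsub>?Q\<^esub> z = x \<oplus>\<^bsub>?Q\<^esub> (y \<oplus>\<^bsub>?Q\<^esub> z)"
    by (simp add: sm m_assoc)
  show "x \<oplus>\<^bsub>?Q\<^esub> y = y \<oplus>\<^bsub>?Q\<^esub> x"
    by (simp add: sm m_comm[of t s] a_comm)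
  show "\<zero>\<^bsub>?Q\<^esub> \<oplus>\<^bsub>?Q\<^esub> x = x" by (simp add: sm)
qed

text \<open>The map sending the multiple x times a^2 to x times a, defined on the ideal generated by
  a^2 in Q(R), is well defined because R is reduced; its extension to Q(R) provides a
  quasi-inverse of a.\<close>
lemma reduced_quasi_inverse:
  assumes inj: "self_fp_injective (classical_quotient_ring R)"
    and red: "\<And>x. \<lbrakk>x \<in> carrier R; x \<otimes> x = \<zero>\<rbrakk> \<Longrightarrow> x = \<zero>"
    and [simp, carr]: "a \<in> carrier R"
  obtains x s where "x \<in> carrier R" "regular_elem R s" "x \<otimes> a \<otimes> a = a \<otimes> s"
proof -
  let ?Q = "classical_quotient_ring R"
  interpret Q: abelian_monoid ?Q by (rule classical_quotient_abelian_monoid)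
  define k where "k = (\<lambda>(i::nat) (j::nat). if j < 1 then frac_class R (a \<otimes> a) \<one> else \<zero>\<^bsub>?Q\<^esub>)"
  \<comment> \<open>The graph of the map from x a^2 / t to x a / t, on vectors of length 1 padded
    with zeros. As the representation of a vector by x and t is not unique, \<open>g\<close> is
    first chosen from the graph and then shown to be determined by it.\<close>
  define P where "P = (\<lambda>v q. \<exists>x t. x \<in> carrier R \<and> regular_elem R t \<and>
      v = (\<lambda>j::nat. if j < 1 then frac_class R (x \<otimes> (a \<otimes> a)) t else \<zero>\<^bsub>?Q\<^esub>) \<and> q = frac_class R (x \<otimes> a) t)"
  define g where "g = (\<lambda>v. SOME q. P v q)"
  have clQ: "frac_class R x t \<in> carrier ?Q" if "x \<in> carrier R" "regular_elem R t" for x t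
    using that classical_quotient_carrier_iff by blast
  have sum1: "finsum ?Q h {..<1::nat} = h 0" if "h 0 \<in> carrier ?Q" for h
    using that by (simp add: lessThan_Suc Q.finsum_insert)
  have uniq: "q = q'" if "P v q" "P v q'" for v q q'
  proof -
    obtain x t y w where [simp, carr]: "x \<in> carrier R" "y \<in> carrier R" and reg: "regular_elem R t" "regular_elem R w"
      and v: "v = (\<lambda>j::nat. if j < 1 then frac_class R (x \<otimes> (a \<otimes> a)) t else \<zero>\<^bsub>?Q\<^esub>)"
        "v = (\<lambda>j::nat. if j < 1 then frac_class R (y \<otimes> (a \<otimes> a)) w else \<zero>\<^bsub>?Q\<^esub>)"
      and q: "q = frac_class R (x \<otimes> a) t" "q' = frac_class R (y \<otimes> a) w"
      using \<open>P v q\<close> \<open>P v q'\<close> unfolding P_def by blast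
    have [simp, carr]: "t \<in> carrier R" "w \<in> carrier R" using reg by (auto intro: regular_elem_closed)
    have "frac_class R (x \<otimes> (a \<otimes> a)) t = frac_class R (y \<otimes> (a \<otimes> a)) w"
      using fun_cong[OF v(1), of 0] fun_cong[OF v(2), of 0] by simp
    then have e: "x \<otimes> (a \<otimes> a) \<otimes> w = y \<otimes> (a \<otimes> a) \<otimes> t" using reg by (simp add: frac_class_eq_iff)
    define D where "D = x \<otimes> a \<otimes> w \<ominus> y \<otimes> a \<otimes> t"
    have D[simp, carr]: "D \<in> carrier R" by (simp add: D_def)
    \<comment> \<open>D is a (x w - y t), so its square is x w - y t times the cross difference for
      a^2, which vanishes. Reducedness then gives D = 0.\<close>
    have "D \<otimes> D = (x \<otimes> w \<ominus> y \<otimes> t) \<otimes> (x \<otimes> (a \<otimes> a) \<otimes> w \<ominus> y \<otimes> (a \<otimes> a) \<otimes> t)"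
      unfolding D_def using carr by algebra
    also have "\<dots> = \<zero>" unfolding e using carr by algebra
    finally have "D = \<zero>" using red D by blast
    then have "x \<otimes> a \<otimes> w = y \<otimes> a \<otimes> t" unfolding D_def by (rule eq_by_diff) auto
    then show ?thesis unfolding q using reg by (simp add: frac_class_eq_iff)
  qed
  have gP: "g v = q" if "P v q" for v q
    unfolding g_def using that uniq by (intro some_equality) blast+
  let ?K = "gen_submod ?Q 1 1 k"
  have PI: "P (\<lambda>j::nat. if j < 1 then frac_class R (x \<otimes> (a \<otimes> a)) t else \<zero>\<^bsub>?Q\<^esub>) (frac_class R (x \<otimes> a) t)"
    if "x \<in> carrier R" "regular_elem R t" for x t
    unfolding P_def using that by blast
  have K: "\<exists>q. P v q" if "v \<in> ?K" for v
  proof -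
    obtain r where r: "r 0 \<in> carrier ?Q"
      and v: "v = (\<lambda>j. if j < 1 then finsum ?Q (\<lambda>i. r i \<otimes>\<^bsub>?Q\<^esub> k i j) {..<1::nat} else \<zero>\<^bsub>?Q\<^esub>)"
      using \<open>v \<in> ?K\<close> unfolding gen_submod_def by blast
    obtain x t where x: "x \<in> carrier R" "regular_elem R t" and rx: "r 0 = frac_class R x t"
      using r unfolding classical_quotient_carrier_iff by blast
    have [simp, carr]: "t \<in> carrier R" using x by (auto intro: regular_elem_closed)
    have "r 0 \<otimes>\<^bsub>?Q\<^esub> k 0 0 = frac_class R (x \<otimes> (a \<otimes> a)) t"
      unfolding rx k_def using x by (simp add: classical_quotient_simps frac_mult_class regular_elem_one)
    then have "finsum ?Q (\<lambda>i. r i \<otimes>\<^bsub>?Q\<^esub> k i 0) {..<1::nat} = frac_class R (x \<otimes> (a \<otimes> a)) t"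
      using clQ x by (subst sum1) auto
    then have "v = (\<lambda>j. if j < 1 then frac_class R (x \<otimes> (a \<otimes> a)) t else \<zero>\<^bsub>?Q\<^esub>)"
      unfolding v by (intro ext) (auto simp del: One_nat_def)
    then show ?thesis using PI[OF x] by blast
  qed
  have kF: "\<forall>i<1. k i \<in> free_mod ?Q 1" using clQ regular_elem_one by (auto simp: k_def free_mod_def)
  have lin: "linear_on ?Q ?K g"
    unfolding linear_on_def
  proof (intro conjI ballI)
    fix v assume "v \<in> ?K"
    then obtain x t where x[simp, carr]: "x \<in> carrier R" and reg: "regular_elem R t"
      and v: "v = (\<lambda>j. if j < 1 then frac_class R (x \<otimes> (a \<otimes> a)) t else \<zero>\<^bsub>?Q\<^esub>)"
      using K unfolding P_def by blast
    have [simp, carr]: "t \<in> carrier R" using reg by (auto intro: regular_elem_closed)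
    have gv: "g v = frac_class R (x \<otimes> a) t" using gP PI[OF x reg] v by blast
    show "g v \<in> carrier ?Q" unfolding gv using clQ reg by simp
    {
      fix u assume "u \<in> ?K"
      then obtain y w where y[simp, carr]: "y \<in> carrier R" and reg2: "regular_elem R w"
        and u: "u = (\<lambda>j. if j < 1 then frac_class R (y \<otimes> (a \<otimes> a)) w else \<zero>\<^bsub>?Q\<^esub>)"
        using K unfolding P_def by blast
      have [simp, carr]: "w \<in> carrier R" using reg2 by (auto intro: regular_elem_closed)
      have gu: "g u = frac_class R (y \<otimes> a) w" using gP PI[OF y reg2] u by blast
      have e1: "y \<otimes> (a \<otimes> a) \<otimes> t \<oplus> x \<otimes> (a \<otimes> a) \<otimes> w = (y \<otimes> t \<oplus> x \<otimes> w) \<otimes> (a \<otimes> a)"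
        using carr by algebra
      have e2: "y \<otimes> a \<otimes> t \<oplus> x \<otimes> a \<otimes> w = (y \<otimes> t \<oplus> x \<otimes> w) \<otimes> a"
        using carr by algebra
      have "vadd ?Q u v = (\<lambda>j. if j < 1 then frac_class R ((y \<otimes> t \<oplus> x \<otimes> w) \<otimes> (a \<otimes> a)) (w \<otimes> t) else \<zero>\<^bsub>?Q\<^esub>)"
        unfolding vadd_def u v e1[symmetric] using reg reg2
        by (intro ext) (auto simp: classical_quotient_simps frac_add_class regular_elem_one)
      then have "g (vadd ?Q u v) = frac_class R ((y \<otimes> t \<oplus> x \<otimes> w) \<otimes> a) (w \<otimes> t)"
        using gP PI regular_elem_mult[OF reg2 reg] by auto
      also have "\<dots> = g u \<oplus>\<^bsub>?Q\<^esub> g v"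
        unfolding gu gv e2[symmetric] using reg reg2 by (simp add: classical_quotient_simps frac_add_class)
      finally show "g (vadd ?Q u v) = g u \<oplus>\<^bsub>?Q\<^esub> g v" .
    }
    fix r assume "r \<in> carrier ?Q"
    then obtain y w where [simp, carr]: "y \<in> carrier R" and reg2: "regular_elem R w" and r: "r = frac_class R y w"
      unfolding classical_quotient_carrier_iff by blast
    have [simp, carr]: "w \<in> carrier R" using reg2 by (auto intro: regular_elem_closed)
    have "vsmult ?Q r v = (\<lambda>j. if j < 1 then frac_class R ((y \<otimes> x) \<otimes> (a \<otimes> a)) (w \<otimes> t) else \<zero>\<^bsub>?Q\<^esub>)"
      unfolding vsmult_def v r using reg reg2 regular_elem_mult[OF reg2 regular_elem_one]
      by (intro ext) (auto simp: classical_quotient_simps frac_mult_class regular_elem_one m_assoc frac_class_eq_iff)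
    then have "g (vsmult ?Q r v) = frac_class R ((y \<otimes> x) \<otimes> a) (w \<otimes> t)"
      using gP PI regular_elem_mult[OF reg2 reg] by auto
    also have "\<dots> = r \<otimes>\<^bsub>?Q\<^esub> g v"
      unfolding gv r using reg reg2 by (simp add: classical_quotient_simps frac_mult_class m_assoc)
    finally show "g (vsmult ?Q r v) = r \<otimes>\<^bsub>?Q\<^esub> g v" .
  qed
  from inj[unfolded self_fp_injective_def, THEN spec, of 1, THEN spec, of 1, THEN spec, of k, THEN spec, of g] kF lin
  obtain c where c: "c \<in> free_mod ?Q 1"
    and gc: "\<And>v. v \<in> ?K \<Longrightarrow> g v = finsum ?Q (\<lambda>j. c j \<otimes>\<^bsub>?Q\<^esub> v j) {..<1::nat}"
    by blast
  obtain x s where [simp, carr]: "x \<in> carrier R" and reg: "regular_elem R s" and cx: "c 0 = frac_class R x s"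
    using c unfolding free_mod_def classical_quotient_carrier_iff by auto
  have [simp, carr]: "s \<in> carrier R" using reg by (auto intro: regular_elem_closed)
  have kc: "k 0 0 \<in> carrier ?Q" unfolding k_def using clQ regular_elem_one by simp
  have one: "\<one>\<^bsub>?Q\<^esub> \<otimes>\<^bsub>?Q\<^esub> k 0 0 = k 0 0"
    unfolding k_def by (simp add: classical_quotient_simps frac_mult_class regular_elem_one)
  \<comment> \<open>The generator a^2 lies in the submodule with coefficient 1. There the map takes
    the value a, whereas its extension takes the value (x / s) a^2.\<close>
  have "k 0 = (\<lambda>j. if j < 1 then finsum ?Q (\<lambda>i. \<one>\<^bsub>?Q\<^esub> \<otimes>\<^bsub>?Q\<^esub> k i j) {..<1::nat} else \<zero>\<^bsub>?Q\<^esub>)"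
  proof
    fix j
    show "k 0 j = (if j < 1 then finsum ?Q (\<lambda>i. \<one>\<^bsub>?Q\<^esub> \<otimes>\<^bsub>?Q\<^esub> k i j) {..<1::nat} else \<zero>\<^bsub>?Q\<^esub>)"
      using kc one by (cases "j = 0") (auto simp: sum1[unfolded One_nat_def] k_def)
  qed
  moreover have "\<one>\<^bsub>?Q\<^esub> \<in> carrier ?Q" unfolding classical_quotient_simps using clQ regular_elem_one by simp
  ultimately have k0: "k 0 \<in> ?K"
    unfolding gen_submod_def by (auto intro!: exI[of _ "\<lambda>_. \<one>\<^bsub>?Q\<^esub>"])
  have prod: "c 0 \<otimes>\<^bsub>?Q\<^esub> k 0 0 = frac_class R (x \<otimes> (a \<otimes> a)) s"
    unfolding cx k_def using reg by (simp add: classical_quotient_simps frac_mult_class regular_elem_one)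
  have "k 0 = (\<lambda>j. if j < 1 then frac_class R (\<one> \<otimes> (a \<otimes> a)) \<one> else \<zero>\<^bsub>?Q\<^esub>)"
    unfolding k_def by (intro ext) simp
  then have "g (k 0) = frac_class R (\<one> \<otimes> a) \<one>" using gP PI[OF one_closed regular_elem_one] by auto
  moreover have "g (k 0) = frac_class R (x \<otimes> (a \<otimes> a)) s"
    unfolding gc[OF k0] using prod clQ reg by (subst sum1) auto
  ultimately have "frac_class R (x \<otimes> (a \<otimes> a)) s = frac_class R a \<one>" by simp
  then have "x \<otimes> (a \<otimes> a) = a \<otimes> s" using reg regular_elem_one by (simp add: frac_class_eq_iff)
  then show ?thesis using that[of x s] reg by (simp add: m_assoc)
qed

text \<open>In the ring of quotients E = x a / s is idempotent, because (x a)^2 = x a s, and a E =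
  a. Dividing x a and s by their gcd d, which is regular as a divisor of s, writes E = w / t with u
  w + v t = 1; this puts E into R.\<close>

lemma gcd_ring_annihilator_idempotent:
  assumes G: "gcd_ring R" and reg: "regular_elem R s" and xs: "x \<otimes> a \<otimes> a = a \<otimes> s"
    and [simp, carr]: "x \<in> carrier R" "a \<in> carrier R"
  obtains e where "e \<in> carrier R" "e \<otimes> e = e" "a \<otimes> e = a"
    "\<And>y. \<lbrakk>y \<in> carrier R; a \<otimes> y = \<zero>\<rbrakk> \<Longrightarrow> e \<otimes> y = \<zero>"
proof -
  have s[simp, carr]: "s \<in> carrier R" using reg by (rule regular_elem_closed)
  have xa: "x \<otimes> a \<in> carrier R" by simp
  obtain d w t u v where [simp, carr]: "d \<in> carrier R" "w \<in> carrier R" "t \<in> carrier R" "u \<in> carrier R" "v \<in> carrier R"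
    and w: "x \<otimes> a = w \<otimes> d" and t: "s = t \<otimes> d" and d: "d = u \<otimes> (x \<otimes> a) \<oplus> v \<otimes> s"
    by (rule gcd_ringE[OF G xa s])
  have rt: "regular_elem R t" by (rule regular_elem_divisor[of t d]) (use reg t in auto)
  have rd: "regular_elem R d" by (rule regular_elem_divisor[of d t]) (use reg t in \<open>auto simp: m_comm\<close>)
  have "d \<otimes> (u \<otimes> w \<oplus> v \<otimes> t) = u \<otimes> (w \<otimes> d) \<oplus> v \<otimes> (t \<otimes> d)" using carr by algebra
  also have "\<dots> = d \<otimes> \<one>" using d unfolding w[symmetric] t[symmetric] by simp
  finally have uv: "u \<otimes> w \<oplus> v \<otimes> t = \<one>" by (rule regular_elem_cancel[OF rd]) auto
  have "d \<otimes> (a \<otimes> w) = a \<otimes> (w \<otimes> d)" using carr by algebra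
  also have "\<dots> = a \<otimes> s" unfolding w[symmetric] xs[symmetric] using carr by algebra
  also have "\<dots> = d \<otimes> (a \<otimes> t)" unfolding t using carr by algebra
  finally have aX: "a \<otimes> w = a \<otimes> t" by (rule regular_elem_cancel[OF rd]) auto
  have "d \<otimes> (w \<otimes> w) = (w \<otimes> d) \<otimes> w" using carr by algebra
  also have "\<dots> = x \<otimes> (a \<otimes> w)" unfolding w[symmetric] by (rule m_assoc) auto
  also have "\<dots> = (x \<otimes> a) \<otimes> t" unfolding aX by (rule m_assoc[symmetric]) auto
  also have "\<dots> = d \<otimes> (w \<otimes> t)" unfolding w using carr by algebra
  finally have XX: "w \<otimes> w = w \<otimes> t" by (rule regular_elem_cancel[OF rd]) auto
  \<comment> \<open>For the idempotent E = w / t both w E and t E equal w, so multiplying u w + v t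
    = 1 by E gives E = (u + v) w.\<close>
  define e where "e = (u \<oplus> v) \<otimes> w"
  have [simp, carr]: "e \<in> carrier R" by (simp add: e_def)
  have "t \<otimes> e = u \<otimes> (w \<otimes> t) \<oplus> v \<otimes> t \<otimes> w" unfolding e_def using carr by algebra
  also have "\<dots> = (u \<otimes> w \<oplus> v \<otimes> t) \<otimes> w" unfolding XX[symmetric] using carr by algebra
  finally have te: "t \<otimes> e = w" unfolding uv by simp
  have "t \<otimes> (t \<otimes> (e \<otimes> e)) = (t \<otimes> e) \<otimes> (t \<otimes> e)" using carr by algebra
  also have "\<dots> = t \<otimes> (t \<otimes> e)" unfolding te XX by (rule m_comm) auto
  finally have ee: "e \<otimes> e = e" using regular_elem_cancel[OF rt] by auto
  have "t \<otimes> (a \<otimes> e) = a \<otimes> (t \<otimes> e)" using carr by algebra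
  also have "\<dots> = t \<otimes> a" unfolding te aX by (rule m_comm) auto
  finally have ae: "a \<otimes> e = a" by (rule regular_elem_cancel[OF rt]) auto
  have "e \<otimes> y = \<zero>" if [simp, carr]: "y \<in> carrier R" and y: "a \<otimes> y = \<zero>" for y
  proof -
    have "d \<otimes> (t \<otimes> (e \<otimes> y)) = ((t \<otimes> e) \<otimes> d) \<otimes> y" using carr by algebra
    also have "\<dots> = x \<otimes> (a \<otimes> y)" unfolding te w[symmetric] by (rule m_assoc) auto
    also have "\<dots> = \<zero>" using y by simp
    finally have "t \<otimes> (e \<otimes> y) = \<zero>" by (rule regular_elem_eq_zero[OF rd]) auto
    then show ?thesis by (rule regular_elem_eq_zero[OF rt]) auto
  qed
  then show ?thesis using that[of e] ee ae by auto
qed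

end

section \<open>Reduction to prime quotients\<close>

lemma (in cring) bezout_imp_gcd_ring:
  assumes "bezout_ring R"
  shows "gcd_ring R"
  unfolding gcd_ring_def
proof (intro ballI)
  fix x y assume xy: "x \<in> carrier R" "y \<in> carrier R"
  obtain d where d: "d \<in> carrier R" and eq: "Idl {x, y} = PIdl d"
    using assms xy unfolding bezout_ring_def by (metis empty_subsetI finite.emptyI finite_insert insert_subset)
  have "x \<in> PIdl d" "y \<in> PIdl d" using genideal_self[of "{x, y}"] xy eq by auto
  then obtain x' y' where x': "x' \<in> carrier R" "x = x' \<otimes> d" and y': "y' \<in> carrier R" "y = y' \<otimes> d"
    unfolding cgenideal_def by blast
  have "x \<in> PIdl x <+>\<^bsub>R\<^esub> PIdl y" "y \<in> PIdl x <+>\<^bsub>R\<^esub> PIdl y"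
    using union_genideal[OF cgenideal_ideal cgenideal_ideal, OF xy] genideal_self[of "PIdl x \<union> PIdl y"]
      cgenideal_self[OF xy(1)] cgenideal_self[OF xy(2)] ideal.Icarr[OF cgenideal_ideal[OF xy(1)]]
      ideal.Icarr[OF cgenideal_ideal[OF xy(2)]] by blast+
  then have "Idl {x, y} \<subseteq> PIdl x <+>\<^bsub>R\<^esub> PIdl y"
    by (intro genideal_minimal add_ideals cgenideal_ideal xy) auto
  then have "d \<in> PIdl x <+>\<^bsub>R\<^esub> PIdl y" using cgenideal_self[OF d] eq by blast
  then obtain u v where uv: "u \<in> carrier R" "v \<in> carrier R" "d = u \<otimes> x \<oplus> v \<otimes> y"
    unfolding set_add_def' cgenideal_def by auto
  show "\<exists>d\<in>carrier R. \<exists>x'\<in>carrier R. \<exists>y'\<in>carrier R. \<exists>u\<in>carrier R. \<exists>v\<in>carrier R.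
      x = x' \<otimes> d \<and> y = y' \<otimes> d \<and> d = u \<otimes> x \<oplus> v \<otimes> y"
    by (intro bexI[of _ d] bexI[of _ x'] bexI[of _ y'] bexI[of _ u] bexI[of _ v] conjI) fact+
qed

context ideal
begin

lemma rcos_eq_zero_iff:
  assumes "x \<in> carrier R"
  shows "I +> x = \<zero>\<^bsub>R Quot I\<^esub> \<longleftrightarrow> x \<in> I"
  using a_rcos_self[OF assms] a_rcos_const by (auto simp: FactRing_def)

lemma rcos_surj:
  assumes "y \<in> carrier (R Quot I)"
  obtains x where "x \<in> carrier R" "y = I +> x"
  using assms unfolding FactRing_def A_RCOSETS_def' by auto

end

lemma (in ideal) gcd_ring_quotient:
  assumes "gcd_ring R"
  shows "gcd_ring (R Quot I)"
  unfolding gcd_ring_def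
proof (intro ballI)
  interpret h: ring_hom_ring R "R Quot I" "(+>) I" by (rule rcos_ring_hom_ring)
  fix xx yy assume xy: "xx \<in> carrier (R Quot I)" "yy \<in> carrier (R Quot I)"
  obtain x where x: "x \<in> carrier R" "xx = I +> x" by (rule rcos_surj[OF xy(1)])
  obtain y where y: "y \<in> carrier R" "yy = I +> y" by (rule rcos_surj[OF xy(2)])
  obtain d x' y' u v where c: "d \<in> carrier R" "x' \<in> carrier R" "y' \<in> carrier R" "u \<in> carrier R" "v \<in> carrier R"
    and e: "x = x' \<otimes> d" "y = y' \<otimes> d" "d = u \<otimes> x \<oplus> v \<otimes> y"
    by (rule gcd_ringE[OF assms x(1) y(1)])
  have "xx = (I +> x') \<otimes>\<^bsub>R Quot I\<^esub> (I +> d)" "yy = (I +> y') \<otimes>\<^bsub>R Quot I\<^esub> (I +> d)"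
    unfolding x(2) y(2) e(1) e(2) using c by simp_all
  moreover have "I +> d = (I +> u) \<otimes>\<^bsub>R Quot I\<^esub> xx \<oplus>\<^bsub>R Quot I\<^esub> (I +> v) \<otimes>\<^bsub>R Quot I\<^esub> yy"
    unfolding x(2) y(2) using c x(1) y(1) by (subst e(3)) simp
  ultimately show "\<exists>d\<in>carrier (R Quot I). \<exists>x'\<in>carrier (R Quot I). \<exists>y'\<in>carrier (R Quot I).
      \<exists>u\<in>carrier (R Quot I). \<exists>v\<in>carrier (R Quot I).
      xx = x' \<otimes>\<^bsub>R Quot I\<^esub> d \<and> yy = y' \<otimes>\<^bsub>R Quot I\<^esub> d \<and> d = u \<otimes>\<^bsub>R Quot I\<^esub> xx \<oplus>\<^bsub>R Quot I\<^esub> v \<otimes>\<^bsub>R Quot I\<^esub> yy"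
    using h.hom_closed[OF c(1)] h.hom_closed[OF c(2)] h.hom_closed[OF c(3)] h.hom_closed[OF c(4)] h.hom_closed[OF c(5)]
    by blast
qed

text \<open>Every reduced quotient R/A is a p.p. ring (weak Baer ring): the annihilator of a modulo
  A is generated by the idempotent 1 - e. Working with membership in A avoids cosets and makes the
  property usable for preimages of ideals.\<close>

definition radical_split_ring :: "('a, 'm) ring_scheme \<Rightarrow> bool" where
  "radical_split_ring R \<longleftrightarrow> (\<forall>A a. ideal A R \<longrightarrow> (\<forall>x\<in>carrier R. x \<otimes>\<^bsub>R\<^esub> x \<in> A \<longrightarrow> x \<in> A) \<longrightarrow> a \<in> carrier R \<longrightarrow>
     (\<exists>e\<in>carrier R. e \<otimes>\<^bsub>R\<^esub> (\<one>\<^bsub>R\<^esub> \<ominus>\<^bsub>R\<^esub> e) \<in> A \<and> a \<otimes>\<^bsub>R\<^esub> (\<one>\<^bsub>R\<^esub> \<ominus>\<^bsub>R\<^esub> e) \<in> A \<and>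
        (\<forall>x\<in>carrier R. a \<otimes>\<^bsub>R\<^esub> x \<in> A \<longrightarrow> e \<otimes>\<^bsub>R\<^esub> x \<in> A)))"

lemma radical_split_ringE:
  assumes "radical_split_ring R" "ideal A R" "\<And>x. \<lbrakk>x \<in> carrier R; x \<otimes>\<^bsub>R\<^esub> x \<in> A\<rbrakk> \<Longrightarrow> x \<in> A" "a \<in> carrier R"
  obtains e where "e \<in> carrier R" "e \<otimes>\<^bsub>R\<^esub> (\<one>\<^bsub>R\<^esub> \<ominus>\<^bsub>R\<^esub> e) \<in> A" "a \<otimes>\<^bsub>R\<^esub> (\<one>\<^bsub>R\<^esub> \<ominus>\<^bsub>R\<^esub> e) \<in> A"
    "\<And>x. \<lbrakk>x \<in> carrier R; a \<otimes>\<^bsub>R\<^esub> x \<in> A\<rbrakk> \<Longrightarrow> e \<otimes>\<^bsub>R\<^esub> x \<in> A"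
  using assms(1)[unfolded radical_split_ring_def, THEN spec, of A, THEN spec, of a] assms(2-4) by blast

lemma (in cring) frac_self_fp_injective_imp_radical_split:
  assumes inj: "frac_self_fp_injective R" and G: "gcd_ring R"
  shows "radical_split_ring R"
  unfolding radical_split_ring_def
proof (intro allI impI)
  fix A a assume A: "ideal A R" and rad: "\<forall>x\<in>carrier R. x \<otimes> x \<in> A \<longrightarrow> x \<in> A" and a: "a \<in> carrier R"
  interpret A: ideal A R by (rule A)
  show "\<exists>e\<in>carrier R. e \<otimes> (\<one> \<ominus> e) \<in> A \<and> a \<otimes> (\<one> \<ominus> e) \<in> A \<and> (\<forall>x\<in>carrier R. a \<otimes> x \<in> A \<longrightarrow> e \<otimes> x \<in> A)"
  proof (cases "A = carrier R")
    \<comment> \<open>\<open>frac_self_fp_injective\<close> speaks of proper ideals; for the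
      improper one all memberships are trivial.\<close>
    case True
    then show ?thesis using a by (intro bexI[of _ \<one>]) auto
  next
    case False
    let ?S = "R Quot A"
    interpret S: cring ?S by (rule A.quotient_is_cring[OF cring_axioms])
    interpret h: ring_hom_ring R ?S "(+>) A" by (rule A.rcos_ring_hom_ring)
    have red: "Y = \<zero>\<^bsub>?S\<^esub>" if Y: "Y \<in> carrier ?S" "Y \<otimes>\<^bsub>?S\<^esub> Y = \<zero>\<^bsub>?S\<^esub>" for Y
    proof -
      obtain y where y: "y \<in> carrier R" "Y = A +> y" by (rule A.rcos_surj[OF Y(1)])
      have "A +> (y \<otimes> y) = \<zero>\<^bsub>?S\<^esub>" using Y(2) y by simp
      then have "y \<otimes> y \<in> A" using y(1) A.rcos_eq_zero_iff[of "y \<otimes> y"] by simp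
      then have "y \<in> A" using rad y(1) by blast
      then show ?thesis using y A.rcos_eq_zero_iff by simp
    qed
    have "self_fp_injective (classical_quotient_ring ?S)"
      using inj A False unfolding frac_self_fp_injective_def by blast
    then obtain x s where xs: "x \<in> carrier ?S" "regular_elem ?S s" "x \<otimes>\<^bsub>?S\<^esub> (A +> a) \<otimes>\<^bsub>?S\<^esub> (A +> a) = (A +> a) \<otimes>\<^bsub>?S\<^esub> s"
      by (rule S.reduced_quasi_inverse[OF _ red h.hom_closed[OF a]])
    obtain E where E: "E \<in> carrier ?S" "E \<otimes>\<^bsub>?S\<^esub> E = E" "(A +> a) \<otimes>\<^bsub>?S\<^esub> E = A +> a"
      "\<And>y. \<lbrakk>y \<in> carrier ?S; (A +> a) \<otimes>\<^bsub>?S\<^esub> y = \<zero>\<^bsub>?S\<^esub>\<rbrakk> \<Longrightarrow> E \<otimes>\<^bsub>?S\<^esub> y = \<zero>\<^bsub>?S\<^esub>"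
      by (rule S.gcd_ring_annihilator_idempotent[OF A.gcd_ring_quotient[OF G] xs(2,3,1) h.hom_closed[OF a]]) blast
    obtain e where e: "e \<in> carrier R" "E = A +> e" by (rule A.rcos_surj[OF E(1)])
    have *: "b \<otimes> (\<one> \<ominus> e) \<in> A" if b: "b \<in> carrier R" "(A +> b) \<otimes>\<^bsub>?S\<^esub> E = A +> b" for b
    proof -
      have "b \<otimes> (\<one> \<ominus> e) = b \<ominus> b \<otimes> e"
        using b(1) e(1) by (simp add: a_minus_def r_distr r_minus)
      then have "A +> (b \<otimes> (\<one> \<ominus> e)) = (A +> b) \<ominus>\<^bsub>?S\<^esub> ((A +> b) \<otimes>\<^bsub>?S\<^esub> E)"
        using b(1) e by (simp add: a_minus_def S.minus_eq)
      also have "\<dots> = \<zero>\<^bsub>?S\<^esub>" unfolding b(2) using h.hom_closed[OF b(1)] by (simp add: S.minus_eq S.r_neg)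
      finally show ?thesis using A.rcos_eq_zero_iff[of "b \<otimes> (\<one> \<ominus> e)"] b(1) e(1) by simp
    qed
    have "e \<otimes> x \<in> A" if x: "x \<in> carrier R" "a \<otimes> x \<in> A" for x
    proof -
      have "(A +> a) \<otimes>\<^bsub>?S\<^esub> (A +> x) = \<zero>\<^bsub>?S\<^esub>"
        using A.rcos_eq_zero_iff[of "a \<otimes> x"] x a by simp
      then have "A +> (e \<otimes> x) = \<zero>\<^bsub>?S\<^esub>" using E(4)[OF h.hom_closed[OF x(1)]] e x(1) by simp
      then show ?thesis using A.rcos_eq_zero_iff[of "e \<otimes> x"] x e by simp
    qed
    then show ?thesis using *[OF e(1)] *[OF a] E(2,3) e by blast
  qed
qed

text \<open>An ideal maximal among those modulo which the family has no comaximal pair is radical and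
  admits no nontrivial idempotents, hence is prime.\<close>
lemma (in cring) comax_local_global:
  assumes split: "radical_split_ring R"
    and V: "V \<subseteq> carrier R \<times> carrier R" "V \<noteq> {}"
    and affine: "\<And>x y x' y' e f. \<lbrakk>(x, y) \<in> V; (x', y') \<in> V; e \<in> carrier R; f \<in> carrier R; f \<oplus> e = \<one>\<rbrakk>
       \<Longrightarrow> (f \<otimes> x \<oplus> e \<otimes> x', f \<otimes> y \<oplus> e \<otimes> y') \<in> V"
    and prime: "\<And>P. primeideal P R \<Longrightarrow> \<exists>(x, y)\<in>V. comax (R Quot P) (P +> x) (P +> y)"
  shows "\<exists>(x, y)\<in>V. comax R x y"
proof (rule ccontr)
  assume no: "\<not> ?thesis"
  \<comment> \<open>The union of the ideals (x, y) over all pairs in V. It is closed under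
    multiplication by R but in general not under addition; it contains 1 exactly if some pair in V
    is comaximal.\<close>
  define T where "T = {p \<otimes> x \<oplus> q \<otimes> y | p q x y. p \<in> carrier R \<and> q \<in> carrier R \<and> (x, y) \<in> V}"
  have T1: "\<one> \<notin> T"
  proof
    assume "\<one> \<in> T"
    then obtain p q x y where "p \<in> carrier R" "q \<in> carrier R" "(x, y) \<in> V" "p \<otimes> x \<oplus> q \<otimes> y = \<one>"
      unfolding T_def by force
    then show False using no unfolding comax_def by blast
  qed
  have TE: "thesis" if "t \<in> T" and "\<And>p q x y. \<lbrakk>p \<in> carrier R; q \<in> carrier R; x \<in> carrier R; y \<in> carrier R; (x, y) \<in> V;
      t = p \<otimes> x \<oplus> q \<otimes> y\<rbrakk> \<Longrightarrow> thesis" for t thesis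
    using that V unfolding T_def by blast
  have TI: "p \<otimes> x \<oplus> q \<otimes> y \<in> T" if "p \<in> carrier R" "q \<in> carrier R" "(x, y) \<in> V" for p q x y
    using that unfolding T_def by blast
  have Tc: "t \<in> carrier R" if "t \<in> T" for t
    by (rule TE[OF that]) simp
  have Tm: "t \<otimes> r \<in> T" if t: "t \<in> T" and r: "r \<in> carrier R" for t r
  proof (rule TE[OF t])
    fix p q x y assume c: "p \<in> carrier R" "q \<in> carrier R" "x \<in> carrier R" "y \<in> carrier R" and xy: "(x, y) \<in> V"
      and t': "t = p \<otimes> x \<oplus> q \<otimes> y"
    have "t \<otimes> r = (p \<otimes> r) \<otimes> x \<oplus> (q \<otimes> r) \<otimes> y"
      unfolding t' using c r by algebra
    then show ?thesis using TI[of "p \<otimes> r" "q \<otimes> r" x y] c r xy by simp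
  qed
  \<comment> \<open>1 - t lies in A for some t in T exactly if some pair in V is comaximal modulo A.
    The condition concerns single elements of A, so it survives unions of chains.\<close>
  define F where "F = {A. ideal A R \<and> (\<forall>t\<in>T. \<one> \<ominus> t \<notin> A)}"
  have "{\<zero>} \<in> F" using zeroideal T1 Tc eq_by_diff[of \<one>] unfolding F_def by auto
  then have "F \<noteq> {}" by blast
  then have "\<exists>M\<in>F. \<forall>B\<in>F. M \<subseteq> B \<longrightarrow> B = M"
  proof (rule subset_Zorn_nonempty)
    fix C assume C: "C \<noteq> {}" "subset.chain F C"
    then have "subset.chain {I. ideal I R} C" unfolding F_def pred_on.chain_def by blast
    then have "ideal (\<Union>C) R" using chain_Union_is_ideal[of C] C(1) by simp
    moreover have "\<one> \<ominus> t \<notin> \<Union>C" if "t \<in> T" for t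
      using C(2) that unfolding F_def pred_on.chain_def by blast
    ultimately show "\<Union>C \<in> F" unfolding F_def by blast
  qed
  then obtain A where AF: "A \<in> F" and max: "\<And>B. \<lbrakk>B \<in> F; A \<subseteq> B\<rbrakk> \<Longrightarrow> B = A" by blast
  interpret A: ideal A R using AF by (simp add: F_def)
  have AT: "\<one> \<ominus> t \<notin> A" if "t \<in> T" for t using AF that by (simp add: F_def)
  \<comment> \<open>By maximality of A, adjoining any further element z produces a pair that is
    comaximal modulo the larger ideal.\<close>
  have enlarge: thesis
    if z: "z \<in> carrier R" "z \<notin> A"
      and th: "\<And>t r i. \<lbrakk>t \<in> T; r \<in> carrier R; i \<in> A; t \<in> carrier R; i \<in> carrier R; \<one> \<ominus> t = i \<oplus> r \<otimes> z\<rbrakk> \<Longrightarrow> thesis" for z thesis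
  proof -
    have I: "ideal (A <+>\<^bsub>R\<^esub> PIdl z) R" by (intro add_ideals A.ideal_axioms cgenideal_ideal z)
    have "i \<in> A <+>\<^bsub>R\<^esub> PIdl z" if "i \<in> A" for i
    proof -
      have "i = i \<oplus> \<zero> \<otimes> z" using A.Icarr[OF that] z by simp
      then show ?thesis unfolding set_add_def' cgenideal_def using that zero_closed by blast
    qed
    moreover have "z \<in> A <+>\<^bsub>R\<^esub> PIdl z"
    proof -
      have "z = \<zero> \<oplus> \<one> \<otimes> z" using z by simp
      then show ?thesis unfolding set_add_def' cgenideal_def using A.zero_closed one_closed by blast
    qed
    ultimately have "A <+>\<^bsub>R\<^esub> PIdl z \<notin> F" using max[of "A <+>\<^bsub>R\<^esub> PIdl z"] z by blast
    then obtain t where t: "t \<in> T" "\<one> \<ominus> t \<in> A <+>\<^bsub>R\<^esub> PIdl z" using I unfolding F_def by blast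
    then obtain i r where "i \<in> A" "r \<in> carrier R" "\<one> \<ominus> t = i \<oplus> r \<otimes> z"
      unfolding set_add_def' cgenideal_def by blast
    then show thesis using th t(1) Tc A.Icarr by blast
  qed
  have rad: "z \<in> A" if z: "z \<in> carrier R" "z \<otimes> z \<in> A" for z
  proof (rule ccontr)
    assume "z \<notin> A"
    then obtain t r i where t: "t \<in> T" and i: "i \<in> A" and c: "t \<in> carrier R" "r \<in> carrier R" "i \<in> carrier R"
      and e: "\<one> \<ominus> t = i \<oplus> r \<otimes> z"
      using enlarge[OF z(1)] by metis
    have cz: "z \<in> carrier R" by (rule z)
    have t': "t = \<one> \<ominus> (i \<oplus> r \<otimes> z)" unfolding e[symmetric] using c by algebra
    \<comment> \<open>Modulo A the element t is 1 - r z, which 1 + r z inverts because z^2 lies in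
      A. The product stays in T, against the choice of A.\<close>
    have "\<one> \<ominus> t \<otimes> (\<one> \<oplus> r \<otimes> z) = i \<otimes> (\<one> \<oplus> r \<otimes> z) \<oplus> (r \<otimes> r) \<otimes> (z \<otimes> z)"
      unfolding t' using c cz by algebra
    also have "\<dots> \<in> A" using A.I_r_closed[OF i, of "\<one> \<oplus> r \<otimes> z"] A.I_l_closed[OF z(2), of "r \<otimes> r"] c cz
      by (intro A.a_closed) simp_all
    finally show False using AT[OF Tm[OF t, of "\<one> \<oplus> r \<otimes> z"]] c cz by simp
  qed
  have indec: "e \<in> A \<or> \<one> \<ominus> e \<in> A" if ce: "e \<in> carrier R" and e: "e \<otimes> (\<one> \<ominus> e) \<in> A" for e
  proof (rule ccontr)
    define f where "f = \<one> \<ominus> e"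
    have cf: "f \<in> carrier R" using ce by (simp add: f_def)
    have fe: "f \<oplus> e = \<one>" unfolding f_def using ce by algebra
    assume "\<not> (e \<in> A \<or> \<one> \<ominus> e \<in> A)"
    then have n: "e \<notin> A" "f \<notin> A" by (auto simp: f_def)
    obtain t r i where t: "t \<in> T" and i: "i \<in> A" and c: "t \<in> carrier R" "r \<in> carrier R" "i \<in> carrier R"
      and t1: "\<one> \<ominus> t = i \<oplus> r \<otimes> e"
      using enlarge[OF ce n(1)] by metis
    obtain t' r' i' where t': "t' \<in> T" and i': "i' \<in> A" and c': "t' \<in> carrier R" "r' \<in> carrier R" "i' \<in> carrier R"
      and t2: "\<one> \<ominus> t' = i' \<oplus> r' \<otimes> f"
      using enlarge[OF cf n(2)] by metis
    obtain p q x y where pq: "p \<in> carrier R" "q \<in> carrier R" "x \<in> carrier R" "y \<in> carrier R" and xy: "(x, y) \<in> V"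
      and tp: "t = p \<otimes> x \<oplus> q \<otimes> y" using TE[OF t] by metis
    obtain p' q' x' y' where pq': "p' \<in> carrier R" "q' \<in> carrier R" "x' \<in> carrier R" "y' \<in> carrier R" and xy': "(x', y') \<in> V"
      and tp': "t' = p' \<otimes> x' \<oplus> q' \<otimes> y'" using TE[OF t'] by metis
    \<comment> \<open>Pairs and coefficients are glued with the same weights f and e. Modulo A,
      where e f vanishes, w becomes f t + e t'; as f (1 - t) and e (1 - t') lie in A by
      \<open>t1\<close> and \<open>t2\<close>, so does 1 - w.\<close>
    define w where "w = (f \<otimes> p \<oplus> e \<otimes> p') \<otimes> (f \<otimes> x \<oplus> e \<otimes> x') \<oplus> (f \<otimes> q \<oplus> e \<otimes> q') \<otimes> (f \<otimes> y \<oplus> e \<otimes> y')"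
    have wT: "w \<in> T" unfolding w_def
      by (intro TI affine xy xy' fe) (use ce cf pq pq' in auto)
    \<comment> \<open>e is idempotent modulo A but not in R, so each glued product is off by a
      multiple of e f; k gathers the two corrections.\<close>
    define k where "k = (p \<ominus> p') \<otimes> (x \<ominus> x') \<oplus> (q \<ominus> q') \<otimes> (y \<ominus> y')"
    have ck: "k \<in> carrier R" unfolding k_def using pq pq' by simp
    have glue: "(f \<otimes> g \<oplus> e \<otimes> g') \<otimes> (f \<otimes> h \<oplus> e \<otimes> h')
        = f \<otimes> (g \<otimes> h) \<oplus> e \<otimes> (g' \<otimes> h') \<ominus> (g \<ominus> g') \<otimes> (h \<ominus> h') \<otimes> (e \<otimes> f)"
      if "g \<in> carrier R" "g' \<in> carrier R" "h \<in> carrier R" "h' \<in> carrier R" for g g' h h'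
    proof -
      have ff: "f \<otimes> f = f \<ominus> e \<otimes> f" and ee: "e \<otimes> e = e \<ominus> e \<otimes> f"
        unfolding f_def using ce by algebra+
      have "(f \<otimes> g \<oplus> e \<otimes> g') \<otimes> (f \<otimes> h \<oplus> e \<otimes> h')
          = (f \<otimes> f) \<otimes> (g \<otimes> h) \<oplus> (e \<otimes> e) \<otimes> (g' \<otimes> h') \<oplus> (e \<otimes> f) \<otimes> (g \<otimes> h' \<oplus> g' \<otimes> h)"
        using ce cf that by algebra
      also have "\<dots> = f \<otimes> (g \<otimes> h) \<oplus> e \<otimes> (g' \<otimes> h') \<ominus> (g \<ominus> g') \<otimes> (h \<ominus> h') \<otimes> (e \<otimes> f)"
        unfolding ff ee using ce cf that by algebra
      finally show ?thesis .
    qed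
    have sum: "\<one> \<ominus> ((f \<otimes> a \<oplus> e \<otimes> a' \<ominus> g \<otimes> z) \<oplus> (f \<otimes> b \<oplus> e \<otimes> b' \<ominus> h \<otimes> z))
        = f \<otimes> (\<one> \<ominus> (a \<oplus> b)) \<oplus> e \<otimes> (\<one> \<ominus> (a' \<oplus> b')) \<oplus> (g \<oplus> h) \<otimes> z"
      if "a \<in> carrier R" "a' \<in> carrier R" "b \<in> carrier R" "b' \<in> carrier R" "g \<in> carrier R" "h \<in> carrier R" "z \<in> carrier R"
      for a a' b b' g h z
    proof -
      have "f \<otimes> (\<one> \<ominus> (a \<oplus> b)) \<oplus> e \<otimes> (\<one> \<ominus> (a' \<oplus> b')) \<oplus> (g \<oplus> h) \<otimes> z
          = (f \<oplus> e) \<ominus> ((f \<otimes> a \<oplus> e \<otimes> a' \<ominus> g \<otimes> z) \<oplus> (f \<otimes> b \<oplus> e \<otimes> b' \<ominus> h \<otimes> z))"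
        using ce cf that by algebra
      then show ?thesis unfolding fe by simp
    qed
    have "\<one> \<ominus> w = f \<otimes> (\<one> \<ominus> t) \<oplus> e \<otimes> (\<one> \<ominus> t') \<oplus> k \<otimes> (e \<otimes> f)"
      unfolding w_def k_def tp tp' using pq pq' ce cf
      by (subst glue, simp, simp, simp, simp, subst glue, simp, simp, simp, simp, subst sum) simp_all
    also have "\<dots> = f \<otimes> i \<oplus> e \<otimes> i' \<oplus> (r \<oplus> r' \<oplus> k) \<otimes> (e \<otimes> f)"
      unfolding t1 t2 using ce cf c c' ck by algebra
    also have "\<dots> \<in> A"
      using A.I_l_closed[OF i cf] A.I_l_closed[OF i' ce] A.I_l_closed[OF e[folded f_def], of "r \<oplus> r' \<oplus> k"] c c' ck
      by (intro A.a_closed) simp_all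
    finally show False using AT[OF wT] by simp
  qed
  have ne: "carrier R \<noteq> A"
  proof
    assume "carrier R = A"
    moreover obtain x y where "(x, y) \<in> V" using V(2) by auto
    ultimately show False using AT[OF TI[OF zero_closed zero_closed \<open>(x, y) \<in> V\<close>]] V(1) by auto
  qed
  have "primeideal A R"
  proof (rule primeidealI2[OF A.additive_subgroup_axioms cring_axioms A.I_l_closed A.I_r_closed ne])
    fix a b assume a: "a \<in> carrier R" and b: "b \<in> carrier R" and ab: "a \<otimes> b \<in> A"
    obtain e where ce: "e \<in> carrier R" and e: "e \<otimes> (\<one> \<ominus> e) \<in> A" and ae: "a \<otimes> (\<one> \<ominus> e) \<in> A"
      and ann: "\<And>x. \<lbrakk>x \<in> carrier R; a \<otimes> x \<in> A\<rbrakk> \<Longrightarrow> e \<otimes> x \<in> A"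
      using radical_split_ringE[OF split A.ideal_axioms rad a] by blast
    \<comment> \<open>Modulo A the idempotent e is 0 or 1. In the first case a = a e vanishes; in
      the second b = e b does, as a b = 0 implies e b = 0.\<close>
    from indec[OF ce e] show "a \<in> A \<or> b \<in> A"
    proof
      assume "e \<in> A"
      have "a = a \<otimes> (\<one> \<ominus> e) \<oplus> a \<otimes> e" using a ce by algebra
      also have "\<dots> \<in> A" using ae A.I_l_closed[OF \<open>e \<in> A\<close> a] by (rule A.a_closed)
      finally show ?thesis ..
    next
      assume f: "\<one> \<ominus> e \<in> A"
      have "b = (\<one> \<ominus> e) \<otimes> b \<oplus> e \<otimes> b" using b ce by algebra
      also have "\<dots> \<in> A" using A.I_r_closed[OF f b] ann[OF b ab] by (rule A.a_closed)
      finally show ?thesis ..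
    qed
  qed
  from prime[OF this] obtain x y where xy: "(x, y) \<in> V" and cm: "comax (R Quot A) (A +> x) (A +> y)" by blast
  interpret h: ring_hom_ring R "R Quot A" "(+>) A" by (rule A.rcos_ring_hom_ring)
  have cxy: "x \<in> carrier R" "y \<in> carrier R" using xy V by auto
  obtain p' q' where pq': "p' \<in> carrier (R Quot A)" "q' \<in> carrier (R Quot A)"
    and e: "p' \<otimes>\<^bsub>R Quot A\<^esub> (A +> x) \<oplus>\<^bsub>R Quot A\<^esub> q' \<otimes>\<^bsub>R Quot A\<^esub> (A +> y) = \<one>\<^bsub>R Quot A\<^esub>"
    using cm unfolding comax_def by blast
  obtain p where p: "p \<in> carrier R" "p' = A +> p" by (rule A.rcos_surj[OF pq'(1)])
  obtain q where q: "q \<in> carrier R" "q' = A +> q" by (rule A.rcos_surj[OF pq'(2)])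
  have "A +> (p \<otimes> x \<oplus> q \<otimes> y) = \<one>\<^bsub>R Quot A\<^esub>" using e p q cxy by simp
  then have "A +> (\<one> \<ominus> (p \<otimes> x \<oplus> q \<otimes> y)) = \<zero>\<^bsub>R Quot A\<^esub>"
    using p(1) q(1) cxy by (simp add: a_minus_def h.S.r_neg)
  then have "\<one> \<ominus> (p \<otimes> x \<oplus> q \<otimes> y) \<in> A"
    using A.rcos_eq_zero_iff[of "\<one> \<ominus> (p \<otimes> x \<oplus> q \<otimes> y)"] p(1) q(1) cxy by simp
  then show False using AT[OF TI[OF p(1) q(1) xy]] by simp
qed

section \<open>Radicals of ideals, and radical splittings in R/P\<close>

lemma (in cring) add_pow_mem_ideal:
  assumes "ideal I R" "x \<in> carrier R" "y \<in> carrier R"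
  shows "\<lbrakk>w \<in> carrier R; x [^] (n::nat) \<otimes> w \<in> I; y [^] (m::nat) \<otimes> w \<in> I\<rbrakk> \<Longrightarrow> (x \<oplus> y) [^] (n + m) \<otimes> w \<in> I"
\<comment> \<open>The factor w replaces the binomial theorem: one factor x + y is expanded, x and y
  are absorbed into w, and in each summand one of the exponents drops. Once an exponent is 0, w
  itself lies in I.\<close>
proof (induction "n + m" arbitrary: n m w)
  case 0
  then show ?case by simp
next
  case (Suc k)
  interpret I: ideal I R by fact
  note [simp, carr] = \<open>x \<in> carrier R\<close> \<open>y \<in> carrier R\<close> \<open>w \<in> carrier R\<close>
  show ?case
  proof (cases "n = 0 \<or> m = 0")
    case True
    then have "w \<in> I" using Suc.prems by auto
    then show ?thesis by (intro I.I_l_closed) auto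
  next
    case False
    then obtain n' m' where nm: "n = Suc n'" "m = Suc m'" by (meson not0_implies_Suc)
    have "x [^] n' \<otimes> (x \<otimes> w) \<in> I" using Suc.prems(2) by (simp add: nm m_assoc)
    moreover have "y [^] m \<otimes> (x \<otimes> w) \<in> I"
      using I.I_l_closed[OF Suc.prems(3), of x] by (simp add: m_lcomm)
    ultimately have 1: "(x \<oplus> y) [^] k \<otimes> (x \<otimes> w) \<in> I"
      using Suc.hyps(1)[of n' m "x \<otimes> w"] Suc.hyps(2) by (simp add: nm)
    have "y [^] m' \<otimes> (y \<otimes> w) \<in> I" using Suc.prems(3) by (simp add: nm m_assoc)
    moreover have "x [^] n \<otimes> (y \<otimes> w) \<in> I"
      using I.I_l_closed[OF Suc.prems(2), of y] by (simp add: m_lcomm)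
    ultimately have 2: "(x \<oplus> y) [^] k \<otimes> (y \<otimes> w) \<in> I"
      using Suc.hyps(1)[of n m' "y \<otimes> w"] Suc.hyps(2) by (simp add: nm)
    have "(x \<oplus> y) [^] (n + m) \<otimes> w = (x \<oplus> y) [^] k \<otimes> (x \<otimes> w) \<oplus> (x \<oplus> y) [^] k \<otimes> (y \<otimes> w)"
      unfolding Suc.hyps(2)[symmetric] by (simp add: m_assoc l_distr r_distr)
    then show ?thesis using I.a_closed[OF 1 2] by simp
  qed
qed

lemma (in cring) radical_is_ideal:
  assumes "ideal I R"
  shows "ideal {x \<in> carrier R. \<exists>n::nat. x [^] n \<in> I} R"
proof (rule idealI[OF ring_axioms])
  interpret I: ideal I R by fact
  have m: "x \<otimes> a \<in> {x \<in> carrier R. \<exists>n::nat. x [^] n \<in> I}"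
    if a: "a \<in> {x \<in> carrier R. \<exists>n::nat. x [^] n \<in> I}" and x: "x \<in> carrier R" for a x
  proof -
    obtain n :: nat where c: "a \<in> carrier R" and n: "a [^] n \<in> I" using a by blast
    have "(x \<otimes> a) [^] n = x [^] n \<otimes> a [^] n" using c x by (simp add: nat_pow_distrib)
    also have "\<dots> \<in> I" using n x by (intro I.I_l_closed) auto
    finally show ?thesis using c x by blast
  qed
  then show "x \<otimes> a \<in> {x \<in> carrier R. \<exists>n::nat. x [^] n \<in> I}"
    and "a \<otimes> x \<in> {x \<in> carrier R. \<exists>n::nat. x [^] n \<in> I}"
    if "a \<in> {x \<in> carrier R. \<exists>n::nat. x [^] n \<in> I}" and "x \<in> carrier R" for a x
    using that m_comm[of a x] by auto
  show "subgroup {x \<in> carrier R. \<exists>n::nat. x [^] n \<in> I} (add_monoid R)"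
  proof (rule add.subgroupI)
    have "\<zero> [^] (1::nat) \<in> I" by simp
    then show "{x \<in> carrier R. \<exists>n::nat. x [^] n \<in> I} \<noteq> {}" using zero_closed by blast
  next
    fix a assume a: "a \<in> {x \<in> carrier R. \<exists>n::nat. x [^] n \<in> I}"
    then have "\<ominus> a = (\<ominus> \<one>) \<otimes> a" by (simp add: l_minus)
    then show "\<ominus> a \<in> {x \<in> carrier R. \<exists>n::nat. x [^] n \<in> I}" using m[OF a, of "\<ominus> \<one>"] by simp
  next
    fix a b assume "a \<in> {x \<in> carrier R. \<exists>n::nat. x [^] n \<in> I}" "b \<in> {x \<in> carrier R. \<exists>n::nat. x [^] n \<in> I}"
    then obtain n m :: nat where c: "a \<in> carrier R" "b \<in> carrier R" and nm: "a [^] n \<in> I" "b [^] m \<in> I" by blast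
    have "(a \<oplus> b) [^] (n + m) \<otimes> \<one> \<in> I" using nm c by (intro add_pow_mem_ideal[OF assms]) auto
    then show "a \<oplus> b \<in> {x \<in> carrier R. \<exists>n::nat. x [^] n \<in> I}" using c by auto
  qed auto
qed

lemma (in cring) radically_split_quotient:
  assumes split: "radical_split_ring R" and P: "primeideal P R"
    and c: "c \<in> carrier (R Quot P)" and a: "a \<in> carrier (R Quot P)"
  shows "\<exists>e\<in>carrier (R Quot P). radically_split (R Quot P) c a e"
proof -
  interpret P: primeideal P R by fact
  let ?S = "R Quot P"
  let ?h = "(+>) P"
  interpret S: domain ?S by (rule P.quotient_is_domain)
  interpret h: ring_hom_ring R ?S ?h by (rule P.rcos_ring_hom_ring)
  have pow: "?h (x [^] (n::nat)) = ?h x [^]\<^bsub>?S\<^esub> n" if "x \<in> carrier R" for x n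
    using that by (induction n) simp_all
  \<comment> \<open>The preimage in R of the radical of c(R/P). It is a radical ideal of R, so the
    splitting property of R applies to it although the idempotents concern a quotient of
    R/P.\<close>
  define A where "A = {x \<in> carrier R. \<exists>n::nat. x [^] n \<in> {r \<in> carrier R. ?h r \<in> PIdl\<^bsub>?S\<^esub> c}}"
  have A: "ideal A R"
    unfolding A_def by (intro radical_is_ideal h.ideal_vimage S.cgenideal_ideal c)
  have mem: "x \<in> A \<longleftrightarrow> (\<exists>n::nat. c divides\<^bsub>?S\<^esub> (?h x [^]\<^bsub>?S\<^esub> n))" if x: "x \<in> carrier R" for x
  proof -
    have "y \<in> PIdl\<^bsub>?S\<^esub> c \<longleftrightarrow> c divides\<^bsub>?S\<^esub> y" for y
      unfolding cgenideal_def factor_def using S.m_comm[OF c] by auto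
    then show ?thesis unfolding A_def using x by (auto simp: pow)
  qed
  have rad: "x \<in> A" if x: "x \<in> carrier R" "x \<otimes> x \<in> A" for x
  proof -
    obtain n :: nat where "(x \<otimes> x) [^] n \<in> {r \<in> carrier R. ?h r \<in> PIdl\<^bsub>?S\<^esub> c}"
      using x unfolding A_def by blast
    moreover have "(x \<otimes> x) [^] n = x [^] (n + n)" using x(1) by (simp add: nat_pow_distrib nat_pow_mult)
    ultimately have "x [^] (n + n) \<in> {r \<in> carrier R. ?h r \<in> PIdl\<^bsub>?S\<^esub> c}" by simp
    then show ?thesis using x(1) unfolding A_def by blast
  qed
  obtain a' where a': "a' \<in> carrier R" "a = ?h a'" by (rule P.rcos_surj[OF a])
  obtain e where e: "e \<in> carrier R" "e \<otimes> (\<one> \<ominus> e) \<in> A" "a' \<otimes> (\<one> \<ominus> e) \<in> A"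
    and ann: "\<And>x. \<lbrakk>x \<in> carrier R; a' \<otimes> x \<in> A\<rbrakk> \<Longrightarrow> e \<otimes> x \<in> A"
    using radical_split_ringE[OF split A rad a'(1)] by blast
  have hm: "?h (x \<otimes> (\<one> \<ominus> e)) = ?h x \<otimes>\<^bsub>?S\<^esub> (\<one>\<^bsub>?S\<^esub> \<ominus>\<^bsub>?S\<^esub> ?h e)" if "x \<in> carrier R" for x
    using that e(1) by (simp add: a_minus_def S.minus_eq)
  have ce': "\<one> \<ominus> e \<in> carrier R" using e(1) by simp
  have "radically_split ?S c a (?h e)"
    unfolding radically_split_def
  proof (intro conjI ballI impI)
    show "\<exists>n::nat. c divides\<^bsub>?S\<^esub> ((?h e \<otimes>\<^bsub>?S\<^esub> (\<one>\<^bsub>?S\<^esub> \<ominus>\<^bsub>?S\<^esub> ?h e)) [^]\<^bsub>?S\<^esub> n)"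
      using e(2) mem[OF m_closed[OF e(1) ce'], unfolded hm[OF e(1)]] by blast
    show "\<exists>n::nat. c divides\<^bsub>?S\<^esub> ((a \<otimes>\<^bsub>?S\<^esub> (\<one>\<^bsub>?S\<^esub> \<ominus>\<^bsub>?S\<^esub> ?h e)) [^]\<^bsub>?S\<^esub> n)"
      using e(3) mem[OF m_closed[OF a'(1) ce'], unfolded hm[OF a'(1)]] a'(2) by blast
  next
    fix y assume y: "y \<in> carrier ?S" "c divides\<^bsub>?S\<^esub> (a \<otimes>\<^bsub>?S\<^esub> y)"
    obtain x where x: "x \<in> carrier R" "y = ?h x" by (rule P.rcos_surj[OF y(1)])
    have "c divides\<^bsub>?S\<^esub> (?h (a' \<otimes> x) [^]\<^bsub>?S\<^esub> (1::nat))" using y(2) a' x by simp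
    then have "a' \<otimes> x \<in> A" using mem[of "a' \<otimes> x"] a'(1) x(1) by blast
    then have "e \<otimes> x \<in> A" by (rule ann[OF x(1)])
    then show "\<exists>n::nat. c divides\<^bsub>?S\<^esub> ((?h e \<otimes>\<^bsub>?S\<^esub> y) [^]\<^bsub>?S\<^esub> n)"
      using mem[of "e \<otimes> x"] e(1) x by simp
  qed
  then show ?thesis using h.hom_closed[OF e(1)] by blast
qed

section \<open>Lifting the two conditions from the prime quotients to R\<close>

lemma (in cring) hermite_ring_if_radical_split:
  assumes split: "radical_split_ring R" and G: "gcd_ring R"
  shows "hermite_ring R"
  unfolding hermite_ring_def
proof (intro ballI)
  fix x y assume cxy: "x \<in> carrier R" "y \<in> carrier R"
  obtain d a b u v where cd: "d \<in> carrier R" and ca: "a \<in> carrier R" and cb: "b \<in> carrier R"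
    and cu: "u \<in> carrier R" and cv: "v \<in> carrier R"
    and x: "x = a \<otimes> d" and y: "y = b \<otimes> d" and d: "d = u \<otimes> x \<oplus> v \<otimes> y"
    by (rule gcd_ringE[OF G cxy])
  \<comment> \<open>The defect of the cofactor identity. It annihilates d because u x + v y =
    d.\<close>
  define z where "z = \<one> \<ominus> (u \<otimes> a \<oplus> v \<otimes> b)"
  have cz: "z \<in> carrier R" using ca cb cu cv by (simp add: z_def)
  have "z \<otimes> d = d \<ominus> (u \<otimes> (a \<otimes> d) \<oplus> v \<otimes> (b \<otimes> d))"
    unfolding z_def using ca cb cu cv cd by algebra
  also have "\<dots> = d \<ominus> d" using d unfolding x y by simp
  finally have zd: "z \<otimes> d = \<zero>" using cd by (simp add: a_minus_def r_neg)
  \<comment> \<open>All cofactor pairs of x and y with respect to d: a coset of ann(d)^2.\<close>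
  define V where "V = {(a \<oplus> k, b \<oplus> l) | k l. k \<in> carrier R \<and> l \<in> carrier R \<and> k \<otimes> d = \<zero> \<and> l \<otimes> d = \<zero>}"
  have VI: "(a \<oplus> k, b \<oplus> l) \<in> V" if "k \<in> carrier R" "l \<in> carrier R" "k \<otimes> d = \<zero>" "l \<otimes> d = \<zero>" for k l
    using that unfolding V_def by blast
  have "\<exists>(x, y)\<in>V. comax R x y"
  proof (rule comax_local_global[OF split])
    show "V \<subseteq> carrier R \<times> carrier R" using ca cb by (auto simp: V_def)
    have "(a \<oplus> \<zero>, b \<oplus> \<zero>) \<in> V" using cd by (intro VI) auto
    then show "V \<noteq> {}" by blast
  next
    fix p q p' q' e f assume "(p, q) \<in> V" "(p', q') \<in> V" and ce: "e \<in> carrier R" and cf: "f \<in> carrier R" and fe: "f \<oplus> e = \<one>"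
    then obtain k l k' l' where ck: "k \<in> carrier R" "l \<in> carrier R" "k' \<in> carrier R" "l' \<in> carrier R"
      and kd: "k \<otimes> d = \<zero>" "l \<otimes> d = \<zero>" "k' \<otimes> d = \<zero>" "l' \<otimes> d = \<zero>"
      and p: "p = a \<oplus> k" "q = b \<oplus> l" "p' = a \<oplus> k'" "q' = b \<oplus> l'"
      unfolding V_def by blast
    have lin: "f \<otimes> (g \<oplus> i) \<oplus> e \<otimes> (g \<oplus> j) = g \<oplus> (f \<otimes> i \<oplus> e \<otimes> j)"
      if cg: "g \<in> carrier R" and ci: "i \<in> carrier R" and cj: "j \<in> carrier R" for g i j
    proof -
      have "f \<otimes> (g \<oplus> i) \<oplus> e \<otimes> (g \<oplus> j) = (f \<oplus> e) \<otimes> g \<oplus> (f \<otimes> i \<oplus> e \<otimes> j)"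
        using ce cf cg ci cj by algebra
      then show ?thesis using fe cg by simp
    qed
    have ann: "(f \<otimes> i \<oplus> e \<otimes> j) \<otimes> d = \<zero>"
      if "i \<in> carrier R" "j \<in> carrier R" "i \<otimes> d = \<zero>" "j \<otimes> d = \<zero>" for i j
      using that ce cf cd by (simp add: l_distr m_assoc)
    show "(f \<otimes> p \<oplus> e \<otimes> p', f \<otimes> q \<oplus> e \<otimes> q') \<in> V"
      unfolding p lin[OF ca ck(1,3)] lin[OF cb ck(2,4)]
      using ce cf ck kd by (intro VI ann) auto
  next
    fix P assume P: "primeideal P R"
    interpret P: primeideal P R by fact
    let ?S = "R Quot P"
    interpret S: domain ?S by (rule P.quotient_is_domain)
    interpret h: ring_hom_ring R ?S "(+>) P" by (rule P.rcos_ring_hom_ring)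
    have HS: "hermite_ring ?S" by (rule S.gcd_ring_imp_hermite[OF P.gcd_ring_quotient[OF G]])
    \<comment> \<open>(a, b, z) is unimodular, so over R/P stable range 2 makes a and b comaximal by
      adding multiples of z. Such changes lift to elements of V, since z annihilates d.\<close>
    have "u \<otimes> a \<oplus> v \<otimes> b \<oplus> \<one> \<otimes> z = \<one>"
      unfolding z_def using ca cb cu cv by algebra
    from arg_cong[OF this, of "(+>) P"]
    have "(P +> u) \<otimes>\<^bsub>?S\<^esub> (P +> a) \<oplus>\<^bsub>?S\<^esub> (P +> v) \<otimes>\<^bsub>?S\<^esub> (P +> b) \<oplus>\<^bsub>?S\<^esub> \<one>\<^bsub>?S\<^esub> \<otimes>\<^bsub>?S\<^esub> (P +> z) = \<one>\<^bsub>?S\<^esub>"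
      using ca cb cu cv cz by simp
    then obtain K L where K: "K \<in> carrier ?S" "L \<in> carrier ?S"
      and cm: "comax ?S ((P +> a) \<oplus>\<^bsub>?S\<^esub> K \<otimes>\<^bsub>?S\<^esub> (P +> z)) ((P +> b) \<oplus>\<^bsub>?S\<^esub> L \<otimes>\<^bsub>?S\<^esub> (P +> z))"
      by (rule S.hermite_stable_range_2[OF HS]) (use ca cb cu cv cz in auto)
    obtain k where k: "k \<in> carrier R" "K = P +> k" by (rule P.rcos_surj[OF K(1)])
    obtain l where l: "l \<in> carrier R" "L = P +> l" by (rule P.rcos_surj[OF K(2)])
    have "comax ?S (P +> (a \<oplus> k \<otimes> z)) (P +> (b \<oplus> l \<otimes> z))"
      using cm k l ca cb cz by simp
    moreover have "(a \<oplus> k \<otimes> z, b \<oplus> l \<otimes> z) \<in> V"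
      using k(1) l(1) cz cd zd by (intro VI) (auto simp: m_assoc)
    ultimately show "\<exists>(x, y)\<in>V. comax ?S (P +> x) (P +> y)" by blast
  qed
  then obtain k l where ck: "k \<in> carrier R" "l \<in> carrier R" and kd: "k \<otimes> d = \<zero>" "l \<otimes> d = \<zero>"
    and cm: "comax R (a \<oplus> k) (b \<oplus> l)" unfolding V_def by blast
  have "x = (a \<oplus> k) \<otimes> d" "y = (b \<oplus> l) \<otimes> d" using x y ck kd ca cb cd by (simp_all add: l_distr)
  moreover have "a \<oplus> k \<in> carrier R" "b \<oplus> l \<in> carrier R" using ca cb ck by auto
  ultimately show "\<exists>d\<in>carrier R. \<exists>x'\<in>carrier R. \<exists>y'\<in>carrier R. x = x' \<otimes> d \<and> y = y' \<otimes> d \<and> comax R x' y'"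
    using cm cd by blast
qed

text \<open>The pairs (a x + b y, c y) form a submodule of R^2, in particular a family closed under
  affine combinations; modulo a prime, \<open>triangular_unimodular_value\<close> finds a comaximal
  one.\<close>

lemma (in cring) kaplansky_condition_if_radical_split:
  assumes split: "radical_split_ring R" and G: "gcd_ring R"
  shows "kaplansky_condition R"
  unfolding kaplansky_condition_def
proof (intro ballI impI)
  fix a b c assume "a \<in> carrier R" "b \<in> carrier R" "c \<in> carrier R"
    and "\<exists>\<alpha>\<in>carrier R. \<exists>\<beta>\<in>carrier R. \<exists>\<gamma>\<in>carrier R. \<alpha> \<otimes> a \<oplus> \<beta> \<otimes> b \<oplus> \<gamma> \<otimes> c = \<one>"
  then obtain \<alpha> \<beta> \<gamma> where abc: "\<alpha> \<otimes> a \<oplus> \<beta> \<otimes> b \<oplus> \<gamma> \<otimes> c = \<one>"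
    and cc: "\<alpha> \<in> carrier R" "\<beta> \<in> carrier R" "\<gamma> \<in> carrier R" "a \<in> carrier R" "b \<in> carrier R" "c \<in> carrier R"
    by blast
  define V where "V = {(a \<otimes> x \<oplus> b \<otimes> y, c \<otimes> y) | x y. x \<in> carrier R \<and> y \<in> carrier R}"
  have VI: "(a \<otimes> x \<oplus> b \<otimes> y, c \<otimes> y) \<in> V" if "x \<in> carrier R" "y \<in> carrier R" for x y
    using that unfolding V_def by blast
  have "\<exists>(x, y)\<in>V. comax R x y"
  proof (rule comax_local_global[OF split])
    show "V \<subseteq> carrier R \<times> carrier R" using cc by (auto simp: V_def)
    show "V \<noteq> {}" using VI[OF zero_closed zero_closed] by blast
  next
    fix p q p' q' e f assume "(p, q) \<in> V" "(p', q') \<in> V" and ce: "e \<in> carrier R" and cf: "f \<in> carrier R" and fe: "f \<oplus> e = \<one>"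
    then obtain x y x' y' where cx: "x \<in> carrier R" "y \<in> carrier R" "x' \<in> carrier R" "y' \<in> carrier R"
      and p: "p = a \<otimes> x \<oplus> b \<otimes> y" "q = c \<otimes> y" "p' = a \<otimes> x' \<oplus> b \<otimes> y'" "q' = c \<otimes> y'"
      unfolding V_def by blast
    have "f \<otimes> p \<oplus> e \<otimes> p' = a \<otimes> (f \<otimes> x \<oplus> e \<otimes> x') \<oplus> b \<otimes> (f \<otimes> y \<oplus> e \<otimes> y')"
      unfolding p using cc cx ce cf by algebra
    moreover have "f \<otimes> q \<oplus> e \<otimes> q' = c \<otimes> (f \<otimes> y \<oplus> e \<otimes> y')"
      unfolding p using cc cx ce cf by algebra
    ultimately show "(f \<otimes> p \<oplus> e \<otimes> p', f \<otimes> q \<oplus> e \<otimes> q') \<in> V"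
      using VI[of "f \<otimes> x \<oplus> e \<otimes> x'" "f \<otimes> y \<oplus> e \<otimes> y'"] cx ce cf by simp
  next
    fix P assume P: "primeideal P R"
    interpret P: primeideal P R by fact
    let ?S = "R Quot P"
    interpret S: domain ?S by (rule P.quotient_is_domain)
    interpret h: ring_hom_ring R ?S "(+>) P" by (rule P.rcos_ring_hom_ring)
    have HS: "hermite_ring ?S" by (rule S.gcd_ring_imp_hermite[OF P.gcd_ring_quotient[OF G]])
    have "(P +> \<alpha>) \<otimes>\<^bsub>?S\<^esub> (P +> a) \<oplus>\<^bsub>?S\<^esub> (P +> \<beta>) \<otimes>\<^bsub>?S\<^esub> (P +> b) \<oplus>\<^bsub>?S\<^esub> (P +> \<gamma>) \<otimes>\<^bsub>?S\<^esub> (P +> c) = \<one>\<^bsub>?S\<^esub>"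
      using arg_cong[OF abc, of "(+>) P"] cc by simp
    then have "\<exists>x\<in>carrier ?S. \<exists>y\<in>carrier ?S.
        comax ?S ((P +> a) \<otimes>\<^bsub>?S\<^esub> x \<oplus>\<^bsub>?S\<^esub> (P +> b) \<otimes>\<^bsub>?S\<^esub> y) ((P +> c) \<otimes>\<^bsub>?S\<^esub> y)"
      using radically_split_quotient[OF split P] cc by (intro S.triangular_unimodular_value[OF HS]) auto
    then obtain x' y' where x': "x' \<in> carrier ?S" "y' \<in> carrier ?S"
      and cm: "comax ?S ((P +> a) \<otimes>\<^bsub>?S\<^esub> x' \<oplus>\<^bsub>?S\<^esub> (P +> b) \<otimes>\<^bsub>?S\<^esub> y') ((P +> c) \<otimes>\<^bsub>?S\<^esub> y')"
      by blast
    obtain x where x: "x \<in> carrier R" "x' = P +> x" by (rule P.rcos_surj[OF x'(1)])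
    obtain y where y: "y \<in> carrier R" "y' = P +> y" by (rule P.rcos_surj[OF x'(2)])
    have "comax ?S (P +> (a \<otimes> x \<oplus> b \<otimes> y)) (P +> (c \<otimes> y))" using cm x y cc by simp
    then show "\<exists>(x, y)\<in>V. comax ?S (P +> x) (P +> y)" using VI[OF x(1) y(1)] by blast
  qed
  then show "\<exists>x\<in>carrier R. \<exists>y\<in>carrier R. comax R (a \<otimes> x \<oplus> b \<otimes> y) (c \<otimes> y)"
    unfolding V_def by blast
qed

section \<open>Diagonal reduction of matrices\<close>

text \<open>Being a mere lambda abstraction, a double transpose is the original matrix up to beta
  and eta conversion. This lets statements on columns be read off from those on rows.\<close>

abbreviation (input) mat_transpose :: "(nat \<Rightarrow> nat \<Rightarrow> 'a) \<Rightarrow> nat \<Rightarrow> nat \<Rightarrow> 'a" where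
  "mat_transpose M \<equiv> (\<lambda>i j. M j i)"

definition mat_id :: "('a, 'm) ring_scheme \<Rightarrow> nat \<Rightarrow> nat \<Rightarrow> 'a" where
  "mat_id R = (\<lambda>i j. if i = j then \<one>\<^bsub>R\<^esub> else \<zero>\<^bsub>R\<^esub>)"

text \<open>Matrices are total functions whose values outside the m by n range are arbitrary, so
  identities between them hold only within that range.\<close>

definition mat_eq :: "nat \<Rightarrow> nat \<Rightarrow> (nat \<Rightarrow> nat \<Rightarrow> 'a) \<Rightarrow> (nat \<Rightarrow> nat \<Rightarrow> 'a) \<Rightarrow> bool" where
  "mat_eq m n M N \<longleftrightarrow> (\<forall>i<m. \<forall>j<n. M i j = N i j)"

definition mat_equiv :: "('a, 'm) ring_scheme \<Rightarrow> nat \<Rightarrow> nat \<Rightarrow> (nat \<Rightarrow> nat \<Rightarrow> 'a) \<Rightarrow> (nat \<Rightarrow> nat \<Rightarrow> 'a) \<Rightarrow> bool" where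
  "mat_equiv R m n M N \<longleftrightarrow> is_mat R m n M \<and> is_mat R m n N \<and>
     (\<exists>P Q. invertible_mat R m P \<and> invertible_mat R n Q \<and> mat_eq m n (mat_mul R n (mat_mul R m P M) Q) N)"

definition row_op :: "('a, 'm) ring_scheme \<Rightarrow> nat \<Rightarrow> nat \<Rightarrow> 'a \<Rightarrow> 'a \<Rightarrow> 'a \<Rightarrow> 'a \<Rightarrow> (nat \<Rightarrow> nat \<Rightarrow> 'a) \<Rightarrow> nat \<Rightarrow> nat \<Rightarrow> 'a" where
  "row_op R i j \<alpha> \<beta> \<gamma> \<delta> M = (\<lambda>k l.
     if k = i then \<alpha> \<otimes>\<^bsub>R\<^esub> M i l \<oplus>\<^bsub>R\<^esub> \<beta> \<otimes>\<^bsub>R\<^esub> M j l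
     else if k = j then \<gamma> \<otimes>\<^bsub>R\<^esub> M i l \<oplus>\<^bsub>R\<^esub> \<delta> \<otimes>\<^bsub>R\<^esub> M j l else M k l)"

abbreviation (input) col_op :: "('a, 'm) ring_scheme \<Rightarrow> nat \<Rightarrow> nat \<Rightarrow> 'a \<Rightarrow> 'a \<Rightarrow> 'a \<Rightarrow> 'a \<Rightarrow> (nat \<Rightarrow> nat \<Rightarrow> 'a) \<Rightarrow> nat \<Rightarrow> nat \<Rightarrow> 'a" where
  "col_op R i j \<alpha> \<beta> \<gamma> \<delta> M \<equiv> mat_transpose (row_op R i j \<alpha> \<beta> \<gamma> \<delta> (mat_transpose M))"

definition sl2 :: "('a, 'm) ring_scheme \<Rightarrow> 'a \<Rightarrow> 'a \<Rightarrow> 'a \<Rightarrow> 'a \<Rightarrow> bool" where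
  "sl2 R \<alpha> \<beta> \<gamma> \<delta> \<longleftrightarrow> \<alpha> \<in> carrier R \<and> \<beta> \<in> carrier R \<and> \<gamma> \<in> carrier R \<and> \<delta> \<in> carrier R \<and>
     \<alpha> \<otimes>\<^bsub>R\<^esub> \<delta> \<ominus>\<^bsub>R\<^esub> \<beta> \<otimes>\<^bsub>R\<^esub> \<gamma> = \<one>\<^bsub>R\<^esub>"

lemma is_mat_transpose: "is_mat R m n M \<Longrightarrow> is_mat R n m (mat_transpose M)"
  by (auto simp: is_mat_def)

lemma is_matD: "\<lbrakk>is_mat R m n M; i < m; j < n\<rbrakk> \<Longrightarrow> M i j \<in> carrier R"
  by (auto simp: is_mat_def)

lemma mat_eq_is_mat: "\<lbrakk>mat_eq m n M N; is_mat R m n M\<rbrakk> \<Longrightarrow> is_mat R m n N"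
  by (auto simp: mat_eq_def is_mat_def)

lemma mat_eq_sym: "mat_eq m n M N \<Longrightarrow> mat_eq m n N M"
  by (auto simp: mat_eq_def)

lemma mat_eq_trans [trans]: "\<lbrakk>mat_eq m n M N; mat_eq m n N L\<rbrakk> \<Longrightarrow> mat_eq m n M L"
  by (auto simp: mat_eq_def)

lemma mat_eq_refl: "mat_eq m n M M"
  by (auto simp: mat_eq_def)

section \<open>Matrix algebra and equivalence of matrices\<close>

context cring
begin

lemma finsum_swap:
  assumes "finite A" "finite B" "\<And>s t. \<lbrakk>s \<in> A; t \<in> B\<rbrakk> \<Longrightarrow> f s t \<in> carrier R"
  shows "(\<Oplus>s\<in>A. \<Oplus>t\<in>B. f s t) = (\<Oplus>t\<in>B. \<Oplus>s\<in>A. f s t)"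
  using assms(1,3)
proof (induction A rule: finite_induct)
  case empty
  then show ?case by simp
next
  case (insert x A)
  have cl: "(\<Oplus>t\<in>B. f s t) \<in> carrier R" if "s \<in> insert x A" for s
    using insert.prems that by (intro finsum_closed) auto
  have cl': "(\<Oplus>s\<in>A. f s t) \<in> carrier R" if "t \<in> B" for t
    using insert.prems that by (intro finsum_closed) auto
  have "(\<Oplus>s\<in>insert x A. \<Oplus>t\<in>B. f s t) = (\<Oplus>t\<in>B. f x t) \<oplus> (\<Oplus>s\<in>A. \<Oplus>t\<in>B. f s t)"
    using insert.hyps cl by (intro finsum_insert) auto
  also have "\<dots> = (\<Oplus>t\<in>B. f x t) \<oplus> (\<Oplus>t\<in>B. \<Oplus>s\<in>A. f s t)"
    using insert.IH insert.prems by simp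
  also have "\<dots> = (\<Oplus>t\<in>B. f x t \<oplus> (\<Oplus>s\<in>A. f s t))"
    using insert.prems cl' by (intro finsum_addf[symmetric]) auto
  also have "\<dots> = (\<Oplus>t\<in>B. \<Oplus>s\<in>insert x A. f s t)"
    using insert.prems insert.hyps by (intro finsum_cong'[OF refl]) (auto simp: finsum_insert intro!: finsum_closed)
  finally show ?case .
qed

lemma is_mat_mul:
  assumes "is_mat R m l A" "is_mat R l n B"
  shows "is_mat R m n (mat_mul R l A B)"
  using assms by (auto simp: is_mat_def mat_mul_def intro!: finsum_closed)

lemma mat_mul_cong:
  assumes "mat_eq m l A A'" "mat_eq l n B B'" "is_mat R m l A" "is_mat R l n B"
  shows "mat_eq m n (mat_mul R l A B) (mat_mul R l A' B')"
  unfolding mat_eq_def mat_mul_def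
  using assms by (auto intro!: finsum_cong'[OF refl] simp: is_mat_def mat_eq_def)

lemma mat_mul_assoc:
  assumes "is_mat R m k A" "is_mat R k l B" "is_mat R l n C"
  shows "mat_eq m n (mat_mul R l (mat_mul R k A B) C) (mat_mul R k A (mat_mul R l B C))"
  unfolding mat_eq_def mat_mul_def
proof (intro allI impI)
  fix i j assume ij: "i < m" "j < n"
  have c: "A i s \<in> carrier R" "B s t \<in> carrier R" "C t j \<in> carrier R" if "s < k" "t < l" for s t
    using assms ij that by (auto simp: is_mat_def)
  have "(\<Oplus>t\<in>{..<l}. (\<Oplus>s\<in>{..<k}. A i s \<otimes> B s t) \<otimes> C t j) = (\<Oplus>t\<in>{..<l}. \<Oplus>s\<in>{..<k}. A i s \<otimes> (B s t \<otimes> C t j))"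
  proof (rule finsum_cong'[OF refl])
    fix t assume t: "t \<in> {..<l}"
    then have C: "C t j \<in> carrier R" using assms ij by (auto simp: is_mat_def)
    have "(\<Oplus>s\<in>{..<k}. A i s \<otimes> B s t) \<otimes> C t j = (\<Oplus>s\<in>{..<k}. A i s \<otimes> B s t \<otimes> C t j)"
      using c t C by (intro finsum_ldistr) auto
    also have "\<dots> = (\<Oplus>s\<in>{..<k}. A i s \<otimes> (B s t \<otimes> C t j))"
      using c t by (intro finsum_cong'[OF refl]) (auto simp: m_assoc)
    finally show "(\<Oplus>s\<in>{..<k}. A i s \<otimes> B s t) \<otimes> C t j = (\<Oplus>s\<in>{..<k}. A i s \<otimes> (B s t \<otimes> C t j))" .
  qed (use c in \<open>auto intro!: finsum_closed\<close>)
  also have "\<dots> = (\<Oplus>s\<in>{..<k}. \<Oplus>t\<in>{..<l}. A i s \<otimes> (B s t \<otimes> C t j))"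
    using c by (intro finsum_swap) auto
  also have "\<dots> = (\<Oplus>s\<in>{..<k}. A i s \<otimes> (\<Oplus>t\<in>{..<l}. B s t \<otimes> C t j))"
  proof (rule finsum_cong'[OF refl])
    fix s assume s: "s \<in> {..<k}"
    then have A: "A i s \<in> carrier R" using assms ij by (auto simp: is_mat_def)
    show "(\<Oplus>t\<in>{..<l}. A i s \<otimes> (B s t \<otimes> C t j)) = A i s \<otimes> (\<Oplus>t\<in>{..<l}. B s t \<otimes> C t j)"
      using c s A by (intro finsum_rdistr[symmetric]) auto
  next
    have "A i s \<in> carrier R" if "s < k" for s using assms ij that by (auto simp: is_mat_def)
    then show "(\<lambda>s. A i s \<otimes> (\<Oplus>t\<in>{..<l}. B s t \<otimes> C t j)) \<in> {..<k} \<rightarrow> carrier R"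
      using c by (auto intro!: finsum_closed)
  qed
  finally show "(\<Oplus>t\<in>{..<l}. (\<Oplus>s\<in>{..<k}. A i s \<otimes> B s t) \<otimes> C t j) = (\<Oplus>s\<in>{..<k}. A i s \<otimes> (\<Oplus>t\<in>{..<l}. B s t \<otimes> C t j))" .
qed

lemma mat_mul_transpose:
  assumes "is_mat R m l A" "is_mat R l n B"
  shows "mat_eq n m (mat_transpose (mat_mul R l A B)) (mat_mul R l (mat_transpose B) (mat_transpose A))"
  unfolding mat_eq_def mat_mul_def
  using assms by (auto intro!: finsum_cong'[OF refl] simp: is_mat_def m_comm)

lemma is_mat_id: "is_mat R m n (mat_id R)"
  by (auto simp: is_mat_def mat_id_def)

lemma mat_mul_id_left:
  assumes "is_mat R m n M"
  shows "mat_eq m n (mat_mul R m (mat_id R) M) M"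
  unfolding mat_eq_def
proof (intro allI impI)
  fix i j assume ij: "i < m" "j < n"
  have c: "M t j \<in> carrier R" if "t < m" for t using assms ij that by (auto simp: is_mat_def)
  have "mat_mul R m (mat_id R) M i j = (\<Oplus>t\<in>{..<m}. if i = t then M t j else \<zero>)"
    unfolding mat_mul_def mat_id_def using c by (intro finsum_cong'[OF refl]) auto
  also have "\<dots> = M i j" using ij c by (intro finsum_singleton) auto
  finally show "mat_mul R m (mat_id R) M i j = M i j" .
qed

lemma mat_mul_id_right:
  assumes "is_mat R m n M"
  shows "mat_eq m n (mat_mul R n M (mat_id R)) M"
proof -
  have "mat_eq n m (mat_mul R n (mat_id R) (mat_transpose M)) (mat_transpose M)"
    by (rule mat_mul_id_left[OF is_mat_transpose[OF assms]])
  moreover have "mat_eq n m (mat_transpose (mat_mul R n M (mat_id R))) (mat_mul R n (mat_transpose (mat_id R)) (mat_transpose M))"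
    by (rule mat_mul_transpose[OF assms is_mat_id])
  moreover have "mat_transpose (mat_id R) = mat_id R" by (auto simp: mat_id_def fun_eq_iff)
  ultimately show ?thesis by (auto simp: mat_eq_def)
qed

lemma invertible_mat_iff:
  "invertible_mat R n P \<longleftrightarrow> is_mat R n n P \<and> (\<exists>P'. is_mat R n n P' \<and>
     mat_eq n n (mat_mul R n P P') (mat_id R) \<and> mat_eq n n (mat_mul R n P' P) (mat_id R))"
  by (auto simp: invertible_mat_def mat_eq_def mat_id_def)

lemma invertible_mat_transpose:
  assumes "invertible_mat R n P"
  shows "invertible_mat R n (mat_transpose P)"
proof -
  obtain P' where P: "is_mat R n n P" "is_mat R n n P'" "mat_eq n n (mat_mul R n P P') (mat_id R)"
    "mat_eq n n (mat_mul R n P' P) (mat_id R)"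
    using assms unfolding invertible_mat_iff by blast
  have *: "mat_eq n n (mat_mul R n (mat_transpose A) (mat_transpose B)) (mat_id R)"
    if "is_mat R n n A" "is_mat R n n B" "mat_eq n n (mat_mul R n B A) (mat_id R)" for A B
    using mat_mul_transpose[OF that(2,1)] that(3) by (auto simp: mat_eq_def mat_id_def)
  show ?thesis
    unfolding invertible_mat_iff
    by (intro conjI exI[of _ "mat_transpose P'"] is_mat_transpose[OF P(1)] is_mat_transpose[OF P(2)] *[OF P(1,2,4)] *[OF P(2,1,3)])
qed

lemma mat_mul_inverse_pair:
  assumes P: "is_mat R n n P" "is_mat R n n P'" and Q: "is_mat R n n Q" "is_mat R n n Q'"
    and PP: "mat_eq n n (mat_mul R n P P') (mat_id R)" and QQ: "mat_eq n n (mat_mul R n Q Q') (mat_id R)"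
  shows "mat_eq n n (mat_mul R n (mat_mul R n P Q) (mat_mul R n Q' P')) (mat_id R)"
proof -
  note cl = P Q is_mat_mul is_mat_id mat_eq_refl
  have "mat_eq n n (mat_mul R n (mat_mul R n P Q) (mat_mul R n Q' P')) (mat_mul R n P (mat_mul R n Q (mat_mul R n Q' P')))"
    by (intro mat_mul_assoc cl)
  also have "mat_eq n n \<dots> (mat_mul R n P (mat_mul R n (mat_mul R n Q Q') P'))"
    by (intro mat_mul_cong mat_eq_sym[OF mat_mul_assoc] cl)
  also have "mat_eq n n \<dots> (mat_mul R n P (mat_mul R n (mat_id R) P'))"
    by (intro mat_mul_cong QQ cl)
  also have "mat_eq n n \<dots> (mat_mul R n P P')"
    by (intro mat_mul_cong mat_mul_id_left cl)
  also note PP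
  finally show ?thesis .
qed

lemma invertible_mat_mul:
  assumes "invertible_mat R n P" "invertible_mat R n Q"
  shows "invertible_mat R n (mat_mul R n P Q)"
proof -
  obtain P' where P: "is_mat R n n P" "is_mat R n n P'" "mat_eq n n (mat_mul R n P P') (mat_id R)"
    "mat_eq n n (mat_mul R n P' P) (mat_id R)"
    using assms(1) unfolding invertible_mat_iff by blast
  obtain Q' where Q: "is_mat R n n Q" "is_mat R n n Q'" "mat_eq n n (mat_mul R n Q Q') (mat_id R)"
    "mat_eq n n (mat_mul R n Q' Q) (mat_id R)"
    using assms(2) unfolding invertible_mat_iff by blast
  show ?thesis
    unfolding invertible_mat_iff
  proof (intro conjI exI)
    show "mat_eq n n (mat_mul R n (mat_mul R n P Q) (mat_mul R n Q' P')) (mat_id R)"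
      by (rule mat_mul_inverse_pair[OF P(1,2) Q(1,2) P(3) Q(3)])
    show "mat_eq n n (mat_mul R n (mat_mul R n Q' P') (mat_mul R n P Q)) (mat_id R)"
      by (rule mat_mul_inverse_pair[OF Q(2,1) P(2,1) Q(4) P(4)])
  qed (intro is_mat_mul P Q)+
qed

lemma invertible_mat_id: "invertible_mat R n (mat_id R)"
  unfolding invertible_mat_iff using is_mat_id mat_mul_id_left[OF is_mat_id] by blast

lemma mat_equiv_refl:
  assumes "is_mat R m n M"
  shows "mat_equiv R m n M M"
proof -
  have "mat_eq m n (mat_mul R n (mat_mul R m (mat_id R) M) (mat_id R)) (mat_mul R m (mat_id R) M)"
    by (intro mat_mul_id_right is_mat_mul is_mat_id assms)
  also note mat_mul_id_left[OF assms]
  finally show ?thesis unfolding mat_equiv_def using assms invertible_mat_id by blast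
qed

lemma mat_equiv_transpose:
  assumes "mat_equiv R m n M N"
  shows "mat_equiv R n m (mat_transpose M) (mat_transpose N)"
proof -
  obtain P Q where inv: "invertible_mat R m P" "invertible_mat R n Q"
    and M: "is_mat R m n M" and N: "is_mat R m n N"
    and eq: "mat_eq m n (mat_mul R n (mat_mul R m P M) Q) N"
    using assms unfolding mat_equiv_def by blast
  have P: "is_mat R m m P" and Q: "is_mat R n n Q" using inv by (auto simp: invertible_mat_iff)
  note T = is_mat_transpose[OF P] is_mat_transpose[OF Q] is_mat_transpose[OF M]
  have "mat_eq n m (mat_mul R m (mat_mul R n (mat_transpose Q) (mat_transpose M)) (mat_transpose P))
          (mat_mul R n (mat_transpose Q) (mat_mul R m (mat_transpose M) (mat_transpose P)))"
    by (intro mat_mul_assoc T)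
  also have "mat_eq n m \<dots> (mat_mul R n (mat_transpose Q) (mat_transpose (mat_mul R m P M)))"
    by (intro mat_mul_cong mat_eq_refl mat_eq_sym[OF mat_mul_transpose[OF P M]] T is_mat_mul)
  also have "mat_eq n m \<dots> (mat_transpose (mat_mul R n (mat_mul R m P M) Q))"
    by (rule mat_eq_sym[OF mat_mul_transpose[OF is_mat_mul[OF P M] Q]])
  also have "mat_eq n m \<dots> (mat_transpose N)" using eq by (auto simp: mat_eq_def)
  finally have eq': "mat_eq n m (mat_mul R m (mat_mul R n (mat_transpose Q) (mat_transpose M)) (mat_transpose P)) (mat_transpose N)" .
  show ?thesis
    unfolding mat_equiv_def
    by (intro conjI exI[of _ "mat_transpose Q"] exI[of _ "mat_transpose P"] T is_mat_transpose[OF N]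
        invertible_mat_transpose[OF inv(1)] invertible_mat_transpose[OF inv(2)] eq')
qed

lemma mat_equiv_mul_left:
  assumes eqv: "mat_equiv R m n M N" and E: "invertible_mat R m E" and N': "mat_eq m n (mat_mul R m E N) N'"
  shows "mat_equiv R m n M N'"
proof -
  obtain P Q where inv: "invertible_mat R m P" "invertible_mat R n Q"
    and M: "is_mat R m n M" and N: "is_mat R m n N"
    and eq: "mat_eq m n (mat_mul R n (mat_mul R m P M) Q) N"
    using assms unfolding mat_equiv_def by blast
  have P: "is_mat R m m P" and Q: "is_mat R n n Q" and E': "is_mat R m m E" using inv E by (auto simp: invertible_mat_iff)
  have "mat_eq m n (mat_mul R n (mat_mul R m (mat_mul R m E P) M) Q) (mat_mul R n (mat_mul R m E (mat_mul R m P M)) Q)"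
    by (intro mat_mul_cong mat_eq_refl mat_mul_assoc is_mat_mul P Q E' M)
  also have "mat_eq m n \<dots> (mat_mul R m E (mat_mul R n (mat_mul R m P M) Q))"
    by (intro mat_mul_assoc is_mat_mul P Q E' M)
  also have "mat_eq m n \<dots> (mat_mul R m E N)"
    by (intro mat_mul_cong eq mat_eq_refl is_mat_mul P Q E' M)
  also note N'
  finally show ?thesis
    unfolding mat_equiv_def using inv M invertible_mat_mul[OF E inv(1)] mat_eq_is_mat[OF N' is_mat_mul[OF E' N]] by blast
qed

text \<open>The factor P is a left multiplication, and Q becomes one after transposing, so
  \<open>mat_equiv_mul_left\<close> serves for both sides.\<close>

lemma mat_equiv_trans [trans]:
  assumes "mat_equiv R m n L M" "mat_equiv R m n M N"
  shows "mat_equiv R m n L N"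
proof -
  obtain P Q where inv: "invertible_mat R m P" "invertible_mat R n Q"
    and M: "is_mat R m n M" and N: "is_mat R m n N"
    and eq: "mat_eq m n (mat_mul R n (mat_mul R m P M) Q) N"
    using assms(2) unfolding mat_equiv_def by blast
  have P: "is_mat R m m P" and Q: "is_mat R n n Q" using inv by (auto simp: invertible_mat_iff)
  have "mat_equiv R m n L (mat_mul R m P M)"
    by (rule mat_equiv_mul_left[OF assms(1) inv(1) mat_eq_refl])
  then have eqv: "mat_equiv R n m (mat_transpose L) (mat_transpose (mat_mul R m P M))"
    by (rule mat_equiv_transpose)
  have eq': "mat_eq n m (mat_mul R n (mat_transpose Q) (mat_transpose (mat_mul R m P M))) (mat_transpose N)"
    using mat_mul_transpose[OF is_mat_mul[OF P M] Q] eq by (auto simp: mat_eq_def)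
  have "mat_equiv R n m (mat_transpose L) (mat_transpose N)"
    by (rule mat_equiv_mul_left[OF eqv invertible_mat_transpose[OF inv(2)] eq'])
  from mat_equiv_transpose[OF this] show ?thesis .
qed

lemma mat_equiv_cong:
  assumes "mat_equiv R m n M N" "mat_eq m n N N'"
  shows "mat_equiv R m n M N'"
proof (rule mat_equiv_mul_left[OF assms(1) invertible_mat_id])
  have "is_mat R m n N" using assms unfolding mat_equiv_def by blast
  from mat_eq_trans[OF mat_mul_id_left[OF this] assms(2)]
  show "mat_eq m n (mat_mul R m (mat_id R) N) N'" .
qed

lemma mat_equiv_is_mat:
  assumes "mat_equiv R m n M N"
  shows "is_mat R m n M" "is_mat R m n N"
  using assms unfolding mat_equiv_def by auto

section \<open>Row and column operations of determinant 1\<close>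

lemma is_mat_row_op:
  assumes "is_mat R m n M" "i < m" "j < m" "\<alpha> \<in> carrier R" "\<beta> \<in> carrier R" "\<gamma> \<in> carrier R" "\<delta> \<in> carrier R"
  shows "is_mat R m n (row_op R i j \<alpha> \<beta> \<gamma> \<delta> M)"
  using assms by (auto simp: is_mat_def row_op_def)

text \<open>With A the identity matrix this exhibits a row operation as left multiplication by the
  transformed identity.\<close>

lemma row_op_mat_mul:
  assumes A: "is_mat R m l A" and B: "is_mat R l n B" and ij: "i < m" "j < m"
    and c: "\<alpha> \<in> carrier R" "\<beta> \<in> carrier R" "\<gamma> \<in> carrier R" "\<delta> \<in> carrier R"
  shows "mat_eq m n (mat_mul R l (row_op R i j \<alpha> \<beta> \<gamma> \<delta> A) B) (row_op R i j \<alpha> \<beta> \<gamma> \<delta> (mat_mul R l A B))"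
proof -
  have *: "(\<Oplus>t\<in>{..<l}. (x \<otimes> A i t \<oplus> y \<otimes> A j t) \<otimes> B t q)
      = x \<otimes> (\<Oplus>t\<in>{..<l}. A i t \<otimes> B t q) \<oplus> y \<otimes> (\<Oplus>t\<in>{..<l}. A j t \<otimes> B t q)"
    if x: "x \<in> carrier R" "y \<in> carrier R" and q: "q < n" for x y q
  proof -
    have cA: "A i t \<in> carrier R" "A j t \<in> carrier R" "B t q \<in> carrier R" if "t < l" for t
      using A B ij q that by (auto simp: is_mat_def)
    have "x \<otimes> (\<Oplus>t\<in>{..<l}. A i t \<otimes> B t q) \<oplus> y \<otimes> (\<Oplus>t\<in>{..<l}. A j t \<otimes> B t q)
      = (\<Oplus>t\<in>{..<l}. x \<otimes> (A i t \<otimes> B t q)) \<oplus> (\<Oplus>t\<in>{..<l}. y \<otimes> (A j t \<otimes> B t q))"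
      using cA x by (subst (1 2) finsum_rdistr) auto
    also have "\<dots> = (\<Oplus>t\<in>{..<l}. x \<otimes> (A i t \<otimes> B t q) \<oplus> y \<otimes> (A j t \<otimes> B t q))"
      using cA x by (intro finsum_addf[symmetric]) auto
    also have "\<dots> = (\<Oplus>t\<in>{..<l}. (x \<otimes> A i t \<oplus> y \<otimes> A j t) \<otimes> B t q)"
      using cA x by (intro finsum_cong'[OF refl]) (auto simp: l_distr m_assoc)
    finally show ?thesis by simp
  qed
  show ?thesis
    unfolding mat_eq_def mat_mul_def row_op_def using * c by auto
qed

text \<open>The inner terms apply the adjugate, with rows (\<delta>, -\<beta>) and (-\<gamma>,
  \<alpha>), which is the inverse at determinant 1.\<close>

lemma sl2_cancel:
  assumes "x \<in> carrier R" "y \<in> carrier R" and s: "sl2 R \<alpha> \<beta> \<gamma> \<delta>"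
  shows "\<alpha> \<otimes> (\<delta> \<otimes> x \<oplus> \<ominus> \<beta> \<otimes> y) \<oplus> \<beta> \<otimes> (\<ominus> \<gamma> \<otimes> x \<oplus> \<alpha> \<otimes> y) = x"
    and "\<gamma> \<otimes> (\<delta> \<otimes> x \<oplus> \<ominus> \<beta> \<otimes> y) \<oplus> \<delta> \<otimes> (\<ominus> \<gamma> \<otimes> x \<oplus> \<alpha> \<otimes> y) = y"
proof -
  have c: "\<alpha> \<in> carrier R" "\<beta> \<in> carrier R" "\<gamma> \<in> carrier R" "\<delta> \<in> carrier R" and d: "\<alpha> \<otimes> \<delta> \<ominus> \<beta> \<otimes> \<gamma> = \<one>"
    using s by (auto simp: sl2_def)
  note [simp, carr] = c assms(1,2)
  have "\<alpha> \<otimes> (\<delta> \<otimes> x \<oplus> \<ominus> \<beta> \<otimes> y) \<oplus> \<beta> \<otimes> (\<ominus> \<gamma> \<otimes> x \<oplus> \<alpha> \<otimes> y) = (\<alpha> \<otimes> \<delta> \<ominus> \<beta> \<otimes> \<gamma>) \<otimes> x"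
    using c assms by algebra
  then show "\<alpha> \<otimes> (\<delta> \<otimes> x \<oplus> \<ominus> \<beta> \<otimes> y) \<oplus> \<beta> \<otimes> (\<ominus> \<gamma> \<otimes> x \<oplus> \<alpha> \<otimes> y) = x"
    unfolding d by simp
  have "\<gamma> \<otimes> (\<delta> \<otimes> x \<oplus> \<ominus> \<beta> \<otimes> y) \<oplus> \<delta> \<otimes> (\<ominus> \<gamma> \<otimes> x \<oplus> \<alpha> \<otimes> y) = (\<alpha> \<otimes> \<delta> \<ominus> \<beta> \<otimes> \<gamma>) \<otimes> y"
    using c assms by algebra
  then show "\<gamma> \<otimes> (\<delta> \<otimes> x \<oplus> \<ominus> \<beta> \<otimes> y) \<oplus> \<delta> \<otimes> (\<ominus> \<gamma> \<otimes> x \<oplus> \<alpha> \<otimes> y) = y"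
    unfolding d by simp
qed

lemma row_op_inverse:
  assumes M: "is_mat R m n M" and ij: "i < m" "j < m" "i \<noteq> j" and s: "sl2 R \<alpha> \<beta> \<gamma> \<delta>"
  shows "mat_eq m n (row_op R i j \<alpha> \<beta> \<gamma> \<delta> (row_op R i j \<delta> (\<ominus> \<beta>) (\<ominus> \<gamma>) \<alpha> M)) M"
  using sl2_cancel[OF _ _ s] M ij unfolding mat_eq_def row_op_def is_mat_def by simp

lemma row_op_invertible:
  assumes ij: "i < m" "j < m" "i \<noteq> j" and s: "sl2 R \<alpha> \<beta> \<gamma> \<delta>"
  shows "invertible_mat R m (row_op R i j \<alpha> \<beta> \<gamma> \<delta> (mat_id R))"
proof -
  have c: "\<alpha> \<in> carrier R" "\<beta> \<in> carrier R" "\<gamma> \<in> carrier R" "\<delta> \<in> carrier R" and d: "\<alpha> \<otimes> \<delta> \<ominus> \<beta> \<otimes> \<gamma> = \<one>"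
    using s by (auto simp: sl2_def)
  have "\<delta> \<otimes> \<alpha> \<ominus> \<ominus> \<beta> \<otimes> \<ominus> \<gamma> = \<alpha> \<otimes> \<delta> \<ominus> \<beta> \<otimes> \<gamma>" using c by algebra
  then have s': "sl2 R \<delta> (\<ominus> \<beta>) (\<ominus> \<gamma>) \<alpha>" using c d by (simp add: sl2_def)
  have prod: "mat_eq m m (mat_mul R m (row_op R i j a b c' d' (mat_id R)) (row_op R i j d' (\<ominus> b) (\<ominus> c') a (mat_id R))) (mat_id R)"
    if t: "sl2 R a b c' d'" for a b c' d'
  proof -
    have c: "a \<in> carrier R" "b \<in> carrier R" "c' \<in> carrier R" "d' \<in> carrier R" using t by (auto simp: sl2_def)
    let ?E = "row_op R i j d' (\<ominus> b) (\<ominus> c') a (mat_id R)"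
    have E: "is_mat R m m ?E" using c ij by (intro is_mat_row_op is_mat_id) auto
    have "mat_eq m m (mat_mul R m (row_op R i j a b c' d' (mat_id R)) ?E) (row_op R i j a b c' d' (mat_mul R m (mat_id R) ?E))"
      by (rule row_op_mat_mul[OF is_mat_id E ij(1,2) c])
    also have "mat_eq m m \<dots> (row_op R i j a b c' d' ?E)"
      using mat_mul_id_left[OF E] ij unfolding mat_eq_def row_op_def[of R i j a b c' d'] by simp
    also have "mat_eq m m \<dots> (mat_id R)" by (rule row_op_inverse[OF is_mat_id ij t])
    finally show ?thesis .
  qed
  have "mat_eq m m (mat_mul R m (row_op R i j \<delta> (\<ominus> \<beta>) (\<ominus> \<gamma>) \<alpha> (mat_id R)) (row_op R i j \<alpha> \<beta> \<gamma> \<delta> (mat_id R))) (mat_id R)"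
    using prod[OF s'] c by simp
  moreover have "is_mat R m m (row_op R i j \<alpha> \<beta> \<gamma> \<delta> (mat_id R))" "is_mat R m m (row_op R i j \<delta> (\<ominus> \<beta>) (\<ominus> \<gamma>) \<alpha> (mat_id R))"
    using c ij by (auto intro!: is_mat_row_op is_mat_id)
  ultimately show ?thesis unfolding invertible_mat_iff using prod[OF s] by blast
qed

lemma mat_equiv_row_op:
  assumes "mat_equiv R m n M N" and ij: "i < m" "j < m" "i \<noteq> j" and s: "sl2 R \<alpha> \<beta> \<gamma> \<delta>"
  shows "mat_equiv R m n M (row_op R i j \<alpha> \<beta> \<gamma> \<delta> N)"
proof (rule mat_equiv_mul_left[OF assms(1) row_op_invertible[OF ij s]])
  have c: "\<alpha> \<in> carrier R" "\<beta> \<in> carrier R" "\<gamma> \<in> carrier R" "\<delta> \<in> carrier R" using s by (auto simp: sl2_def)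
  have N: "is_mat R m n N" using mat_equiv_is_mat[OF assms(1)] by simp
  have "mat_eq m n (mat_mul R m (row_op R i j \<alpha> \<beta> \<gamma> \<delta> (mat_id R)) N) (row_op R i j \<alpha> \<beta> \<gamma> \<delta> (mat_mul R m (mat_id R) N))"
    by (rule row_op_mat_mul[OF is_mat_id N ij(1,2) c])
  also have "mat_eq m n \<dots> (row_op R i j \<alpha> \<beta> \<gamma> \<delta> N)"
    using mat_mul_id_left[OF N] ij unfolding mat_eq_def row_op_def by simp
  finally show "mat_eq m n (mat_mul R m (row_op R i j \<alpha> \<beta> \<gamma> \<delta> (mat_id R)) N) (row_op R i j \<alpha> \<beta> \<gamma> \<delta> N)" .
qed

lemma mat_equiv_col_op:
  assumes "mat_equiv R m n M N" and ij: "i < n" "j < n" "i \<noteq> j" and s: "sl2 R \<alpha> \<beta> \<gamma> \<delta>"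
  shows "mat_equiv R m n M (col_op R i j \<alpha> \<beta> \<gamma> \<delta> N)"
  using mat_equiv_transpose[OF mat_equiv_row_op[OF mat_equiv_transpose[OF assms(1)] ij s]] .

end

section \<open>Elimination to diagonal form\<close>

definition offdiag_zero :: "('a, 'm) ring_scheme \<Rightarrow> nat \<Rightarrow> nat \<Rightarrow> nat \<Rightarrow> (nat \<Rightarrow> nat \<Rightarrow> 'a) \<Rightarrow> bool" where
  "offdiag_zero R m n k N \<longleftrightarrow> (\<forall>i<m. \<forall>j<n. i \<noteq> j \<longrightarrow> i < k \<or> j < k \<longrightarrow> N i j = \<zero>\<^bsub>R\<^esub>)"

text \<open>The rows stop at l while the columns run to the end: \<open>gcd_to_corner\<close> takes
  in one row at a time.\<close>

definition block_dvd :: "('a, 'm) ring_scheme \<Rightarrow> nat \<Rightarrow> nat \<Rightarrow> nat \<Rightarrow> 'a \<Rightarrow> (nat \<Rightarrow> nat \<Rightarrow> 'a) \<Rightarrow> bool" where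
  "block_dvd R k l n g N \<longleftrightarrow> (\<forall>i\<in>{k..<l}. \<forall>j\<in>{k..<n}. g divides\<^bsub>R\<^esub> N i j)"

text \<open>What remains true after column operations among the columns from c on. Taking d to be
  zero in the last clause shows that vanishing rows stay zero.\<close>
definition col_reduction :: "('a, 'm) ring_scheme \<Rightarrow> nat \<Rightarrow> nat \<Rightarrow> nat \<Rightarrow> (nat \<Rightarrow> nat \<Rightarrow> 'a) \<Rightarrow> (nat \<Rightarrow> nat \<Rightarrow> 'a) \<Rightarrow> bool" where
  "col_reduction R m n c M N \<longleftrightarrow> mat_equiv R m n M N \<and> (\<forall>i<m. \<forall>j<c. N i j = M i j) \<and>
     (\<forall>i<m. \<forall>d\<in>carrier R. (\<forall>j\<in>{c..<n}. d divides\<^bsub>R\<^esub> M i j) \<longrightarrow> (\<forall>j\<in>{c..<n}. d divides\<^bsub>R\<^esub> N i j))"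

context cring
begin

lemma divides_combination:
  assumes "d divides x" "d divides y" and [simp, carr]: "d \<in> carrier R" "\<alpha> \<in> carrier R" "\<beta> \<in> carrier R"
  shows "d divides (\<alpha> \<otimes> x \<oplus> \<beta> \<otimes> y)"
proof -
  obtain x' where [simp, carr]: "x' \<in> carrier R" and x: "x = d \<otimes> x'" using assms(1) unfolding factor_def by blast
  obtain y' where [simp, carr]: "y' \<in> carrier R" and y: "y = d \<otimes> y'" using assms(2) unfolding factor_def by blast
  have "\<alpha> \<otimes> x \<oplus> \<beta> \<otimes> y = d \<otimes> (\<alpha> \<otimes> x' \<oplus> \<beta> \<otimes> y')" unfolding x y using carr by algebra
  moreover have "\<alpha> \<otimes> x' \<oplus> \<beta> \<otimes> y' \<in> carrier R" by simp
  ultimately show ?thesis unfolding factor_def by blast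
qed

lemma zero_divides_iff: "x \<in> carrier R \<Longrightarrow> \<zero> divides x \<longleftrightarrow> x = \<zero>"
  unfolding factor_def by auto

lemma divides_zero': "x \<in> carrier R \<Longrightarrow> x divides \<zero>"
  unfolding factor_def by (intro bexI[of _ \<zero>]) auto

lemma col_reductionD:
  assumes "col_reduction R m n c M N"
  shows "mat_equiv R m n M N"
    and "\<And>i j. \<lbrakk>i < m; j < c\<rbrakk> \<Longrightarrow> N i j = M i j"
    and "\<And>i j d. \<lbrakk>i < m; c \<le> j; j < n; d \<in> carrier R; \<And>j. \<lbrakk>c \<le> j; j < n\<rbrakk> \<Longrightarrow> d divides M i j\<rbrakk> \<Longrightarrow> d divides N i j"
  using assms unfolding col_reduction_def by auto

lemma col_reduction_offdiag_zero:
  assumes red: "col_reduction R m n c M N" and M: "offdiag_zero R m n k M" and kc: "k \<le> c"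
  shows "offdiag_zero R m n k N"
  unfolding offdiag_zero_def
proof (intro allI impI)
  fix i j assume ij: "i < m" "j < n" "i \<noteq> j" "i < k \<or> j < k"
  have N: "is_mat R m n N" using mat_equiv_is_mat[OF col_reductionD(1)[OF red]] by simp
  show "N i j = \<zero>"
  proof (cases "j < c")
    case True
    then show ?thesis using col_reductionD(2)[OF red] ij M by (auto simp: offdiag_zero_def)
  next
    case False
    then have i: "i < k" using ij kc by auto
    have "\<zero> divides M i j'" if "c \<le> j'" "j' < n" for j'
      using that M i ij kc divides_zero' by (simp add: offdiag_zero_def)
    then have "\<zero> divides N i j" using col_reductionD(3)[OF red ij(1) _ ij(2) zero_closed] False by simp
    then show ?thesis using zero_divides_iff is_matD[OF N ij(1,2)] by simp
  qed
qed

lemma col_reduction_block_dvd: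
  assumes red: "col_reduction R m n c M N" and M: "block_dvd R k l n g M" and kc: "k \<le> c" "l \<le> m" "g \<in> carrier R"
  shows "block_dvd R k l n g N"
  unfolding block_dvd_def
proof (intro ballI)
  fix i j assume ij: "i \<in> {k..<l}" "j \<in> {k..<n}"
  show "g divides N i j"
  proof (cases "j < c")
    case True
    then show ?thesis using col_reductionD(2)[OF red, of i j] ij kc M by (auto simp: block_dvd_def)
  next
    case False
    then show ?thesis using ij kc M by (intro col_reductionD(3)[OF red]) (auto simp: block_dvd_def)
  qed
qed

text \<open>c marks how far the columns have been treated. Column k, the source of all multiples,
  never changes, so the operations do not interfere.\<close>

lemma add_col_multiples:
  assumes M: "is_mat R m n M" and k: "k < n" and q: "\<And>j. j < n \<Longrightarrow> q j \<in> carrier R"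
  shows "c \<le> n \<Longrightarrow> mat_equiv R m n M (\<lambda>i j. if k < j \<and> j < c then M i j \<ominus> q j \<otimes> M i k else M i j)"
proof (induction c)
  case 0
  then show ?case using mat_equiv_refl[OF M] by simp
next
  case (Suc c)
  let ?N = "\<lambda>c i j. if k < j \<and> j < c then M i j \<ominus> q j \<otimes> M i k else M i j"
  have IH: "mat_equiv R m n M (?N c)" using Suc by simp
  show ?case
  proof (cases "k < c")
    case False
    then have "mat_eq m n (?N c) (?N (Suc c))" by (auto simp: mat_eq_def less_Suc_eq)
    then show ?thesis by (rule mat_equiv_cong[OF IH])
  next
    case True
    have c: "c < n" using Suc.prems by simp
    have "sl2 R \<one> \<zero> (\<ominus> q c) \<one>" using q[OF c] by (simp add: sl2_def a_minus_def)
    then have "mat_equiv R m n M (col_op R k c \<one> \<zero> (\<ominus> q c) \<one> (?N c))"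
      using mat_equiv_col_op[OF IH k c] True by simp
    moreover have "mat_eq m n (col_op R k c \<one> \<zero> (\<ominus> q c) \<one> (?N c)) (?N (Suc c))"
      unfolding mat_eq_def
    proof (intro allI impI)
      fix i j assume ij: "i < m" "j < n"
      have [simp, carr]: "M i k \<in> carrier R" "M i c \<in> carrier R" "M i j \<in> carrier R" "q c \<in> carrier R"
        using M ij k c q by (auto simp: is_mat_def)
      have "\<ominus> q c \<otimes> M i k \<oplus> \<one> \<otimes> M i c = M i c \<ominus> q c \<otimes> M i k"
        by (simp add: a_minus_def l_minus a_comm)
      then show "col_op R k c \<one> \<zero> (\<ominus> q c) \<one> (?N c) i j = ?N (Suc c) i j"
        using True by (auto simp: row_op_def less_Suc_eq)
    qed
    ultimately show ?thesis by (rule mat_equiv_cong)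
  qed
qed

lemma clear_row:
  assumes M: "is_mat R m n M" and k: "k < m" "k < n" and dv: "\<And>j. \<lbrakk>k < j; j < n\<rbrakk> \<Longrightarrow> M k k divides M k j"
  obtains N where "col_reduction R m n k M N" "\<And>i. i < m \<Longrightarrow> N i k = M i k" "\<And>j. \<lbrakk>k < j; j < n\<rbrakk> \<Longrightarrow> N k j = \<zero>"
proof -
  have "\<forall>j. \<exists>q. k < j \<and> j < n \<longrightarrow> q \<in> carrier R \<and> M k j = M k k \<otimes> q"
    using dv unfolding factor_def by blast
  then obtain q0 where q0: "\<And>j. \<lbrakk>k < j; j < n\<rbrakk> \<Longrightarrow> q0 j \<in> carrier R \<and> M k j = M k k \<otimes> q0 j" by metis
  \<comment> \<open>q0 is unspecified outside the range k < j < n; the value 0 keeps q inside the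
    carrier for every column.\<close>
  define q where "q = (\<lambda>j. if k < j \<and> j < n then q0 j else \<zero>)"
  have q: "q j \<in> carrier R" for j using q0 by (simp add: q_def)
  define N where "N = (\<lambda>i j. if k < j \<and> j < n then M i j \<ominus> q j \<otimes> M i k else M i j)"
  have Mc: "M i j \<in> carrier R" if "i < m" "j < n" for i j using M that by (rule is_matD)
  have "mat_equiv R m n M N" unfolding N_def by (rule add_col_multiples[OF M k(2) q order_refl])
  moreover have "d divides N i j" if i: "i < m" and d: "d \<in> carrier R" and D: "\<forall>j\<in>{k..<n}. d divides M i j"
    and j: "j \<in> {k..<n}" for i j d
  proof (cases "k < j")
    case True
    have "d divides (\<one> \<otimes> M i j \<oplus> \<ominus> q j \<otimes> M i k)"
      by (rule divides_combination) (use D j d q k in auto)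
    then show ?thesis using True j i k q Mc by (simp add: N_def a_minus_def l_minus)
  next
    case False
    then show ?thesis using D j by (simp add: N_def)
  qed
  ultimately have "col_reduction R m n k M N"
    unfolding col_reduction_def by (auto simp: N_def)
  moreover have "N k j = \<zero>" if "k < j" "j < n" for j
    using q0[OF that] that Mc[OF k] m_comm[of "M k k" "q0 j"] by (simp add: N_def q_def a_minus_def r_neg)
  ultimately show ?thesis by (intro that[of N]) (auto simp: N_def)
qed

text \<open>Column c0 accumulates the gcd: if the two entries of row l are x d and y d with u x + v
  y = 1, the operation with rows (u, v) and (-y, x) sends them to d and 0.\<close>

lemma hermite_row:
  assumes H: "hermite_ring R" and M: "is_mat R m n M" and l: "l < m" and c0: "c0 < n"
  shows "c \<le> n \<Longrightarrow> \<exists>N. col_reduction R m n c0 M N \<and> (\<forall>j. c0 < j \<longrightarrow> j < c \<longrightarrow> N l j = \<zero>)"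
proof (induction c)
  case 0
  have "col_reduction R m n c0 M M" unfolding col_reduction_def using mat_equiv_refl[OF M] by simp
  then show ?case by blast
next
  case (Suc c)
  then obtain N where red: "col_reduction R m n c0 M N" and z: "\<And>j. \<lbrakk>c0 < j; j < c\<rbrakk> \<Longrightarrow> N l j = \<zero>" by auto
  show ?case
  proof (cases "c0 < c")
    case False
    then show ?thesis using red by (intro exI[of _ N]) auto
  next
    case True
    have c: "c < n" using Suc.prems by simp
    have N: "is_mat R m n N" using mat_equiv_is_mat[OF col_reductionD(1)[OF red]] by simp
    obtain d x y where cx: "d \<in> carrier R" "x \<in> carrier R" "y \<in> carrier R"
      and x: "N l c0 = x \<otimes> d" and y: "N l c = y \<otimes> d" and xy: "comax R x y"
      by (rule hermite_ringE[OF H is_matD[OF N l c0] is_matD[OF N l c]])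
    obtain u v where cu: "u \<in> carrier R" "v \<in> carrier R" and uv: "u \<otimes> x \<oplus> v \<otimes> y = \<one>"
      using xy by (rule comaxE)
    have "u \<otimes> x \<ominus> v \<otimes> \<ominus> y = u \<otimes> x \<oplus> v \<otimes> y" using cx cu by algebra
    then have s: "sl2 R u v (\<ominus> y) x" using cx cu uv by (simp add: sl2_def)
    let ?N = "col_op R c0 c u v (\<ominus> y) x N"
    have "mat_equiv R m n M ?N"
      using mat_equiv_col_op[OF col_reductionD(1)[OF red] c0 c _ s] True by simp
    moreover have "?N i j = M i j" if "i < m" "j < c0" for i j
      using col_reductionD(2)[OF red that] that True by (simp add: row_op_def)
    moreover have "d' divides ?N i j" if i: "i < m" and d': "d' \<in> carrier R" and D: "\<forall>j\<in>{c0..<n}. d' divides M i j"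
      and j: "j \<in> {c0..<n}" for i j d'
    proof -
      have *: "d' divides N i j'" if "c0 \<le> j'" "j' < n" for j'
        using that D by (intro col_reductionD(3)[OF red i _ _ d']) auto
      show ?thesis
        using * j c0 c True cx cu d' by (auto simp: row_op_def intro!: divides_combination)
    qed
    ultimately have "col_reduction R m n c0 M ?N" unfolding col_reduction_def by blast
    moreover have "?N l j = \<zero>" if "c0 < j" "j < Suc c" for j
    proof (cases "j = c")
      case True
      have "\<ominus> y \<otimes> (x \<otimes> d) \<oplus> x \<otimes> (y \<otimes> d) = \<zero>" using cx by algebra
      then show ?thesis using True that x y by (simp add: row_op_def)
    next
      case False
      then show ?thesis using that z by (simp add: row_op_def)
    qed
    ultimately show ?thesis by blast
  qed
qed

text \<open>Row and column operations bring a gcd of all entries of the matrix with rows (d, 0) and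
  (e, f) to its upper left corner. After division by g the matrix is unimodular, and Kaplansky's
  condition gives vectors (\<alpha>, \<beta>) and (y, x) on which its bilinear form takes the value
  1.\<close>

lemma two_by_two_gcd:
  assumes H: "hermite_ring R" and K: "kaplansky_condition R"
    and cc: "d \<in> carrier R" "e \<in> carrier R" "f \<in> carrier R"
  obtains g \<alpha> \<beta> \<gamma> \<delta> \<alpha>' \<beta>' \<gamma>' \<delta>'
  where "sl2 R \<alpha> \<beta> \<gamma> \<delta>" "sl2 R \<alpha>' \<beta>' \<gamma>' \<delta>'" "g \<in> carrier R" "g divides d" "g divides e" "g divides f"
    "\<alpha>' \<otimes> (\<alpha> \<otimes> d \<oplus> \<beta> \<otimes> e) \<oplus> \<beta>' \<otimes> (\<alpha> \<otimes> \<zero> \<oplus> \<beta> \<otimes> f) = g"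
proof -
  obtain h a1 b1 where ch: "h \<in> carrier R" "a1 \<in> carrier R" "b1 \<in> carrier R"
    and d: "d = a1 \<otimes> h" and e: "e = b1 \<otimes> h" and ab: "comax R a1 b1"
    by (rule hermite_ringE[OF H cc(1,2)])
  obtain g h1 c where cg: "g \<in> carrier R" "h1 \<in> carrier R" "c \<in> carrier R"
    and h: "h = h1 \<otimes> g" and f: "f = c \<otimes> g" and hc: "comax R h1 c"
    by (rule hermite_ringE[OF H ch(1) cc(3)])
  obtain p q where cp: "p \<in> carrier R" "q \<in> carrier R" and pq: "p \<otimes> a1 \<oplus> q \<otimes> b1 = \<one>"
    using ab by (rule comaxE)
  obtain r s where cr: "r \<in> carrier R" "s \<in> carrier R" and rs: "r \<otimes> h1 \<oplus> s \<otimes> c = \<one>"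
    using hc by (rule comaxE)
  define a where "a = a1 \<otimes> h1"
  define b where "b = b1 \<otimes> h1"
  have ca: "a \<in> carrier R" "b \<in> carrier R" using ch cg by (auto simp: a_def b_def)
  have dg: "d = g \<otimes> a" and eg: "e = g \<otimes> b" and fg: "f = g \<otimes> c"
    unfolding d e f h a_def b_def using ch(2,3) cg by (simp_all add: m_ac)
  have "s \<otimes> c \<oplus> (r \<otimes> q) \<otimes> b \<oplus> (r \<otimes> p) \<otimes> a = r \<otimes> h1 \<otimes> (p \<otimes> a1 \<oplus> q \<otimes> b1) \<oplus> s \<otimes> c"
    unfolding a_def b_def using ch(2,3) cg cp cr by algebra
  also have "\<dots> = \<one>" unfolding pq using rs cr cg by simp
  finally have one: "s \<otimes> c \<oplus> (r \<otimes> q) \<otimes> b \<oplus> (r \<otimes> p) \<otimes> a = \<one>" .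
  have "\<exists>\<alpha>\<in>carrier R. \<exists>\<beta>\<in>carrier R. \<exists>\<gamma>\<in>carrier R. \<alpha> \<otimes> c \<oplus> \<beta> \<otimes> b \<oplus> \<gamma> \<otimes> a = \<one>"
    by (intro bexI[of _ s] bexI[of _ "r \<otimes> q"] bexI[of _ "r \<otimes> p"] one m_closed cr cp)
  \<comment> \<open>The condition is phrased for rows (a, b) and (0, c), while the zero sits in the
    other corner here; hence c and a trade places.\<close>
  with K[unfolded kaplansky_condition_def, THEN bspec, OF cg(3), THEN bspec, OF ca(2), THEN bspec, OF ca(1)]
  have "\<exists>x\<in>carrier R. \<exists>y\<in>carrier R. comax R (c \<otimes> x \<oplus> b \<otimes> y) (a \<otimes> y)" by (rule mp)
  then obtain x y where cx: "x \<in> carrier R" "y \<in> carrier R" and xy: "comax R (c \<otimes> x \<oplus> b \<otimes> y) (a \<otimes> y)" by blast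
  obtain \<beta> \<alpha> where cb: "\<beta> \<in> carrier R" "\<alpha> \<in> carrier R" and E: "\<beta> \<otimes> (c \<otimes> x \<oplus> b \<otimes> y) \<oplus> \<alpha> \<otimes> (a \<otimes> y) = \<one>"
    using xy by (rule comaxE)
  show thesis
  proof (rule that)
    \<comment> \<open>The single identity \<open>E\<close> serves as both determinants: (\<alpha>,
      \<beta>) is completed by the form evaluated at (y, x), and (y, x) by the form evaluated at
      (\<alpha>, \<beta>), up to order and sign.\<close>
    have "\<alpha> \<otimes> (a \<otimes> y) \<ominus> \<beta> \<otimes> (\<ominus> (c \<otimes> x \<oplus> b \<otimes> y)) = \<beta> \<otimes> (c \<otimes> x \<oplus> b \<otimes> y) \<oplus> \<alpha> \<otimes> (a \<otimes> y)"
      using cx cb ca cg by algebra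
    then show "sl2 R \<alpha> \<beta> (\<ominus> (c \<otimes> x \<oplus> b \<otimes> y)) (a \<otimes> y)"
      using E cx cb ca cg by (simp add: sl2_def)
    have "y \<otimes> (\<alpha> \<otimes> a \<oplus> \<beta> \<otimes> b) \<ominus> x \<otimes> (\<ominus> (\<beta> \<otimes> c)) = \<beta> \<otimes> (c \<otimes> x \<oplus> b \<otimes> y) \<oplus> \<alpha> \<otimes> (a \<otimes> y)"
      using cx cb ca cg by algebra
    then show "sl2 R y x (\<ominus> (\<beta> \<otimes> c)) (\<alpha> \<otimes> a \<oplus> \<beta> \<otimes> b)"
      using E cx cb ca cg by (simp add: sl2_def)
    show "g \<in> carrier R" by fact
    show "g divides d" "g divides e" "g divides f" unfolding factor_def using dg eg fg ca cg by blast+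
    have "y \<otimes> (\<alpha> \<otimes> d \<oplus> \<beta> \<otimes> e) \<oplus> x \<otimes> (\<alpha> \<otimes> \<zero> \<oplus> \<beta> \<otimes> f)
        = g \<otimes> (\<beta> \<otimes> (c \<otimes> x \<oplus> b \<otimes> y) \<oplus> \<alpha> \<otimes> (a \<otimes> y))"
      unfolding dg eg fg using cx cb ca cg by algebra
    then show "y \<otimes> (\<alpha> \<otimes> d \<oplus> \<beta> \<otimes> e) \<oplus> x \<otimes> (\<alpha> \<otimes> \<zero> \<oplus> \<beta> \<otimes> f) = g"
      unfolding E using cg by simp
  qed
qed

lemma offdiag_zero_transpose: "offdiag_zero R m n k N \<Longrightarrow> offdiag_zero R n m k (mat_transpose N)"
  by (auto simp: offdiag_zero_def)

lemma offdiag_zero_row_op: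
  assumes N: "offdiag_zero R m n k N" and "k \<le> i" "k \<le> j" "i < m" "j < m" and s: "sl2 R \<alpha> \<beta> \<gamma> \<delta>"
  shows "offdiag_zero R m n k (row_op R i j \<alpha> \<beta> \<gamma> \<delta> N)"
proof -
  have "\<alpha> \<in> carrier R" "\<beta> \<in> carrier R" "\<gamma> \<in> carrier R" "\<delta> \<in> carrier R" using s by (auto simp: sl2_def)
  moreover have "N i q = \<zero>" "N j q = \<zero>" if "q < k" "q < n" for q
    using that assms by (auto simp: offdiag_zero_def)
  ultimately show ?thesis using assms unfolding offdiag_zero_def row_op_def by auto
qed

lemma offdiag_zero_col_op:
  assumes "offdiag_zero R m n k N" "k \<le> i" "k \<le> j" "i < n" "j < n" "sl2 R \<alpha> \<beta> \<gamma> \<delta>"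
  shows "offdiag_zero R m n k (col_op R i j \<alpha> \<beta> \<gamma> \<delta> N)"
  using offdiag_zero_transpose[OF offdiag_zero_row_op[OF offdiag_zero_transpose[OF assms(1)] assms(2-6)]] .

lemma block_dvd_row_op:
  assumes "block_dvd R k l n g N" "i \<in> {k..<l}" "j \<in> {k..<l}" "sl2 R \<alpha> \<beta> \<gamma> \<delta>" "g \<in> carrier R"
  shows "block_dvd R k l n g (row_op R i j \<alpha> \<beta> \<gamma> \<delta> N)"
  using assms unfolding block_dvd_def row_op_def sl2_def by (auto intro!: divides_combination)

lemma block_dvd_col_op:
  assumes "block_dvd R k l n g N" "i \<in> {k..<n}" "j \<in> {k..<n}" "sl2 R \<alpha> \<beta> \<gamma> \<delta>" "g \<in> carrier R"
  shows "block_dvd R k l n g (col_op R i j \<alpha> \<beta> \<gamma> \<delta> N)"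
  using assms unfolding block_dvd_def row_op_def sl2_def by (auto intro!: divides_combination)

lemma block_dvd_mono:
  assumes "block_dvd R k l n d N" "g divides d" "is_mat R m n N" "l \<le> m" "g \<in> carrier R"
  shows "block_dvd R k l n g N"
  using assms divides_trans[OF assms(2)] unfolding block_dvd_def is_mat_def by auto

text \<open>Row l is added to a block already divisible by its corner as follows: the corner clears
  the rest of row k, Hermite steps compress row l to its first two relevant columns, and
  \<open>two_by_two_gcd\<close> treats the remaining 2 by 2 matrix.\<close>

lemma gcd_to_corner:
  assumes H: "hermite_ring R" and K: "kaplansky_condition R"
    and k: "k < m" "k < n" and M: "is_mat R m n M" and oz: "offdiag_zero R m n k M"
  shows "\<lbrakk>k < l; l \<le> m\<rbrakk> \<Longrightarrow> \<exists>N. mat_equiv R m n M N \<and> offdiag_zero R m n k N \<and> block_dvd R k l n (N k k) N"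
proof (induction l)
  case 0
  then show ?case by simp
next
  case (Suc l)
  show ?case
  proof (cases "l = k")
    case True
    obtain N where red: "col_reduction R m n k M N" and z: "\<And>j. \<lbrakk>k < j; j < n\<rbrakk> \<Longrightarrow> N k j = \<zero>"
      using hermite_row[OF H M k order_refl] by blast
    have N: "is_mat R m n N" using mat_equiv_is_mat[OF col_reductionD(1)[OF red]] by simp
    have "N k k divides N k j" if "k \<le> j" "j < n" for j
      using that z[of j] is_matD[OF N k] divides_zero' divides_refl by (cases "j = k") auto
    then have "block_dvd R k (Suc l) n (N k k) N" unfolding block_dvd_def True by (auto simp: less_Suc_eq)
    then show ?thesis using col_reductionD(1)[OF red] col_reduction_offdiag_zero[OF red oz order_refl] by blast
  next
    case False
    then have l: "k < l" "l < m" using Suc.prems by auto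
    obtain N0 where eq0: "mat_equiv R m n M N0" and oz0: "offdiag_zero R m n k N0" and bd0: "block_dvd R k l n (N0 k k) N0"
      using Suc.IH l by auto
    have m0: "is_mat R m n N0" using mat_equiv_is_mat[OF eq0] by simp
    have "N0 k k divides N0 k j" if "k < j" "j < n" for j
      using bd0 that l unfolding block_dvd_def by auto
    then obtain N1 where red1: "col_reduction R m n k N0 N1" and col1: "\<And>i. i < m \<Longrightarrow> N1 i k = N0 i k"
      and z1: "\<And>j. \<lbrakk>k < j; j < n\<rbrakk> \<Longrightarrow> N1 k j = \<zero>"
      by (rule clear_row[OF m0 k]) blast+
    have eq1: "mat_equiv R m n M N1" by (rule mat_equiv_trans[OF eq0 col_reductionD(1)[OF red1]])
    have m1: "is_mat R m n N1" using mat_equiv_is_mat[OF eq1] by simp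
    have oz1: "offdiag_zero R m n k N1" by (rule col_reduction_offdiag_zero[OF red1 oz0 order_refl])
    have bd1: "block_dvd R k l n (N1 k k) N1"
      unfolding col1[OF k(1)]
      using col_reduction_block_dvd[OF red1 bd0 order_refl less_imp_le[OF l(2)] is_matD[OF m0 k]] .
    have kl: "k \<in> {k..<Suc l}" "l \<in> {k..<Suc l}" using l by auto
    show ?thesis
    proof (cases "Suc k < n")
      \<comment> \<open>Column k is the last one, so a Hermite step on rows k and l is
        enough.\<close>
      case False
      obtain g x y where cg: "g \<in> carrier R" "x \<in> carrier R" "y \<in> carrier R"
        and x: "N1 k k = x \<otimes> g" and y: "N1 l k = y \<otimes> g" and xy: "comax R x y"
        by (rule hermite_ringE[OF H is_matD[OF m1 k] is_matD[OF m1 l(2) k(2)]])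
      obtain u v where cu: "u \<in> carrier R" "v \<in> carrier R" and uv: "u \<otimes> x \<oplus> v \<otimes> y = \<one>"
        using xy by (rule comaxE)
      have "u \<otimes> x \<ominus> v \<otimes> \<ominus> y = u \<otimes> x \<oplus> v \<otimes> y" using cg cu by algebra
      then have s: "sl2 R u v (\<ominus> y) x" using cg cu uv by (simp add: sl2_def)
      let ?N = "row_op R k l u v (\<ominus> y) x N1"
      have gx: "g divides N1 k k" "g divides N1 l k"
        unfolding x y factor_def using cg m_comm by blast+
      have "block_dvd R k (Suc l) n g N1"
        using block_dvd_mono[OF bd1 gx(1) m1 less_imp_le[OF l(2)] cg(1)] gx(2) False
        unfolding block_dvd_def by (auto simp: less_Suc_eq) (metis le_neq_implies_less less_Suc_eq_le not_less_eq order_less_le_trans)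
      then have "block_dvd R k (Suc l) n g ?N" by (rule block_dvd_row_op[OF _ kl s cg(1)])
      moreover have "?N k k = g"
      proof -
        have "u \<otimes> (x \<otimes> g) \<oplus> v \<otimes> (y \<otimes> g) = (u \<otimes> x \<oplus> v \<otimes> y) \<otimes> g"
          using cg cu by algebra
        then show ?thesis using x y uv cg by (simp add: row_op_def)
      qed
      moreover have "mat_equiv R m n M ?N" using mat_equiv_row_op[OF eq1 k(1) l(2) _ s] l by simp
      moreover have "offdiag_zero R m n k ?N" by (rule offdiag_zero_row_op[OF oz1 _ _ k(1) l(2) s]) (use l in auto)
      ultimately show ?thesis by metis
    next
      case True
      \<comment> \<open>Starting at column k + 1 leaves column k alone and keeps the zeros of row k.
        Rows k, l and columns k, k + 1 then hold a matrix with rows (d, 0) and (e, f), and row l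
        vanishes further right.\<close>
      obtain N2 where red2: "col_reduction R m n (Suc k) N1 N2" and z2: "\<And>j. \<lbrakk>Suc k < j; j < n\<rbrakk> \<Longrightarrow> N2 l j = \<zero>"
        using hermite_row[OF H m1 l(2) True order_refl] by blast
      have eq2: "mat_equiv R m n M N2" by (rule mat_equiv_trans[OF eq1 col_reductionD(1)[OF red2]])
      have m2: "is_mat R m n N2" using mat_equiv_is_mat[OF eq2] by simp
      have oz2: "offdiag_zero R m n k N2" by (rule col_reduction_offdiag_zero[OF red2 oz1]) simp
      have kk2: "N2 k k = N1 k k" using col_reductionD(2)[OF red2 k(1)] by simp
      have bd2: "block_dvd R k l n (N2 k k) N2"
        unfolding kk2 by (rule col_reduction_block_dvd[OF red2 bd1 _ less_imp_le[OF l(2)] is_matD[OF m1 k]]) simp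
      have zk: "N2 k (Suc k) = \<zero>"
      proof -
        have "\<zero> divides N2 k (Suc k)"
          by (rule col_reductionD(3)[OF red2 k(1) order_refl True zero_closed]) (simp add: z1 divides_zero')
        then show ?thesis using zero_divides_iff is_matD[OF m2 k(1) True] by simp
      qed
      obtain g \<alpha> \<beta> \<gamma> \<delta> \<alpha>' \<beta>' \<gamma>' \<delta>' where s: "sl2 R \<alpha> \<beta> \<gamma> \<delta>" and s': "sl2 R \<alpha>' \<beta>' \<gamma>' \<delta>'" and cg: "g \<in> carrier R"
        and gd: "g divides N2 k k" "g divides N2 l k" "g divides N2 l (Suc k)"
        and g: "\<alpha>' \<otimes> (\<alpha> \<otimes> N2 k k \<oplus> \<beta> \<otimes> N2 l k) \<oplus> \<beta>' \<otimes> (\<alpha> \<otimes> \<zero> \<oplus> \<beta> \<otimes> N2 l (Suc k)) = g"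
        by (rule two_by_two_gcd[OF H K is_matD[OF m2 k] is_matD[OF m2 l(2) k(2)] is_matD[OF m2 l(2) True]])
      have "g divides N2 l j" if kj: "k \<le> j" "j < n" for j
      proof -
        consider "j = k" | "j = Suc k" | "Suc k < j" using kj by linarith
        then show ?thesis using gd z2 kj divides_zero'[OF cg] by cases auto
      qed
      then have "block_dvd R k (Suc l) n g N2"
        using block_dvd_mono[OF bd2 gd(1) m2 less_imp_le[OF l(2)] cg]
        unfolding block_dvd_def by (auto simp: less_Suc_eq)
      \<comment> \<open>g divides the whole block before the two operations, and common divisors
        survive them; afterwards g itself is the corner entry.\<close>
      then have "block_dvd R k (Suc l) n g (row_op R k l \<alpha> \<beta> \<gamma> \<delta> N2)" by (rule block_dvd_row_op[OF _ kl s cg])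
      then have "block_dvd R k (Suc l) n g (col_op R k (Suc k) \<alpha>' \<beta>' \<gamma>' \<delta>' (row_op R k l \<alpha> \<beta> \<gamma> \<delta> N2))"
        by (rule block_dvd_col_op[OF _ _ _ s' cg]) (use True in auto)
      moreover have "col_op R k (Suc k) \<alpha>' \<beta>' \<gamma>' \<delta>' (row_op R k l \<alpha> \<beta> \<gamma> \<delta> N2) k k = g"
        using g zk by (simp add: row_op_def)
      moreover have "mat_equiv R m n M (row_op R k l \<alpha> \<beta> \<gamma> \<delta> N2)"
        using mat_equiv_row_op[OF eq2 k(1) l(2) _ s] l by simp
      then have "mat_equiv R m n M (col_op R k (Suc k) \<alpha>' \<beta>' \<gamma>' \<delta>' (row_op R k l \<alpha> \<beta> \<gamma> \<delta> N2))"
        using mat_equiv_col_op[OF _ k(2) True _ s'] by simp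
      moreover have "offdiag_zero R m n k (row_op R k l \<alpha> \<beta> \<gamma> \<delta> N2)"
        by (rule offdiag_zero_row_op[OF oz2 _ _ k(1) l(2) s]) (use l in auto)
      then have "offdiag_zero R m n k (col_op R k (Suc k) \<alpha>' \<beta>' \<gamma>' \<delta>' (row_op R k l \<alpha> \<beta> \<gamma> \<delta> N2))"
        by (rule offdiag_zero_col_op[OF _ _ _ k(2) True s']) auto
      ultimately show ?thesis by metis
    qed
  qed
qed

lemma diagonalize_step:
  assumes H: "hermite_ring R" and K: "kaplansky_condition R"
    and k: "k < m" "k < n" and M: "is_mat R m n M" and oz: "offdiag_zero R m n k M"
  shows "\<exists>N. mat_equiv R m n M N \<and> offdiag_zero R m n (Suc k) N"
proof -
  obtain N0 where eq0: "mat_equiv R m n M N0" and oz0: "offdiag_zero R m n k N0" and bd0: "block_dvd R k m n (N0 k k) N0"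
    using gcd_to_corner[OF H K k M oz k(1) order_refl] by blast
  have m0: "is_mat R m n N0" using mat_equiv_is_mat[OF eq0] by simp
  have "N0 k k divides N0 k j" if "k < j" "j < n" for j
    using bd0 that k unfolding block_dvd_def by auto
  then obtain N1 where red1: "col_reduction R m n k N0 N1" and col1: "\<And>i. i < m \<Longrightarrow> N1 i k = N0 i k"
    and z1: "\<And>j. \<lbrakk>k < j; j < n\<rbrakk> \<Longrightarrow> N1 k j = \<zero>"
    by (rule clear_row[OF m0 k]) blast+
  have eq1: "mat_equiv R m n M N1" by (rule mat_equiv_trans[OF eq0 col_reductionD(1)[OF red1]])
  have m1: "is_mat R m n N1" using mat_equiv_is_mat[OF eq1] by simp
  have oz1: "offdiag_zero R m n k N1" by (rule col_reduction_offdiag_zero[OF red1 oz0 order_refl])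
  have "N1 k k divides N1 i k" if "k < i" "i < m" for i
    using bd0 that k col1 unfolding block_dvd_def by auto
  \<comment> \<open>Column k is cleared as row k of the transpose. The clause \<open>col2\<close>
    says that the row k cleared before stays as it is.\<close>
  then obtain N2 where red2: "col_reduction R n m k (mat_transpose N1) N2"
    and col2: "\<And>j. j < n \<Longrightarrow> N2 j k = N1 k j" and z2: "\<And>i. \<lbrakk>k < i; i < m\<rbrakk> \<Longrightarrow> N2 k i = \<zero>"
    by (rule clear_row[OF is_mat_transpose[OF m1] k(2,1)]) blast+
  have "mat_equiv R m n N1 (mat_transpose N2)"
    using mat_equiv_transpose[OF col_reductionD(1)[OF red2]] .
  then have "mat_equiv R m n M (mat_transpose N2)" by (rule mat_equiv_trans[OF eq1])
  moreover have "offdiag_zero R n m k N2"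
    by (rule col_reduction_offdiag_zero[OF red2 offdiag_zero_transpose[OF oz1] order_refl])
  then have "offdiag_zero R m n (Suc k) (mat_transpose N2)"
    using col2 z1 z2 unfolding offdiag_zero_def by (auto simp: less_Suc_eq) (metis linorder_neqE_nat)+
  ultimately show ?thesis by blast
qed

lemma hermite_kaplansky_condition_imp_kaplansky:
  assumes H: "hermite_ring R" and K: "kaplansky_condition R"
  shows "kaplansky_ring R"
  unfolding kaplansky_ring_def
proof (intro allI impI)
  fix m n M assume M: "is_mat R m n M"
  have "\<exists>N. mat_equiv R m n M N \<and> offdiag_zero R m n k N" if "k \<le> min m n" for k
    using that
  proof (induction k)
    case 0
    then show ?case using mat_equiv_refl[OF M] by (auto simp: offdiag_zero_def)
  next
    case (Suc k)
    then obtain N where N: "mat_equiv R m n M N" "offdiag_zero R m n k N" by auto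
    obtain N' where "mat_equiv R m n N N'" "offdiag_zero R m n (Suc k) N'"
      using diagonalize_step[OF H K _ _ mat_equiv_is_mat(2)[OF N(1)] N(2)] Suc.prems by auto
    then show ?case using mat_equiv_trans[OF N(1)] by blast
  qed
  then obtain D where D: "mat_equiv R m n M D" "offdiag_zero R m n (min m n) D" by blast
  then obtain P Q where "invertible_mat R m P" "invertible_mat R n Q" "is_mat R m n D"
    "mat_eq m n (mat_mul R n (mat_mul R m P M) Q) D"
    unfolding mat_equiv_def by blast
  moreover have "i < min m n \<or> j < min m n" if "i < m" "j < n" for i j using that by linarith
  then have "\<forall>i<m. \<forall>j<n. i \<noteq> j \<longrightarrow> D i j = \<zero>" using D(2) unfolding offdiag_zero_def by blast
  ultimately show "\<exists>P Q D. invertible_mat R m P \<and> invertible_mat R n Q \<and> is_mat R m n D \<and>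
         (\<forall>i<m. \<forall>j<n. i \<noteq> j \<longrightarrow> D i j = \<zero>) \<and>
         (\<forall>i<m. \<forall>j<n. mat_mul R n (mat_mul R m P M) Q i j = D i j)"
    unfolding mat_eq_def by blast
qed

end

theorem theorem3p5:
  fixes R :: "('a, 'm) ring_scheme"
  assumes "cring R"
    and "frac_self_fp_injective R"
    and "bezout_ring R"
  shows "kaplansky_ring R"
proof -
  interpret cring R by fact
  have G: "gcd_ring R" by (rule bezout_imp_gcd_ring) fact
  have split: "radical_split_ring R"
    by (rule frac_self_fp_injective_imp_radical_split[OF _ G]) fact
  show ?thesis
    by (intro hermite_kaplansky_condition_imp_kaplansky hermite_ring_if_radical_split
        kaplansky_condition_if_radical_split split G)
qed

end
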